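(* Let $a,b,c\in\mathbb R$ satisfy $a,b>-1$, $0<c-a-b-2<1$ and $a+2\le c<b+2$. Then the following hold. (a) Suppose $b+1\ne 3+a+b-c$ and $0<2-c+b<1/2$. Then: (1) $T_{a,b,c}$ and $S_{a,b,c}$ map $L^p(\mathbb D)$ boundedly into $L^{q,\infty}(\mathbb D)$ if $1\le p,q\le\infty$, $\frac1q=\frac1p+c-a-b-2$ and $\frac1q>-a$, or if $0\le\frac1p<2-c+b$ and $q=-\frac1a$. At $(p,q)=\left(\frac{1}{2-c+b},-\frac1a\right)$, both $T_{a,b,c}$ and $S_{a,b,c}$ are unbounded from $L^{\frac{1}{2-c+b}}(\mathbb D)$ to $L^{-\frac1a,\infty}(\mathbb D)$. (2) $T_{a,b,c}$ and $S_{a,b,c}$ map $L^{\frac{1}{2-c+b},1}(\mathbb D)$ boundedly into $L^{-\frac1a,\infty}(\mathbb D)$. (b) Suppose $b+1=3+a+b-c$ and $0<2-c+b<1/2$. Then: (1) $T_{a,b,c}$ and $S_{a,b,c}$ map $L^p(\mathbb D)$ boundedly into $L^{q,\infty}(\mathbb D)$ if $1\le p,q\le\infty$, $\frac1q=\frac1p+c-a-b-2$ and $-a<\frac1q<1$, or if $0\le\frac1p<2-c+b$ and $q=-\frac1a$. Both $T_{a,b,c}$ and $S_{a,b,c}$ are unbounded from $L^p(\mathbb D)$ to $L^{q,\infty}(\mathbb D)$ if $(p,q)=\left(\frac{1}{2-c+b},-\frac1a\right)$ or $(p,q)=\left(\frac{1}{3+a+b-c},1\right)$. (2) $T_{a,b,c}$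 and $S_{a,b,c}$ map $L^{p,1}(\mathbb D)$ boundedly into $L^{q,\infty}(\mathbb D)$ if $(p,q)=\left(\frac{1}{2-c+b},-\frac1a\right)$ or $(p,q)=\left(\frac{1}{3+a+b-c},1\right)$. (c) Suppose $b+1\ne 3+a+b-c$ and $1/2\le 2-c+b<1$. Then: (1) $T_{a,b,c}$ and $S_{a,b,c}$ map $L^p(\mathbb D)$ boundedly into $L^{q,\infty}(\mathbb D)$ if $1\le p,q\le\infty$, $\frac1q=\frac1p+c-a-b-2$ and $\frac1q>-a$, or if $0\le\frac1p<2-c+b$ and $q=-\frac1a$. (2) $T_{a,b,c}$ maps $L^{\frac{1}{2-c+b}}(\mathbb D)$ boundedly into $L^{-\frac1a,\infty}(\mathbb D)$, while $S_{a,b,c}$ does not. (3) $T_{a,b,c}$ and $S_{a,b,c}$ map $L^{\frac{1}{2-c+b},1}(\mathbb D)$ boundedly into $L^{-\frac1a,\infty}(\mathbb D)$. (d) Suppose $b+1=3+a+b-c$ and $1/2\le 2-c+b<1$. Then: (1) $T_{a,b,c}$ and $S_{a,b,c}$ map $L^p(\mathbb D)$ boundedly into $L^{q,\infty}(\mathbb D)$ if $1\le p,q\le\infty$, $\frac1q=\frac1p+c-a-b-2$ and $-a<\frac1q<1$, or if $0\le\frac1p<2-c+b$ and $q=-\frac1a$; while at $(p,q)=\left(\frac{1}{3+a+b-c},1\right)$ both $T_{a,b,c}$ and $S_{a,b,c}$ are unbounded from $L^{\frac{1}{3+a+b-c}}(\mathbb D)$ to $L^{1,\infty}(\mathbb D)$.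 (2) $T_{a,b,c}$ maps $L^{\frac{1}{2-c+b}}(\mathbb D)$ boundedly into $L^{-\frac1a,\infty}(\mathbb D)$, while $S_{a,b,c}$ does not. (3) $T_{a,b,c}$ and $S_{a,b,c}$ map $L^{p,1}(\mathbb D)$ boundedly into $L^{q,\infty}(\mathbb D)$ if $(p,q)=\left(\frac{1}{2-c+b},-\frac1a\right)$ or $(p,q)=\left(\frac{1}{3+a+b-c},1\right)$.
   Context: $\mathbb D$ is the open unit disc in $\mathbb C$, $dA$ is normalized area measure on $\mathbb D$, and $|E|$ is the $dA$-measure of $E\subseteq\mathbb D$. For $a,b,c\in\mathbb R$, $$T_{a,b,c}f(z):=(1-|z|^2)^a\int_{\mathbb D}\frac{(1-|w|^2)^b}{(1-z\overline w)^c}f(w)\,dA(w),\qquad S_{a,b,c}f(z):=(1-|z|^2)^a\int_{\mathbb D}\frac{(1-|w|^2)^b}{|1-z\overline w|^c}f(w)\,dA(w),$$ with the principal branch of the power. $L^p(\mathbb D)=L^p(\mathbb D,dA)$. For $1\le q<\infty$, $\|f\|_{L^{q,\infty}}=\sup_{\lambda>0}\lambda|\{|f|>\lambda\}|^{1/q}$, and $L^{\infty,\infty}=L^\infty$. For $1\le p<\infty$, $\|f\|_{L^{p,1}}=p\int_0^\infty|\{|f|>\lambda\}|^{1/p}\,d\lambda$. An operator $\mathcal T$ maps $X$ boundedly into $Y$ if for every $f\in X$ the defining integral converges absolutely for a.e. $z$ and $\|\mathcal Tf\|_Y\le C\|f\|_X$ with $C$ independent of $f$; otherwise it is unbounded from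 $X$ to $Y$. *)

theory Defs
  imports "HOL-Probability.Essential_Supremum" "HOL-Analysis.Analysis"
begin

definition disc_measure :: "complex measure" where
  "disc_measure = density (lebesgue_on (ball 0 1)) (\<lambda>_. ennreal (1 / pi))"

lemma space_disc_measure [simp]: "space disc_measure = ball 0 1"
  by (simp add: disc_measure_def)

lemma sets_disc_measure: "sets disc_measure = sets (lebesgue_on (ball 0 1))"
  by (simp add: disc_measure_def)

lemma emeasure_disc_measure_ball: "emeasure disc_measure (ball 0 1) = 1"
proof -
  have "ball 0 1 \<in> sets (lebesgue_on (ball (0::complex) 1))"
    by (metis sets.top space_lebesgue_on)
  then have "emeasure disc_measure (ball 0 1) =
      ennreal (1 / pi) * emeasure (lebesgue_on (ball 0 1)) (ball (0::complex) 1)"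
    by (simp add: disc_measure_def emeasure_density nn_integral_cmult_indicator)
  also have "emeasure (lebesgue_on (ball 0 1)) (ball (0::complex) 1) = ennreal pi"
    by (simp add: emeasure_restrict_space emeasure_ball unit_ball_vol_2)
  finally show ?thesis
    by (simp flip: ennreal_mult)
qed

subsection \<open>Function (quasi-)norms\<close>

text \<open>
  Exponents \<open>p\<close>, \<open>q\<close> range over the extended reals in \<open>[1, \<infinity>]\<close>; with the library's
  division, \<open>1 / (\<infinity>::ereal) = 0\<close>. All norms take values in \<open>[0, \<infinity>]\<close>; membership in a space
  means measurability together with finiteness of its norm.
\<close>

definition Lp_norm :: "ereal \<Rightarrow> (complex \<Rightarrow> complex) \<Rightarrow> ennreal" where
  "Lp_norm p f =
    (if p = \<infinity> then esssup disc_measure (\<lambda>z. ennreal (cmod (f z)))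
     else let I = (\<integral>\<^sup>+ z. ennreal (cmod (f z) powr real_of_ereal p) \<partial>disc_measure)
          in if I = \<infinity> then \<infinity> else ennreal (enn2real I powr (1 / real_of_ereal p)))"

definition distribution :: "(complex \<Rightarrow> complex) \<Rightarrow> real \<Rightarrow> real" where
  "distribution f t = measure disc_measure {z \<in> ball 0 1. t < cmod (f z)}"

definition weak_Lp_norm :: "ereal \<Rightarrow> (complex \<Rightarrow> complex) \<Rightarrow> ennreal" where
  "weak_Lp_norm q f =
    (if q = \<infinity> then Lp_norm \<infinity> f
     else (SUP t\<in>{0::real<..}. ennreal (t * distribution f t powr (1 / real_of_ereal q))))"

definition Lorentz1_norm :: "real \<Rightarrow> (complex \<Rightarrow> complex) \<Rightarrow> ennreal" where
  "Lorentz1_norm p f =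
    ennreal p * (\<integral>\<^sup>+ t \<in> {0<..}. ennreal (distribution f t powr (1 / p)) \<partial>lborel)"

subsection \<open>The operators\<close>

text \<open>
  The complex \<open>powr\<close> is the principal branch; \<open>1 - z * cnj w\<close> has positive real part on the disc.
\<close>

definition T_kernel :: "real \<Rightarrow> real \<Rightarrow> complex \<Rightarrow> complex \<Rightarrow> complex" where
  "T_kernel b c z w =
    complex_of_real ((1 - (cmod w)\<^sup>2) powr b) / (1 - z * cnj w) powr complex_of_real c"

definition S_kernel :: "real \<Rightarrow> real \<Rightarrow> complex \<Rightarrow> complex \<Rightarrow> complex" where
  "S_kernel b c z w =
    complex_of_real ((1 - (cmod w)\<^sup>2) powr b / cmod (1 - z * cnj w) powr c)"

definition disc_op ::
  "real \<Rightarrow> (complex \<Rightarrow> complex \<Rightarrow> complex) \<Rightarrow> (complex \<Rightarrow> complex) \<Rightarrow> complex \<Rightarrow> complex" where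
  "disc_op a K f z =
    complex_of_real ((1 - (cmod z)\<^sup>2) powr a) * (\<integral>w. K z w * f w \<partial>disc_measure)"

text \<open>
  Absolute convergence at almost every point is part of boundedness: where the integrand is not
  integrable, the Bochner integral in \<open>disc_op\<close> is 0 by convention. Likewise measurability of the
  image is required, since \<open>distribution\<close> is only meaningful for measurable functions.
\<close>

definition disc_op_bounded ::
  "real \<Rightarrow> (complex \<Rightarrow> complex \<Rightarrow> complex) \<Rightarrow>
   ((complex \<Rightarrow> complex) \<Rightarrow> ennreal) \<Rightarrow> ((complex \<Rightarrow> complex) \<Rightarrow> ennreal) \<Rightarrow> bool" where
  "disc_op_bounded a K normX normY \<longleftrightarrow>
    (\<exists>C::real. \<forall>f \<in> borel_measurable disc_measure. normX f < \<infinity> \<longrightarrow>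
       (AE z in disc_measure. integrable disc_measure (\<lambda>w. K z w * f w)) \<and>
       disc_op a K f \<in> borel_measurable disc_measure \<and>
       normY (disc_op a K f) \<le> ennreal C * normX f)"

abbreviation T_bounded where
  "T_bounded a b c \<equiv> disc_op_bounded a (T_kernel b c)"

abbreviation S_bounded where
  "S_bounded a b c \<equiv> disc_op_bounded a (S_kernel b c)"

end

(*
  Everything happens on circles. Put u = 1 - |w|^2 and v = 1 - |z|^2. Averaging over rotations of z
  replaces |1 - z w*|^(-c) by max(u, v)^(1 - c) (since c > 1), so a Hoelder or Young splitting in the
  radial variable bounds the part of each circle |z| = const where the operator exceeds a given level.
  Integrating these circle estimates over v gives the weak-type bounds, because a circle never
  contributes more than its full length while the decay exponent p/q in v exceeds 1.
  At the Lorentz endpoints, the level sets {|f| > t} are split at u = |{|f| > t}|.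

  At 1/p = 2 - c + b the kernel of S fails to be radially integrable by a logarithm. For T the
  L^p means over circles still stay bounded if p <= 2: by duality this is a Littlewood-Paley estimate,
  interpolated between L^2 (Fourier series) and L^infinity. For p > 2 random signs in front of a sum of
  lacunary monomials, each on its own dyadic annulus, give a counterexample.
*)
theory Submission
  imports Defs "HOL-Probability.Probability" "HOL-Complex_Analysis.Cauchy_Integral_Theorem"
begin

section \<open>Normalized area measure, the circle and rotations\<close>

text \<open>Put \<sigma> = b + 2 - c; the hypothesis 0 < c - a - b - 2 says \<sigma> < -a. For q =
  -1/a the outer weight v^a by itself is exactly in weak L^q, so the inner integral has to stay
  bounded up to the unit circle in the sense of circle means. Radially this asks for u^(\<sigma> -
  1) in the dual of L^p, which just fails at p = 1/\<sigma>; T escapes there only through its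
  oscillation on circles. The other critical point, q = 1 and 1/p = b + 1, occurs when a = c - 2.
  There u^b just leaves the dual of L^p, the integral diverges already at z = 0 where both kernels
  agree, and oscillation cannot help: both operators fail. At the Lorentz endpoints a pairing with
  u^(\<tau> - 1), 1/\<tau> being the first Lorentz index, controls the integral of the operator over
  each circle, but Markov's inequality then decays only with exponent 1, which is too slow for q >=
  1. Hence f is compared with its decreasing rearrangement taken at the value u: that part is radial
  and bounded pointwise, and the excess of f over it admits an exponent larger than q.\<close>

definition disc_borel :: "complex measure" where
  "disc_borel = distr disc_measure borel (\<lambda>w. w)"

text \<open>Pushing the area measure forward along \<open>sgn\<close> gives normalized arc length
  without an angle parameter, so the rotation invariance of the circle is inherited from that of the
  disc. The origin, where \<open>sgn\<close> is 0, is a null set.\<close>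

definition circle_measure :: "complex measure" where
  "circle_measure = distr disc_borel borel sgn"

definition defect :: "complex \<Rightarrow> real" where
  "defect w = 1 - (cmod w)\<^sup>2"

lemma measurable_id_disc_measure: "(\<lambda>w. w) \<in> disc_measure \<rightarrow>\<^sub>M borel"
proof -
  have "(\<lambda>w::complex. w) \<in> lebesgue_on (ball 0 1) \<rightarrow>\<^sub>M borel"
    by (intro measurable_restrict_space1) (simp add: measurable_completion)
  then show ?thesis
    by (simp add: disc_measure_def)
qed

lemma borel_measurable_disc_measure: "f \<in> borel_measurable borel \<Longrightarrow> f \<in> borel_measurable disc_measure"
  by (rule measurable_compose[OF measurable_id_disc_measure])

lemma sets_disc_borel [simp, measurable_cong]: "sets disc_borel = sets borel"
  and space_disc_borel [simp]: "space disc_borel = UNIV"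
  and sets_circle_measure [simp, measurable_cong]: "sets circle_measure = sets borel"
  and space_circle_measure [simp]: "space circle_measure = UNIV"
  by (simp_all add: disc_borel_def circle_measure_def)

text \<open>\<open>disc_measure\<close> lives on Lebesgue measurable subsets of the disc, and a
  completed sigma-algebra fits badly with product measures and compositions. All estimates are
  therefore made for this Borel measure on the whole plane, concentrated on the disc; the way back
  to \<open>disc_measure\<close> is taken only when the operators themselves are treated.\<close>

lemma disc_borel_eq:
  "disc_borel = density lborel (\<lambda>w. ennreal (1 / pi) * indicator (ball 0 1) w)"
proof (rule measure_eqI)
  fix A assume "A \<in> sets disc_borel"
  then have A [measurable]: "A \<in> sets borel" by simp
  have A': "A \<inter> ball 0 1 \<in> sets (lebesgue_on (ball 0 1))"
    by (auto simp: sets_restrict_space)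
  have "emeasure disc_borel A = emeasure disc_measure (A \<inter> ball 0 1)"
    by (simp add: disc_borel_def emeasure_distr measurable_id_disc_measure)
  also have "\<dots> = ennreal (1 / pi) * emeasure (lebesgue_on (ball 0 1)) (A \<inter> ball 0 1)"
    using A' by (simp add: disc_measure_def emeasure_density nn_integral_cmult_indicator)
  also have "emeasure (lebesgue_on (ball 0 1)) (A \<inter> ball 0 1) = emeasure lborel (A \<inter> ball 0 1)"
    by (subst emeasure_restrict_space) (auto simp: emeasure_completion)
  also have "ennreal (1 / pi) * \<dots> =
      emeasure (density lborel (\<lambda>w. ennreal (1 / pi) * indicator (ball 0 1) w)) A"
    by (subst emeasure_density, measurable)
       (auto simp: nn_integral_cmult mult.assoc indicator_inter_arith[symmetric]
        Int_commute nn_integral_cmult_indicator simp flip: nn_integral_indicator)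
  finally show "emeasure disc_borel A = \<dots>" .
qed simp

lemma measurable_sgn_complex [measurable]: "(sgn :: complex \<Rightarrow> complex) \<in> borel_measurable borel"
  unfolding sgn_div_norm by measurable

interpretation disc_borel: prob_space disc_borel
proof
  show "emeasure disc_borel (space disc_borel) = 1"
    by (simp add: disc_borel_def emeasure_distr measurable_id_disc_measure emeasure_disc_measure_ball)
qed

interpretation circle_measure: prob_space circle_measure
  unfolding circle_measure_def
  by (rule disc_borel.prob_space_distr) (simp add: measurable_cong_sets[OF sets_disc_borel refl] measurable_sgn_complex)

lemma emeasure_disc_borel:
  assumes [measurable]: "A \<in> sets borel"
  shows "emeasure disc_borel A = ennreal (1 / pi) * emeasure lborel (A \<inter> ball 0 1)"
  unfolding disc_borel_eq
  by (subst emeasure_density, measurable)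
     (auto simp: nn_integral_cmult mult.assoc indicator_inter_arith[symmetric]
        Int_commute nn_integral_cmult_indicator simp flip: nn_integral_indicator)

lemma AE_disc_borel: "AE w in disc_borel. 0 < defect w \<and> defect w < 1 \<and> cmod w < 1 \<and> w \<noteq> 0"
proof -
  have "AE w in lborel. w \<noteq> (0::complex)"
    using AE_lborel_singleton[of 0] by simp
  then show ?thesis
    unfolding disc_borel_eq
    by (subst AE_density) (auto simp: defect_def abs_square_less_1 indicator_def elim!: eventually_mono split: if_splits)
qed

text \<open>Carries the invariance of volume under orthogonal maps from \<open>real^2\<close> to the
  complex plane; it is enough to compare boxes.\<close>

lemma lborel_distr_vec2_complex:
  "distr lborel borel (\<lambda>x::real^2. Complex (x $ 1) (x $ 2)) = lborel" (is "?L = _")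
proof (rule lborel_eqI[symmetric])
  have m [measurable]: "(\<lambda>x::real^2. Complex (x $ 1) (x $ 2)) \<in> borel_measurable borel"
  proof -
    have "(\<lambda>x::real^2. Complex (x $ 1) (x $ 2)) =
        (\<lambda>x. complex_of_real (x $ 1) + \<i> * complex_of_real (x $ 2))"
      by (auto simp: complex_eq_iff)
    then show ?thesis
      by (auto intro!: borel_measurable_continuous_onI continuous_intros)
  qed
  fix l u :: complex assume le: "\<And>b. b \<in> Basis \<Longrightarrow> l \<bullet> b \<le> u \<bullet> b"
  then have le': "Re l \<le> Re u" "Im l \<le> Im u"
    using le[of 1] le[of \<i>] by (auto simp: Basis_complex_def)
  have "(\<lambda>x::real^2. Complex (x $ 1) (x $ 2)) -` box l u = box (vector [Re l, Im l]) (vector [Re u, Im u])"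
    by (auto simp: box_def Basis_complex_def mem_box_cart forall_2 Basis_vec_def inner_axis)
  then have "emeasure ?L (box l u) = emeasure lborel (box (vector [Re l, Im l]) (vector [Re u, Im u]) :: (real^2) set)"
    by (simp add: emeasure_distr)
  also have "\<dots> = ennreal ((Re u - Re l) * (Im u - Im l))"
    using le'
    by (subst emeasure_lborel_box)
       (auto simp: Basis_vec_def inner_axis cart_basis_def forall_2 UNIV_2 axis_eq_axis prod.UNION_disjoint)
  also have "(Re u - Re l) * (Im u - Im l) = (\<Prod>b\<in>Basis. (u - l) \<bullet> b)"
    by (auto simp: Basis_complex_def complex_eq_iff)
  finally show "emeasure ?L (box l u) = \<dots>" by simp
qed simp


text \<open>In real coordinates the multiplication is the map \<open>R\<close>, with orthogonal
  inverse \<open>R'\<close>; both facts come from the sum of squares of the two coordinates of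
  \<open>\<zeta>\<close> being 1.\<close>

lemma lborel_rotate_complex:
  assumes "cmod \<zeta> = 1"
  shows "distr lborel borel (\<lambda>w. \<zeta> * w) = lborel"
proof -
  let ?h = "\<lambda>x::real^2. Complex (x $ 1) (x $ 2)"
  define R :: "real^2 \<Rightarrow> real^2" where
    "R x = vector [Re \<zeta> * x $ 1 - Im \<zeta> * x $ 2, Re \<zeta> * x $ 2 + Im \<zeta> * x $ 1]" for x
  define R' :: "real^2 \<Rightarrow> real^2" where
    "R' x = vector [Re \<zeta> * x $ 1 + Im \<zeta> * x $ 2, Re \<zeta> * x $ 2 - Im \<zeta> * x $ 1]" for x
  have \<zeta>: "(Re \<zeta>)\<^sup>2 + (Im \<zeta>)\<^sup>2 = 1"
    using assms by (simp add: cmod_def)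
  have RR': "R (R' x) = x" and R'R: "R' (R x) = x" for x
  proof -
    have "((Re \<zeta>)\<^sup>2 + (Im \<zeta>)\<^sup>2) * t = t" for t
      using \<zeta> by simp
    then have "Re \<zeta> * (Re \<zeta> * t) + Im \<zeta> * (Im \<zeta> * t) = t" for t
      by (simp add: power2_eq_square distrib_right mult.assoc)
    then show "R (R' x) = x" "R' (R x) = x"
      by (auto simp: R_def R'_def vec_eq_iff forall_2 right_diff_distrib distrib_left mult.left_commute[of "Im \<zeta>" "Re \<zeta>"])
  qed
  have ort: "orthogonal_transformation R'"
    unfolding orthogonal_transformation
  proof
    show "linear R'"
      by (rule linearI) (auto simp: R'_def vec_eq_iff forall_2 algebra_simps)
    have "(norm (R' v))\<^sup>2 = (norm v)\<^sup>2" for v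
    proof -
      have "(norm (R' v))\<^sup>2 = ((Re \<zeta>)\<^sup>2 + (Im \<zeta>)\<^sup>2) * ((v $ 1)\<^sup>2 + (v $ 2)\<^sup>2)"
        unfolding power2_norm_eq_inner by (simp add: R'_def inner_vec_def sum_2 algebra_simps power2_eq_square)
      then show ?thesis
        using \<zeta> unfolding power2_norm_eq_inner by (simp add: inner_vec_def sum_2 power2_eq_square)
    qed
    then show "\<forall>v. norm (R' v) = norm v"
      by (simp add: power2_eq_iff_nonneg)
  qed
  have meas: "?h \<in> borel_measurable borel"
  proof -
    have "?h = (\<lambda>x. complex_of_real (x $ 1) + \<i> * complex_of_real (x $ 2))"
      by (auto simp: complex_eq_iff)
    then show ?thesis
      by (auto intro!: borel_measurable_continuous_onI continuous_intros)
  qed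
  have linR: "linear R"
    by (rule linearI) (auto simp: R_def vec_eq_iff forall_2 algebra_simps)
  then have measR [measurable]: "R \<in> borel_measurable borel"
    by (intro borel_measurable_continuous_onI linear_continuous_on linear_conv_bounded_linear[THEN iffD1])
  have R: "distr lborel borel R = lborel"
  proof (rule lborel_eqI[symmetric])
    fix l u :: "real^2" assume le: "\<And>b. b \<in> Basis \<Longrightarrow> l \<bullet> b \<le> u \<bullet> b"
    \<comment> \<open>Preimages under \<open>R\<close> are rewritten as images under the inverse
      rotation \<open>R'\<close>, because the volume formula for orthogonal maps speaks about
      images.\<close>
    have "R -` box l u = R' ` box l u"
    proof
      show "R -` box l u \<subseteq> R' ` box l u"
        using R'R by (metis image_eqI subsetI vimageD)
      show "R' ` box l u \<subseteq> R -` box l u"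
        using RR' by auto
    qed
    then have "emeasure (distr lborel borel R) (box l u) = emeasure lborel (R' ` box l u)"
      by (simp add: emeasure_distr)
    also have "\<dots> = emeasure lebesgue (R' ` box l u)"
    proof -
      have "R -` box l u \<inter> space borel \<in> sets borel"
        by (rule measurable_sets[OF measR]) auto
      then have "R' ` box l u \<in> sets lborel"
        using \<open>R -` box l u = R' ` box l u\<close> by simp
      then show ?thesis
        by (simp add: sets_completionI_sets main_part_sets emeasure_completion)
    qed
    also have "\<dots> = ennreal (measure lebesgue (R' ` box l u))"
      using measurable_orthogonal_image[OF ort lmeasurable_box, of l u]
      by (intro emeasure_eq_ennreal_measure fmeasurableD2)
    also have "\<dots> = ennreal (measure lborel (box l u))"
      using measure_orthogonal_image[OF ort lmeasurable_box, of l u] by simp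
    finally show "emeasure (distr lborel borel R) (box l u) = ennreal (\<Prod>b\<in>Basis. (u - l) \<bullet> b)"
      using le by (auto simp: measure_lborel_box_eq)
  qed simp
  have "distr lborel borel (\<lambda>w. \<zeta> * w) = distr (distr lborel borel ?h) borel (\<lambda>w. \<zeta> * w)"
    by (simp add: lborel_distr_vec2_complex)
  also have "\<dots> = distr lborel borel (\<lambda>x. \<zeta> * ?h x)"
    using meas by (subst distr_distr) (auto simp: o_def)
  also have "(\<lambda>x. \<zeta> * ?h x) = (\<lambda>x. ?h (R x))"
    by (auto simp: complex_eq_iff R_def)
  also have "distr lborel borel (\<lambda>x. ?h (R x)) = distr (distr lborel borel R) borel ?h"
    using meas by (subst distr_distr) (auto simp: o_def)
  also have "\<dots> = lborel"
    by (simp add: R lborel_distr_vec2_complex)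
  finally show ?thesis .
qed

lemma disc_borel_rotate:
  assumes "cmod \<zeta> = 1"
  shows "distr disc_borel borel (\<lambda>w. \<zeta> * w) = disc_borel"
proof (rule measure_eqI)
  fix A assume "A \<in> sets (distr disc_borel borel (\<lambda>w. \<zeta> * w))"
  then have A [measurable]: "A \<in> sets borel" by simp
  have [measurable]: "ball (0::complex) 1 \<in> sets borel" by simp
  have "emeasure (distr disc_borel borel (\<lambda>w. \<zeta> * w)) A = (\<integral>\<^sup>+w. indicator A (\<zeta> * w) \<partial>disc_borel)"
    by (subst nn_integral_indicator[symmetric], simp, subst nn_integral_distr) auto
  also have "\<dots> = (\<integral>\<^sup>+w. ennreal (1 / pi) * indicator (ball 0 1) (\<zeta> * w) * indicator A (\<zeta> * w) \<partial>lborel)"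
    unfolding disc_borel_eq using assms
    by (subst nn_integral_density) (auto simp: norm_mult indicator_def intro!: nn_integral_cong)
  also have "\<dots> = (\<integral>\<^sup>+w. ennreal (1 / pi) * indicator (ball 0 1) w * indicator A w
      \<partial>distr lborel borel (\<lambda>w. \<zeta> * w))"
    by (subst nn_integral_distr) (auto, measurable)
  also have "\<dots> = emeasure disc_borel A"
    unfolding lborel_rotate_complex[OF assms] disc_borel_eq by (simp add: emeasure_density)
  finally show "emeasure (distr disc_borel borel (\<lambda>w. \<zeta> * w)) A = emeasure disc_borel A" .
qed simp

lemma AE_circle_measure: "AE \<zeta> in circle_measure. cmod \<zeta> = 1"
  unfolding circle_measure_def
  using AE_disc_borel by (subst AE_distr_iff, measurable) (auto simp: norm_sgn elim!: eventually_mono)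

lemma nn_integral_disc_rotate:
  assumes "cmod \<zeta> = 1" and [measurable]: "f \<in> borel_measurable borel"
  shows "(\<integral>\<^sup>+w. f (\<zeta> * w) \<partial>disc_borel) = (\<integral>\<^sup>+w. f w \<partial>disc_borel)"
  by (subst (2) disc_borel_rotate[OF assms(1), symmetric], subst nn_integral_distr) auto

lemma circle_measure_rotate:
  assumes "cmod \<zeta> = 1"
  shows "distr circle_measure borel (\<lambda>w. \<zeta> * w) = circle_measure"
proof -
  have "distr circle_measure borel (\<lambda>w. \<zeta> * w) = distr disc_borel borel (\<lambda>w. \<zeta> * sgn w)"
    unfolding circle_measure_def by (subst distr_distr) (auto simp: o_def)
  also have "(\<lambda>w. \<zeta> * sgn w) = (\<lambda>w. sgn (\<zeta> * w))"
    using assms by (auto simp: sgn_div_norm norm_mult)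
  also have "distr disc_borel borel \<dots> = distr (distr disc_borel borel (\<lambda>w. \<zeta> * w)) borel sgn"
    by (subst distr_distr) (auto simp: o_def)
  finally show ?thesis
    by (simp add: disc_borel_rotate[OF assms] circle_measure_def)
qed

lemma nn_integral_circle_rotate:
  assumes "cmod \<zeta> = 1" and [measurable]: "f \<in> borel_measurable borel"
  shows "(\<integral>\<^sup>+w. f (\<zeta> * w) \<partial>circle_measure) = (\<integral>\<^sup>+w. f w \<partial>circle_measure)"
  by (subst (2) circle_measure_rotate[OF assms(1), symmetric], subst nn_integral_distr) auto

text \<open>Each rotation leaves the integral over the disc unchanged, so it may be averaged over
  \<open>\<zeta>\<close>, and Tonelli moves the average inside. This takes the place of polar
  coordinates throughout.\<close>

lemma nn_integral_disc_average:
  assumes [measurable]: "f \<in> borel_measurable borel"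
  shows "(\<integral>\<^sup>+w. f w \<partial>disc_borel) = (\<integral>\<^sup>+w. \<integral>\<^sup>+\<zeta>. f (\<zeta> * w) \<partial>circle_measure \<partial>disc_borel)"
proof -
  interpret pair_sigma_finite circle_measure disc_borel ..
  have "(\<integral>\<^sup>+w. f w \<partial>disc_borel) = (\<integral>\<^sup>+\<zeta>. \<integral>\<^sup>+w. f w \<partial>disc_borel \<partial>circle_measure)"
    by (simp add: circle_measure.emeasure_space_1[simplified])
  also have "\<dots> = (\<integral>\<^sup>+\<zeta>. \<integral>\<^sup>+w. f (\<zeta> * w) \<partial>disc_borel \<partial>circle_measure)"
    using AE_circle_measure by (intro nn_integral_cong_AE) (auto simp: nn_integral_disc_rotate)
  also have "\<dots> = (\<integral>\<^sup>+w. \<integral>\<^sup>+\<zeta>. f (\<zeta> * w) \<partial>circle_measure \<partial>disc_borel)"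
    by (subst Fubini') auto
  finally show ?thesis .
qed

lemma measurable_defect [measurable]: "defect \<in> borel_measurable borel"
  unfolding defect_def by measurable

lemma defect_rotate: "cmod \<zeta> = 1 \<Longrightarrow> defect (\<zeta> * w) = defect w"
  by (simp add: defect_def norm_mult)

text \<open>For 0 <= x < 1 the set where the defect exceeds x is a disc of squared radius 1 - x,
  hence of normalized area 1 - x. So u = 1 - |w|^2 is uniform on the unit interval, which makes it
  the natural radial variable: no Jacobian appears.\<close>

lemma distr_defect: "distr disc_borel borel defect = density lborel (indicator {0<..<1})"
proof (rule measure_eqI_lessThan)
  fix x :: real
  let ?M = "density lborel (indicator {0<..<1::real})"
  have *: "emeasure disc_borel {w. x < defect w} = ennreal (min 1 (1 - x))" if "x < 1"
  proof (cases "x < 0")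
    case True
    have "emeasure disc_borel {w. x < defect w} = emeasure disc_borel UNIV"
      using AE_disc_borel True by (intro emeasure_eq_AE) auto
    then show ?thesis
      using True by (simp add: disc_borel.emeasure_space_1[simplified])
  next
    case False
    define r where "r = sqrt (1 - x)"
    have r: "0 \<le> r" "r \<le> 1" "r\<^sup>2 = 1 - x"
      using False that by (auto simp: r_def)
    have iff: "x < defect w \<longleftrightarrow> cmod w < r" for w
    proof -
      have "(cmod w)\<^sup>2 < r\<^sup>2 \<longleftrightarrow> cmod w < r"
        using r(1) by (simp add: not_le[symmetric] power_mono_iff)
      then show ?thesis
        using r by (auto simp: defect_def)
    qed
    have eq: "{w. x < defect w} \<inter> ball 0 1 = ball 0 r"
    proof (rule set_eqI)
      fix w show "w \<in> {w. x < defect w} \<inter> ball 0 1 \<longleftrightarrow> w \<in> ball 0 r"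
        using r(2) by (simp only: Int_iff mem_Collect_eq mem_ball_0 iff) (metis less_le_trans)
    qed
    have "emeasure disc_borel {w. x < defect w} = ennreal (1 / pi) * emeasure lborel (ball (0::complex) r)"
      by (subst emeasure_disc_borel, measurable) (simp only: eq)
    also have "emeasure lborel (ball (0::complex) r) = ennreal (pi * r\<^sup>2)"
      using r by (simp add: emeasure_ball unit_ball_vol_2)
    finally show ?thesis
      using r False that by (simp flip: ennreal_mult)
  qed
  have **: "emeasure (distr disc_borel borel defect) {x<..} = ennreal (if x < 1 then min 1 (1 - x) else 0)"
  proof (cases "x < 1")
    case False
    have "emeasure disc_borel {w. x < defect w} = emeasure disc_borel {}"
      using AE_disc_borel False by (intro emeasure_eq_AE) auto
    then show ?thesis using False
      by (simp add: emeasure_distr vimage_def)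
  qed (simp add: emeasure_distr vimage_def *)
  then show "emeasure (distr disc_borel borel defect) {x<..} < \<infinity>" by simp
  have "emeasure ?M {x<..} = (\<integral>\<^sup>+t. indicator ({0<..<1} \<inter> {x<..}) t \<partial>lborel)"
    by (subst emeasure_density, simp, simp, intro nn_integral_cong) (auto simp: indicator_def)
  also have "\<dots> = emeasure lborel ({0<..<1} \<inter> {x<..})"
    by (rule nn_integral_indicator) simp
  also have "{0<..<1} \<inter> {x<..} = {max 0 x<..<1}" by auto
  also have "emeasure lborel \<dots> = ennreal (if x < 1 then min 1 (1 - x) else 0)"
    by (cases "x < 1") auto
  finally show "emeasure (distr disc_borel borel defect) {x<..} = emeasure ?M {x<..}"
    using ** by simp
qed auto

lemma nn_integral_radial:
  assumes [measurable]: "f \<in> borel_measurable borel"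
  shows "(\<integral>\<^sup>+w. f (defect w) \<partial>disc_borel) = (\<integral>\<^sup>+x\<in>{0<..<1}. f x \<partial>lborel)"
proof -
  have "(\<integral>\<^sup>+w. f (defect w) \<partial>disc_borel) = (\<integral>\<^sup>+x. f x \<partial>distr disc_borel borel defect)"
    by (simp add: nn_integral_distr)
  then show ?thesis
    by (simp add: distr_defect nn_integral_density mult.commute)
qed

section \<open>Circle averages of the kernel\<close>

lemma AE_disc_borel_cmod: "AE w in disc_borel. cmod w < 1"
  using AE_disc_borel by (rule eventually_mono) simp

lemma emeasure_lborel_box_complex:
  assumes "Re l \<le> Re u" "Im l \<le> Im u"
  shows "emeasure lborel (box l u) = ennreal ((Re u - Re l) * (Im u - Im l))"
proof -
  have "(1::complex) \<noteq> \<i>" by (simp add: complex_eq_iff)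
  then show ?thesis
    using assms by (subst emeasure_lborel_box) (auto simp: Basis_complex_def)
qed

text \<open>The imaginary part of \<open>sgn w\<close> is at most its distance to 1, so the sector
  over the arc lies in the strip |Im w| < t. Inside the unit disc this strip fits into a box of area
  4 t, of normalized measure at most 4 t / pi.\<close>

lemma circle_arc_le:
  assumes "t > 0"
  shows "emeasure circle_measure {\<zeta>. cmod (1 - \<zeta>) < t} \<le> ennreal (2 * t)"
proof -
  let ?B = "box (Complex (-1) (-t)) (Complex 1 t)"
  have "emeasure circle_measure {\<zeta>. cmod (1 - \<zeta>) < t} = emeasure disc_borel {w. cmod (1 - sgn w) < t}"
    unfolding circle_measure_def by (subst emeasure_distr) (auto simp: vimage_def)
  also have "\<dots> \<le> emeasure disc_borel ?B"
  proof (rule emeasure_mono_AE)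
    show "AE w in disc_borel. w \<in> {w. cmod (1 - sgn w) < t} \<longrightarrow> w \<in> ?B"
      using AE_disc_borel
    proof eventually_elim
      case (elim w)
      have "\<bar>Im w\<bar> < t" if "cmod (1 - sgn w) < t"
      proof -
        have "\<bar>Im w\<bar> = cmod w * \<bar>Im (1 - sgn w)\<bar>"
          using elim by (simp add: sgn_div_norm abs_mult)
        also have "\<dots> \<le> 1 * cmod (1 - sgn w)"
          using elim by (intro mult_mono abs_Im_le_cmod) auto
        finally show ?thesis using that by simp
      qed
      moreover have "\<bar>Re w\<bar> < 1"
        using elim abs_Re_le_cmod[of w] by linarith
      ultimately show ?case
        by (auto simp: box_def Basis_complex_def)
    qed
  qed simp
  also have "\<dots> \<le> ennreal (1 / pi) * emeasure lborel ?B"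
    by (subst emeasure_disc_borel) (auto intro!: mult_left_mono emeasure_mono)
  also have "emeasure lborel ?B = ennreal (4 * t)"
    using assms by (subst emeasure_lborel_box_complex) auto
  also have "ennreal (1 / pi) * ennreal (4 * t) = ennreal (4 * t / pi)"
    using assms by (simp flip: ennreal_mult)
  also have "\<dots> \<le> ennreal (2 * t)"
    using assms pi_ge_two by (intro ennreal_leI) (auto simp: field_simps)
  finally show ?thesis .
qed

text \<open>A box of area t / 16 along the positive real axis and away from the origin lies in the
  sector over the arc, and t / (16 pi) is larger than t / 64. Only the proportionality to t
  matters.\<close>

lemma circle_arc_ge:
  assumes "0 < t" "t \<le> 1"
  shows "ennreal (t / 64) \<le> emeasure circle_measure {\<zeta>. cmod (1 - \<zeta>) \<le> t}"
proof -
  let ?B = "box (Complex (1/4) (-t/8)) (Complex (1/2) (t/8))"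
  have B: "w \<in> ball 0 1 \<and> cmod (1 - sgn w) \<le> t" if "w \<in> ?B" for w
  proof -
    have w: "1/4 < Re w" "Re w < 1/2" "\<bar>Im w\<bar> < t/8"
      using that by (auto simp: box_def Basis_complex_def)
    have le: "cmod w \<le> Re w + \<bar>Im w\<bar>" "Re w \<le> cmod w"
      using cmod_le[of w] w complex_Re_le_cmod[of w] by auto
    have "cmod w * cmod (1 - sgn w) = cmod (of_real (cmod w) * (1 - sgn w))"
      by (simp add: norm_mult)
    also have "of_real (cmod w) * (1 - sgn w) = of_real (cmod w) - w"
      by (cases "w = 0") (simp_all add: sgn_eq right_diff_distrib)
    also have "cmod (of_real (cmod w) - w) \<le> \<bar>cmod w - Re w\<bar> + \<bar>Im w\<bar>"
      using cmod_le[of "of_real (cmod w) - w"] by simp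
    also have "\<dots> \<le> t / 4"
      using le w by linarith
    also have "\<dots> \<le> cmod w * t"
      using le w assms by (simp add: field_simps)
    finally have "cmod (1 - sgn w) \<le> t"
      using le w by (subst (asm) mult_le_cancel_left_pos) auto
    then show ?thesis using le w assms by auto
  qed
  have "ennreal (t / 64) \<le> ennreal (1 / pi * (t / 16))"
    using assms pi_less_4 by (intro ennreal_leI) (auto simp: field_simps)
  also have "\<dots> = ennreal (1 / pi) * emeasure lborel ?B"
    using assms by (subst emeasure_lborel_box_complex) (auto simp flip: ennreal_mult)
  also have "\<dots> \<le> ennreal (1 / pi) * emeasure lborel ({w. cmod (1 - sgn w) \<le> t} \<inter> ball 0 1)"
    using B by (intro mult_left_mono emeasure_mono) auto
  also have "\<dots> = emeasure disc_borel {w. cmod (1 - sgn w) \<le> t}"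
    by (subst emeasure_disc_borel) auto
  also have "\<dots> = emeasure circle_measure {\<zeta>. cmod (1 - \<zeta>) \<le> t}"
    unfolding circle_measure_def by (subst emeasure_distr) (auto simp: vimage_def)
  finally show ?thesis .
qed

text \<open>Rotating by \<open>sgn x\<close> makes the point real and nonnegative.\<close>

lemma nn_integral_circle_cmod:
  "(\<integral>\<^sup>+\<zeta>. ennreal (cmod (1 - \<zeta> * x) powr s) \<partial>circle_measure) =
   (\<integral>\<^sup>+\<zeta>. ennreal (cmod (1 - \<zeta> * of_real (cmod x)) powr s) \<partial>circle_measure)"
proof (cases "x = 0")
  case False
  have "(\<integral>\<^sup>+\<zeta>. ennreal (cmod (1 - sgn x * \<zeta> * of_real (cmod x)) powr s) \<partial>circle_measure) =
      (\<integral>\<^sup>+\<zeta>. ennreal (cmod (1 - \<zeta> * of_real (cmod x)) powr s) \<partial>circle_measure)"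
    using False
    by (intro nn_integral_circle_rotate[where f = "\<lambda>\<zeta>. ennreal (cmod (1 - \<zeta> * of_real (cmod x)) powr s)"])
       (auto simp: norm_sgn)
  moreover have "sgn x * \<zeta> * of_real (cmod x) = \<zeta> * x" for \<zeta>
    using False by (simp add: sgn_eq)
  ultimately show ?thesis by simp
qed simp

text \<open>The fraction is the geometric series over the dyadic arcs in
  \<open>circle_kernel_le\<close>; the power of 2 in front pays for replacing 1 - |z w| by half of
  the larger defect.\<close>

definition kernel_const :: "real \<Rightarrow> real" where
  "kernel_const c = 2 powr (c - 1) * (8 / (1 - 2 powr (1 - c)))"

lemma kernel_const_pos: "1 < c \<Longrightarrow> 0 < kernel_const c"
  by (auto simp: kernel_const_def intro!: mult_pos_pos divide_pos_pos powr_less_one[of 2, simplified])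

text \<open>Put s = 1 - |x|. Where |1 - \<zeta>| is about 2^j s the kernel is at most (2^j s)^(-c),
  while the arc has length of order 2^j s. The products form a geometric series because c >
  1.\<close>

lemma circle_kernel_le:
  assumes c: "1 < c" and x: "cmod x < 1"
  shows "(\<integral>\<^sup>+\<zeta>. ennreal (cmod (1 - \<zeta> * x) powr (-c)) \<partial>circle_measure)
    \<le> ennreal (8 / (1 - 2 powr (1 - c)) * (1 - cmod x) powr (1 - c))"
proof -
  define s where "s = 1 - cmod x"
  have s: "0 < s" "cmod x = 1 - s" using x by (auto simp: s_def)
  define q where "q = 2 powr (1 - c)"
  have q: "0 < q" "q < 1" using c by (auto simp: q_def powr_less_one)
  have sums: "(\<lambda>j. 8 * s powr (1 - c) * q ^ j) sums (8 * s powr (1 - c) * (1 / (1 - q)))"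
    using q by (intro sums_mult geometric_sums) auto
  have pw: "ennreal (cmod (1 - \<zeta> * of_real (cmod x)) powr (-c)) \<le>
      (\<Sum>j. ennreal ((2 ^ j * s) powr (-c)) * indicator {\<zeta>. cmod (1 - \<zeta>) < 4 * 2 ^ j * s} \<zeta>)"
    if "cmod \<zeta> = 1" for \<zeta>
  proof -
    define y where "y = cmod (1 - \<zeta>)"
    define d where "d = cmod (1 - \<zeta> * of_real (cmod x))"
    have d1: "s \<le> d"
      using norm_triangle_ineq2[of 1 "\<zeta> * of_real (cmod x)"] that by (simp add: d_def s_def norm_mult)
    have "y = cmod ((1 - \<zeta> * of_real (cmod x)) - \<zeta> * of_real s)"
      by (simp add: y_def s algebra_simps)
    also have "\<dots> \<le> d + s"
      using norm_triangle_ineq4[of "1 - \<zeta> * of_real (cmod x)" "\<zeta> * of_real s"] that s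
      by (simp add: d_def norm_mult)
    finally have d2: "y \<le> 2 * d" using d1 by simp
    have "\<exists>j. y < 4 * 2 ^ j * s"
    proof -
      obtain j :: nat where "y / (4 * s) < 2 ^ j"
        using real_arch_pow[of 2 "y / (4 * s)"] by auto
      then show ?thesis using s by (intro exI[of _ j]) (simp add: field_simps)
    qed
    \<comment> \<open>For j > 0 the minimality of \<open>j\<close> gives y >= 2 (2^j s), and d >= y
      / 2; for j = 0 the bound d >= s serves instead.\<close>
    then obtain j where j: "y < 4 * 2 ^ j * s" and jmin: "\<And>i. i < j \<Longrightarrow> \<not> y < 4 * 2 ^ i * s"
      using exists_least_iff[of "\<lambda>j. y < 4 * 2 ^ j * s"] by auto
    have "2 ^ j * s \<le> d"
    proof (cases j)
      case (Suc i)
      then show ?thesis using jmin[of i] d2 by simp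
    qed (use d1 in simp)
    then have "d powr (-c) \<le> (2 ^ j * s) powr (-c)"
      using s c by (intro powr_mono2') auto
    then have "ennreal (d powr (-c)) \<le>
        (\<Sum>i\<in>{j}. ennreal ((2 ^ i * s) powr (-c)) * indicator {\<zeta>. cmod (1 - \<zeta>) < 4 * 2 ^ i * s} \<zeta>)"
      using j by (simp add: y_def ennreal_leI)
    also have "\<dots> \<le> (\<Sum>j. ennreal ((2 ^ j * s) powr (-c)) * indicator {\<zeta>. cmod (1 - \<zeta>) < 4 * 2 ^ j * s} \<zeta>)"
      by (intro sum_le_suminf) auto
    finally show ?thesis by (simp add: d_def)
  qed
  have "(\<integral>\<^sup>+\<zeta>. ennreal (cmod (1 - \<zeta> * x) powr (-c)) \<partial>circle_measure) =
      (\<integral>\<^sup>+\<zeta>. ennreal (cmod (1 - \<zeta> * of_real (cmod x)) powr (-c)) \<partial>circle_measure)"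
    by (rule nn_integral_circle_cmod)
  also have "\<dots> \<le> (\<integral>\<^sup>+\<zeta>. (\<Sum>j. ennreal ((2 ^ j * s) powr (-c)) *
      indicator {\<zeta>. cmod (1 - \<zeta>) < 4 * 2 ^ j * s} \<zeta>) \<partial>circle_measure)"
    using AE_circle_measure pw by (intro nn_integral_mono_AE) auto
  also have "\<dots> = (\<Sum>j. ennreal ((2 ^ j * s) powr (-c)) *
      emeasure circle_measure {\<zeta>. cmod (1 - \<zeta>) < 4 * 2 ^ j * s})"
    by (subst nn_integral_suminf) (auto simp: nn_integral_cmult_indicator)
  also have "\<dots> \<le> (\<Sum>j. ennreal (8 * s powr (1 - c) * q ^ j))"
  proof (intro suminf_le summableI)
    fix j
    have "ennreal ((2 ^ j * s) powr (-c)) * emeasure circle_measure {\<zeta>. cmod (1 - \<zeta>) < 4 * 2 ^ j * s}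
        \<le> ennreal ((2 ^ j * s) powr (-c)) * ennreal (2 * (4 * 2 ^ j * s))"
      using s by (intro mult_left_mono circle_arc_le) auto
    also have "\<dots> = ennreal (8 * ((2 ^ j * s) powr (-c) * (2 ^ j * s) powr 1))"
      using s by (simp flip: ennreal_mult)
    also have "(2 ^ j * s) powr (-c) * (2 ^ j * s) powr 1 = (2 ^ j * s) powr (1 - c)"
      by (subst powr_add[symmetric]) simp
    also have "\<dots> = s powr (1 - c) * q ^ j"
      using s by (simp add: powr_mult q_def powr_powr mult.commute flip: powr_realpow)
    finally show "ennreal ((2 ^ j * s) powr (-c)) * emeasure circle_measure {\<zeta>. cmod (1 - \<zeta>) < 4 * 2 ^ j * s}
        \<le> ennreal (8 * s powr (1 - c) * q ^ j)" by (simp add: mult.assoc)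
  qed
  also have "\<dots> = ennreal (8 * s powr (1 - c) * (1 / (1 - q)))"
    using q by (intro suminf_ennreal_eq sums) auto
  finally show ?thesis
    by (simp add: q_def s_def field_simps)
qed

text \<open>On the arc |1 - \<zeta>| <= s the denominator is at most 2 s, and the arc has measure at
  least s / 64. The scale s may be any number above 1 - |x|, because the lower bound for radial
  inputs uses it at s = 2 u.\<close>

lemma circle_kernel_ge:
  assumes c: "0 < c" and x: "1 - s \<le> cmod x" "cmod x < 1" and s: "s \<le> 1"
  shows "ennreal (s / 64 * (2 * s) powr (-c)) \<le>
    (\<integral>\<^sup>+\<zeta>. ennreal (cmod (1 - \<zeta> * x) powr (-c)) \<partial>circle_measure)"
proof -
  have s0: "0 < s" using x by linarith
  have pw: "ennreal ((2 * s) powr (-c)) * indicator {\<zeta>. cmod (1 - \<zeta>) \<le> s} \<zeta> \<le>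
      ennreal (cmod (1 - \<zeta> * of_real (cmod x)) powr (-c))" if "cmod \<zeta> = 1" for \<zeta>
  proof (cases "cmod (1 - \<zeta>) \<le> s")
    case True
    have "1 - \<zeta> * of_real (cmod x) = (1 - \<zeta>) + \<zeta> * of_real (1 - cmod x)"
      by (simp add: algebra_simps)
    then have "cmod (1 - \<zeta> * of_real (cmod x)) \<le> cmod (1 - \<zeta>) + cmod (\<zeta> * of_real (1 - cmod x))"
      by (metis norm_triangle_ineq)
    also have "cmod (\<zeta> * of_real (1 - cmod x)) = 1 - cmod x"
      using that x unfolding norm_mult norm_of_real by simp
    finally have "cmod (1 - \<zeta> * of_real (cmod x)) \<le> 2 * s"
      using True x by linarith
    moreover have "0 < cmod (1 - \<zeta> * of_real (cmod x))"
    proof -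
      have "cmod (\<zeta> * of_real (cmod x)) < 1"
        using that x by (simp add: norm_mult)
      then have "\<zeta> * of_real (cmod x) \<noteq> 1"
        using norm_one[where 'a=complex] by (metis less_irrefl)
      then show ?thesis by simp
    qed
    ultimately show ?thesis
      using True c by (simp add: ennreal_leI powr_mono2')
  qed simp
  have "ennreal (s / 64 * (2 * s) powr (-c)) = ennreal ((2 * s) powr (-c)) * ennreal (s / 64)"
    using s0 by (simp add: mult.commute flip: ennreal_mult)
  also have "\<dots> \<le> ennreal ((2 * s) powr (-c)) * emeasure circle_measure {\<zeta>. cmod (1 - \<zeta>) \<le> s}"
    using s s0 by (intro mult_left_mono circle_arc_ge) auto
  also have "\<dots> = (\<integral>\<^sup>+\<zeta>. ennreal ((2 * s) powr (-c)) * indicator {\<zeta>. cmod (1 - \<zeta>) \<le> s} \<zeta> \<partial>circle_measure)"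
    by (subst nn_integral_cmult_indicator) auto
  also have "\<dots> \<le> (\<integral>\<^sup>+\<zeta>. ennreal (cmod (1 - \<zeta> * of_real (cmod x)) powr (-c)) \<partial>circle_measure)"
    using AE_circle_measure pw by (intro nn_integral_mono_AE) auto
  finally show ?thesis
    by (subst nn_integral_circle_cmod)
qed

definition disc_kernel :: "real \<Rightarrow> real \<Rightarrow> complex \<Rightarrow> complex \<Rightarrow> real" where
  "disc_kernel b c z w = defect w powr b * cmod (1 - z * cnj w) powr (-c)"

text \<open>The operator S without its outer weight, for nonnegative inputs and valued in
  \<open>ennreal\<close>, so that no convergence has to be known in advance. Apart from that weight
  it dominates both operators.\<close>

definition pos_op :: "real \<Rightarrow> real \<Rightarrow> (complex \<Rightarrow> ennreal) \<Rightarrow> complex \<Rightarrow> ennreal" where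
  "pos_op b c F z = (\<integral>\<^sup>+w. ennreal (disc_kernel b c z w) * F w \<partial>disc_borel)"

definition radial_weight :: "real \<Rightarrow> real \<Rightarrow> real \<Rightarrow> real \<Rightarrow> real" where
  "radial_weight b c v u = u powr b * max u v powr (1 - c)"

lemma disc_kernel_nonneg: "0 \<le> disc_kernel b c z w"
  by (simp add: disc_kernel_def)

lemma measurable_disc_kernel [measurable (raw)]:
  assumes [measurable]: "f \<in> borel_measurable M" "g \<in> borel_measurable M"
  shows "(\<lambda>x. disc_kernel b c (f x) (g x)) \<in> borel_measurable M"
proof -
  have [measurable]: "cnj \<in> borel_measurable borel"
    by (intro borel_measurable_continuous_onI continuous_intros)
  show ?thesis unfolding disc_kernel_def by measurable
qed

lemma measurable_pos_op [measurable]: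
  assumes [measurable]: "F \<in> borel_measurable borel"
  shows "pos_op b c F \<in> borel_measurable borel"
proof -
  have "(\<lambda>z. \<integral>\<^sup>+w. ennreal (disc_kernel b c z w) * F w \<partial>disc_borel) \<in> borel_measurable borel"
    by measurable
  then show ?thesis by (simp add: pos_op_def[abs_def])
qed

lemma measurable_radial_weight [measurable]: "radial_weight b c v \<in> borel_measurable borel"
  unfolding radial_weight_def by measurable

text \<open>|z w| is at most the smaller of the two moduli, and 1 - r^2 <= 2 (1 - r).\<close>

lemma one_minus_cmod_mult_ge:
  assumes "cmod z < 1" "cmod w < 1"
  shows "max (defect w) (defect z) / 2 \<le> 1 - cmod (z * cnj w)"
proof -
  have "cmod z * cmod w \<le> cmod z * 1" "cmod z * cmod w \<le> 1 * cmod w"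
    using assms by (intro mult_mono; simp)+
  moreover have "defect x \<le> 2 * (1 - cmod x)" for x
    using zero_le_power2[of "1 - cmod x"] by (simp add: defect_def power2_eq_square algebra_simps)
  from this[of z] this[of w] have "max (defect w) (defect z) \<le> 2 * (1 - min (cmod z) (cmod w))"
    by (simp add: max_def min_def)
  ultimately show ?thesis
    by (simp add: norm_mult min_def split: if_splits)
qed

lemma defect_pos: "cmod w < 1 \<Longrightarrow> 0 < defect w"
  by (simp add: defect_def abs_square_less_1)

lemma circle_disc_kernel_le:
  assumes c: "1 < c" and "cmod z < 1" "cmod w < 1"
  shows "(\<integral>\<^sup>+\<zeta>. ennreal (disc_kernel b c (\<zeta> * z) w) \<partial>circle_measure)
    \<le> ennreal (kernel_const c * radial_weight b c (defect z) (defect w))"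
proof -
  let ?m = "max (defect w) (defect z)"
  have m: "0 < ?m / 2" using defect_pos[OF assms(2)] by simp
  have q: "2 powr (1 - c) < 1" using c by (simp add: powr_less_one)
  have x: "cmod (z * cnj w) < 1"
    using one_minus_cmod_mult_ge[OF assms(2,3)] m by linarith
  have "(\<integral>\<^sup>+\<zeta>. ennreal (disc_kernel b c (\<zeta> * z) w) \<partial>circle_measure) =
      (\<integral>\<^sup>+\<zeta>. ennreal (defect w powr b) * ennreal (cmod (1 - \<zeta> * (z * cnj w)) powr (-c)) \<partial>circle_measure)"
    by (simp add: disc_kernel_def ennreal_mult mult.assoc)
  also have "\<dots> = ennreal (defect w powr b) * (\<integral>\<^sup>+\<zeta>. ennreal (cmod (1 - \<zeta> * (z * cnj w)) powr (-c)) \<partial>circle_measure)"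
    by (subst nn_integral_cmult) auto
  also have "\<dots> \<le> ennreal (defect w powr b) * ennreal (8 / (1 - 2 powr (1 - c)) * (1 - cmod (z * cnj w)) powr (1 - c))"
    using c x by (intro mult_left_mono circle_kernel_le) auto
  also have "\<dots> \<le> ennreal (defect w powr b) * ennreal (8 / (1 - 2 powr (1 - c)) * (?m / 2) powr (1 - c))"
    using c m q one_minus_cmod_mult_ge[OF assms(2,3)]
    by (intro mult_left_mono ennreal_leI powr_mono2') auto
  also have "(?m / 2) powr (1 - c) = 2 powr (c - 1) * ?m powr (1 - c)"
    using m by (subst powr_divide) (auto simp: powr_minus_divide[of 2 "c - 1", simplified] field_simps)
  finally show ?thesis
    using q by (simp add: kernel_const_def radial_weight_def mult_ac flip: ennreal_mult)
qed

text \<open>The average is taken in z alone with w held fixed, so that the kernel becomes radial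
  while the input \<open>F\<close> stays arbitrary.\<close>

lemma pos_op_circle_average:
  assumes c: "1 < c" and z: "cmod z < 1" and [measurable]: "F \<in> borel_measurable borel"
  shows "(\<integral>\<^sup>+\<zeta>. pos_op b c F (\<zeta> * z) \<partial>circle_measure)
    \<le> (\<integral>\<^sup>+w. ennreal (kernel_const c * radial_weight b c (defect z) (defect w)) * F w \<partial>disc_borel)"
proof -
  interpret pair_sigma_finite circle_measure disc_borel ..
  have "(\<integral>\<^sup>+\<zeta>. pos_op b c F (\<zeta> * z) \<partial>circle_measure) =
      (\<integral>\<^sup>+w. \<integral>\<^sup>+\<zeta>. ennreal (disc_kernel b c (\<zeta> * z) w) * F w \<partial>circle_measure \<partial>disc_borel)"
    unfolding pos_op_def by (subst Fubini') auto
  also have "\<dots> = (\<integral>\<^sup>+w. (\<integral>\<^sup>+\<zeta>. ennreal (disc_kernel b c (\<zeta> * z) w) \<partial>circle_measure) * F w \<partial>disc_borel)"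
    by (subst nn_integral_multc) auto
  also have "\<dots> \<le> (\<integral>\<^sup>+w. ennreal (kernel_const c * radial_weight b c (defect z) (defect w)) * F w \<partial>disc_borel)"
    using AE_disc_borel_cmod
    by (intro nn_integral_mono_AE) (auto elim!: eventually_mono intro!: mult_right_mono circle_disc_kernel_le c z)
  finally show ?thesis .
qed

lemma disc_kernel_rotate:
  assumes "cmod \<zeta> = 1"
  shows "disc_kernel b c (\<zeta> * z) (\<zeta> * w) = disc_kernel b c z w"
proof -
  have "\<zeta> * cnj \<zeta> = 1"
    using assms complex_norm_square[of \<zeta>] by simp
  moreover have "\<zeta> * z * cnj (\<zeta> * w) = (\<zeta> * cnj \<zeta>) * (z * cnj w)"
    by simp
  ultimately have "\<zeta> * z * cnj (\<zeta> * w) = z * cnj w"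
    by (simp only: mult_1)
  then show ?thesis
    unfolding disc_kernel_def by (simp only: defect_rotate[OF assms])
qed

lemma pos_op_rotate:
  assumes "cmod \<zeta> = 1" and [measurable]: "F \<in> borel_measurable borel"
  shows "pos_op b c F (\<zeta> * z) = pos_op b c (\<lambda>w. F (\<zeta> * w)) z"
proof -
  have "pos_op b c F (\<zeta> * z) = (\<integral>\<^sup>+w. ennreal (disc_kernel b c (\<zeta> * z) (\<zeta> * w)) * F (\<zeta> * w) \<partial>disc_borel)"
    unfolding pos_op_def using assms
    by (intro nn_integral_disc_rotate[symmetric, where f = "\<lambda>w. ennreal (disc_kernel b c (\<zeta> * z) w) * F w"]) auto
  then show ?thesis
    by (simp add: disc_kernel_rotate assms pos_op_def)
qed

lemma pos_op_radial_rotate: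
  assumes "cmod \<zeta> = 1" and [measurable]: "\<phi> \<in> borel_measurable borel"
  shows "pos_op b c (\<lambda>w. \<phi> (defect w)) (\<zeta> * z) = pos_op b c (\<lambda>w. \<phi> (defect w)) z"
  by (subst pos_op_rotate) (auto simp: assms defect_rotate)

lemma pos_op_radial_average:
  assumes [measurable]: "\<phi> \<in> borel_measurable borel"
  shows "pos_op b c (\<lambda>w. \<phi> (defect w)) z = (\<integral>\<^sup>+\<zeta>. pos_op b c (\<lambda>w. \<phi> (defect w)) (\<zeta> * z) \<partial>circle_measure)"
proof -
  have "(\<integral>\<^sup>+\<zeta>. pos_op b c (\<lambda>w. \<phi> (defect w)) (\<zeta> * z) \<partial>circle_measure) =
      (\<integral>\<^sup>+\<zeta>. pos_op b c (\<lambda>w. \<phi> (defect w)) z \<partial>circle_measure)"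
    using AE_circle_measure by (intro nn_integral_cong_AE) (auto simp: pos_op_radial_rotate)
  then show ?thesis
    by (simp add: circle_measure.emeasure_space_1[simplified])
qed

text \<open>A radial input has a radial image, which equals its own circle average; the averaged
  bound therefore holds at every point.\<close>

lemma pos_op_radial_le:
  assumes "1 < c" "cmod z < 1" and [measurable]: "\<phi> \<in> borel_measurable borel"
  shows "pos_op b c (\<lambda>w. \<phi> (defect w)) z
    \<le> (\<integral>\<^sup>+w. ennreal (kernel_const c * radial_weight b c (defect z) (defect w)) * \<phi> (defect w) \<partial>disc_borel)"
  by (subst pos_op_radial_average) (use assms in \<open>auto intro!: pos_op_circle_average\<close>)

section \<open>Weak-type estimates from circle averages\<close>

lemma nn_integral_powr_to_inf:
  fixes e s :: real
  assumes "e < -1" "0 < s"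
  shows "(\<integral>\<^sup>+x\<in>{s..}. ennreal (x powr e) \<partial>lborel) = ennreal (s powr (e + 1) / (- e - 1))"
proof -
  have "(\<integral>\<^sup>+x. indicator {s..} x * ennreal (x powr e) \<partial>lborel) = ennreal (- (s powr (e + 1)) / (e + 1))"
    using assms nn_integral_has_integral_lebesgue[OF _ has_integral_powr_to_inf[OF assms]]
    by (simp add: ennreal_mult' ennreal_indicator)
  moreover have "- (s powr (e + 1)) / (e + 1) = s powr (e + 1) / (- (e + 1))"
    by (simp only: divide_minus_left divide_minus_right)
  ultimately show ?thesis
    by (simp add: mult.commute)
qed

lemma nn_integral_powr_from_0:
  fixes e s :: real
  assumes "-1 < e" "0 \<le> s"
  shows "(\<integral>\<^sup>+x\<in>{0<..<s}. ennreal (x powr e) \<partial>lborel) \<le> ennreal (s powr (e + 1) / (e + 1))"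
proof -
  have "(\<integral>\<^sup>+x\<in>{0<..<s}. ennreal (x powr e) \<partial>lborel) \<le> (\<integral>\<^sup>+x. indicator {0..s} x * ennreal (x powr e) \<partial>lborel)"
    by (intro nn_integral_mono) (auto simp: indicator_def)
  also have "\<dots> = ennreal (s powr (e + 1) / (e + 1))"
    using assms nn_integral_has_integral_lebesgue[OF _ has_integral_powr_from_0[OF assms]]
    by (simp add: ennreal_mult' ennreal_indicator)
  finally show ?thesis .
qed

lemma nn_integral_disc_powr_near:
  assumes "-1 < e" "0 \<le> s"
  shows "(\<integral>\<^sup>+w. ennreal (defect w powr e) * indicator {..<s} (defect w) \<partial>disc_borel) \<le> ennreal (s powr (e + 1) / (e + 1))"
proof -
  have "(\<integral>\<^sup>+w. ennreal (defect w powr e) * indicator {..<s} (defect w) \<partial>disc_borel) =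
      (\<integral>\<^sup>+x\<in>{0<..<1}. ennreal (x powr e) * indicator {..<s} x \<partial>lborel)"
    by (rule nn_integral_radial[where f = "\<lambda>x. ennreal (x powr e) * indicator {..<s} x"]) simp
  also have "\<dots> \<le> (\<integral>\<^sup>+x\<in>{0<..<s}. ennreal (x powr e) \<partial>lborel)"
    by (intro nn_integral_mono) (auto simp: indicator_def)
  also have "\<dots> \<le> ennreal (s powr (e + 1) / (e + 1))"
    by (rule nn_integral_powr_from_0[OF assms])
  finally show ?thesis .
qed

lemma nn_integral_disc_powr:
  assumes "-1 < e"
  shows "(\<integral>\<^sup>+w. ennreal (defect w powr e) \<partial>disc_borel) \<le> ennreal (1 / (e + 1))"
proof -
  have "(\<integral>\<^sup>+w. ennreal (defect w powr e) \<partial>disc_borel) =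
      (\<integral>\<^sup>+w. ennreal (defect w powr e) * indicator {..<1} (defect w) \<partial>disc_borel)"
    by (intro nn_integral_cong_AE eventually_mono[OF AE_disc_borel]) auto
  also have "\<dots> \<le> ennreal (1 / (e + 1))"
    using nn_integral_disc_powr_near[OF assms, of 1] by simp
  finally show ?thesis .
qed

lemma nn_integral_disc_powr_far:
  assumes "e < -1" "0 < s"
  shows "(\<integral>\<^sup>+w. ennreal (defect w powr e) * indicator {s..} (defect w) \<partial>disc_borel) \<le> ennreal (s powr (e + 1) / (- e - 1))"
proof -
  have "(\<integral>\<^sup>+w. ennreal (defect w powr e) * indicator {s..} (defect w) \<partial>disc_borel) =
      (\<integral>\<^sup>+x\<in>{0<..<1}. ennreal (x powr e) * indicator {s..} x \<partial>lborel)"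
    by (rule nn_integral_radial[where f = "\<lambda>x. ennreal (x powr e) * indicator {s..} x"]) simp
  also have "\<dots> \<le> (\<integral>\<^sup>+x\<in>{s..}. ennreal (x powr e) \<partial>lborel)"
    by (intro nn_integral_mono) (auto simp: indicator_def)
  also have "\<dots> = ennreal (s powr (e + 1) / (- e - 1))"
    by (rule nn_integral_powr_to_inf[OF assms])
  finally show ?thesis .
qed

lemma nn_integral_defect_less:
  assumes "0 \<le> s"
  shows "(\<integral>\<^sup>+w. indicator {..<s} (defect w) \<partial>disc_borel) \<le> ennreal s"
proof -
  have "(\<integral>\<^sup>+w. indicator {..<s} (defect w) \<partial>disc_borel) = (\<integral>\<^sup>+w. ennreal (defect w powr 0) * indicator {..<s} (defect w) \<partial>disc_borel)"
    by (intro nn_integral_cong_AE eventually_mono[OF AE_disc_borel]) (auto simp: indicator_def)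
  also have "\<dots> \<le> ennreal s"
    using nn_integral_disc_powr_near[of 0 s] assms by simp
  finally show ?thesis .
qed

lemma emeasure_defect_less:
  assumes "0 \<le> s"
  shows "emeasure disc_borel {w. defect w < s} \<le> ennreal s"
proof -
  have "emeasure disc_borel {w. defect w < s} = (\<integral>\<^sup>+w. indicator {w. defect w < s} w \<partial>disc_borel)"
    by (subst nn_integral_indicator) auto
  also have "\<dots> = (\<integral>\<^sup>+w. indicator {..<s} (defect w) \<partial>disc_borel)"
    by (intro nn_integral_cong) (auto simp: indicator_def)
  also note nn_integral_defect_less[OF assms]
  finally show ?thesis .
qed

lemma defect_pos_le: "cmod z < 1 \<Longrightarrow> 0 < defect z \<and> defect z \<le> 1"
  by (simp add: defect_pos) (simp add: defect_def)

lemma less_ennreal_mult_powr_iff: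
  assumes "0 < v" "0 < l"
  shows "ennreal l < ennreal (v powr a) * x \<longleftrightarrow> ennreal (l * v powr (-a)) < x"
proof -
  have v: "0 < v powr a" "v powr a * v powr (-a) = 1" using assms by (auto simp flip: powr_add)
  show ?thesis
  proof (cases x)
    case (real r)
    have "l < v powr a * r \<longleftrightarrow> l * v powr (-a) < r"
      using pos_divide_less_eq[OF v(1), of l r] by (simp add: powr_minus_divide mult.commute)
    moreover have "ennreal (v powr a) * x = ennreal (v powr a * r)"
      using real by (simp add: ennreal_mult)
    ultimately show ?thesis using real assms by (simp add: ennreal_less_iff)
  next
    case top
    then show ?thesis using v by (simp add: ennreal_mult_top)
  qed
qed

lemma weak_type_from_circle:
  fixes a p q X K :: real
  assumes [measurable]: "G \<in> borel_measurable borel"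
    and q: "0 < q" "q < p" and X: "0 < X" and K: "0 \<le> K"
    and circ: "\<And>z l. cmod z < 1 \<Longrightarrow> 0 < l \<Longrightarrow>
      emeasure circle_measure {\<zeta>. ennreal l < G (\<zeta> * z)} \<le> ennreal (K * (X * defect z powr (- (a + 1 / q)) / l) powr p)"
    and l: "0 < l"
  shows "emeasure disc_borel {z. ennreal l < ennreal (defect z powr a) * G z} \<le> ennreal ((1 + K / (p / q - 1)) * (X / l) powr q)"
proof -
  define S where "S = {z. ennreal l < ennreal (defect z powr a) * G z}"
  have [measurable]: "S \<in> sets borel" unfolding S_def by measurable
  \<comment> \<open>On the circle with defect v the hypothesis gives, up to \<open>K\<close>, the
    measure (X / l)^p v^(-p/q), which reaches 1 at v = (X / l)^q. Below this value the full length 1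
    of the circle is used, above it the decay; by the same choice the tail integral is s / (p/q -
    1).\<close>
  define s where "s = (X / l) powr q"
  have s: "0 < s" using X l by (simp add: s_def)
  have bound: "(\<integral>\<^sup>+\<zeta>. indicator S (\<zeta> * z) \<partial>circle_measure) \<le>
      indicator {..<s} (defect z) + ennreal (K * (X / l) powr p) * (ennreal (defect z powr (- p / q)) * indicator {s..} (defect z))"
    if z: "cmod z < 1" for z
  proof -
    have v: "0 < defect z" using defect_pos[OF z] .
    have "(\<integral>\<^sup>+\<zeta>. indicator S (\<zeta> * z) \<partial>circle_measure) \<le> (\<integral>\<^sup>+\<zeta>. indicator {\<zeta>. ennreal (l * defect z powr (-a)) < G (\<zeta> * z)} \<zeta> \<partial>circle_measure)"
      using AE_circle_measure
      by (intro nn_integral_mono_AE, elim eventually_mono)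
         (auto simp: S_def defect_rotate indicator_def less_ennreal_mult_powr_iff[OF v l])
    also have "\<dots> = emeasure circle_measure {\<zeta>. ennreal (l * defect z powr (-a)) < G (\<zeta> * z)}"
      by (subst nn_integral_indicator) auto
    finally have *: "(\<integral>\<^sup>+\<zeta>. indicator S (\<zeta> * z) \<partial>circle_measure) \<le> \<dots>" .
    show ?thesis
    proof (cases "defect z < s")
      case True
      have "(\<integral>\<^sup>+\<zeta>. indicator S (\<zeta> * z) \<partial>circle_measure) \<le> 1"
        using * circle_measure.emeasure_le_1 order_trans by blast
      then show ?thesis using True by simp
    next
      case False
      note *
      also have "emeasure circle_measure {\<zeta>. ennreal (l * defect z powr (-a)) < G (\<zeta> * z)} \<le>
          ennreal (K * (X * defect z powr (- (a + 1 / q)) / (l * defect z powr (-a))) powr p)"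
        using v l by (intro circ z) auto
      also have "X * defect z powr (- (a + 1 / q)) / (l * defect z powr (-a)) = X / l * defect z powr (- 1 / q)"
        using v l by (simp add: powr_diff powr_minus field_simps powr_add)
      also have "(X / l * defect z powr (- 1 / q)) powr p = (X / l) powr p * defect z powr (- p / q)"
        using X l by (subst powr_mult) (simp_all add: powr_powr)
      finally show ?thesis using False K by (simp add: ennreal_mult mult.assoc)
    qed
  qed
  have "emeasure disc_borel S = (\<integral>\<^sup>+z. indicator S z \<partial>disc_borel)"
    by simp
  also have "\<dots> = (\<integral>\<^sup>+z. \<integral>\<^sup>+\<zeta>. indicator S (\<zeta> * z) \<partial>circle_measure \<partial>disc_borel)"
    by (rule nn_integral_disc_average) simp
  also have "\<dots> \<le> (\<integral>\<^sup>+z. indicator {..<s} (defect z) + ennreal (K * (X / l) powr p) *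
      (ennreal (defect z powr (- p / q)) * indicator {s..} (defect z)) \<partial>disc_borel)"
    using AE_disc_borel_cmod bound by (intro nn_integral_mono_AE) (auto elim!: eventually_mono)
  also have "\<dots> = (\<integral>\<^sup>+z. indicator {..<s} (defect z) \<partial>disc_borel) + ennreal (K * (X / l) powr p) *
      (\<integral>\<^sup>+z. ennreal (defect z powr (- p / q)) * indicator {s..} (defect z) \<partial>disc_borel)"
    by (subst nn_integral_add, simp, simp, subst nn_integral_cmult, simp) (rule refl)
  also have "\<dots> \<le> ennreal s + ennreal (K * (X / l) powr p) * ennreal (s powr (- p / q + 1) / (- (- p / q) - 1))"
    using nn_integral_defect_less[of s] s q
    by (intro add_mono mult_left_mono nn_integral_disc_powr_far) (auto simp: field_simps)
  also have "\<dots> = ennreal (s + K * (X / l) powr p * (s powr (- p / q + 1) / (p / q - 1)))"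
    using s q K by (simp add: field_simps flip: ennreal_mult ennreal_plus)
  also have "(X / l) powr p * (s powr (- p / q + 1)) = s"
    using X l q by (simp add: s_def powr_powr field_simps flip: powr_add)
  then have "s + K * (X / l) powr p * (s powr (- p / q + 1) / (p / q - 1)) = (1 + K / (p / q - 1)) * s"
    by (simp add: field_simps)
  finally show ?thesis by (simp add: S_def s_def)
qed

text \<open>The function v^(-1/q) belongs to weak L^q because the defect is uniformly
  distributed.\<close>

lemma weak_type_pointwise:
  fixes a q X :: real
  assumes [measurable]: "G \<in> borel_measurable borel"
    and q: "0 < q" and X: "0 < X"
    and le: "\<And>z. cmod z < 1 \<Longrightarrow> G z \<le> ennreal (X * defect z powr (- (a + 1 / q)))"
    and l: "0 < l"
  shows "emeasure disc_borel {z. ennreal l < ennreal (defect z powr a) * G z} \<le> ennreal ((X / l) powr q)"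
proof -
  have "emeasure disc_borel {z. ennreal l < ennreal (defect z powr a) * G z} \<le> emeasure disc_borel {z. defect z < (X / l) powr q}"
  proof (rule emeasure_mono_AE)
    show "AE z in disc_borel. z \<in> {z. ennreal l < ennreal (defect z powr a) * G z} \<longrightarrow> z \<in> {z. defect z < (X / l) powr q}"
      using AE_disc_borel_cmod
    proof (eventually_elim, intro impI CollectI, elim CollectE)
      fix z assume z: "cmod z < 1" and "ennreal l < ennreal (defect z powr a) * G z"
      have v: "0 < defect z" using defect_pos[OF z] .
      have "ennreal (l * defect z powr (-a)) < G z"
        using \<open>ennreal l < _\<close> by (simp add: less_ennreal_mult_powr_iff[OF v l])
      also have "\<dots> \<le> ennreal (X * defect z powr (- (a + 1 / q)))"
        by (rule le[OF z])
      finally have "l * defect z powr (-a) < X * defect z powr (- (a + 1 / q))"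
        using l X by (subst (asm) ennreal_less_iff) auto
      also have "\<dots> = X * defect z powr (- 1 / q) * defect z powr (-a)"
        by (subst mult.assoc, subst powr_add[symmetric]) (simp add: algebra_simps)
      finally have "l < X * defect z powr (- 1 / q)"
        using v by (simp add: mult_less_cancel_right_pos)
      then have "defect z powr (1 / q) < X / l"
        using v l by (simp add: powr_minus field_simps)
      then have "(defect z powr (1 / q)) powr q < (X / l) powr q"
        using q by (intro powr_less_mono2) auto
      then show "defect z < (X / l) powr q"
        using v q by (simp add: powr_powr)
    qed
  qed measurable
  also have "\<dots> \<le> ennreal ((X / l) powr q)"
    by (rule emeasure_defect_less) simp
  finally show ?thesis .
qed

text \<open>Above the height \<open>e\<close> the factor (y / e)^(p - 1) is at least 1. The height
  stays free so that it can be adapted to the level under consideration.\<close>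

lemma young_powr_le:
  fixes y e p :: real
  assumes "0 \<le> y" "0 < e" "1 \<le> p"
  shows "y \<le> e + e powr (1 - p) * y powr p"
proof (cases "y \<le> e")
  case False
  then have "1 \<le> (y / e) powr (p - 1)"
    using assms by (intro ge_one_powr_ge_zero) auto
  then have "y * 1 \<le> y * (y / e) powr (p - 1)"
    using assms by (intro mult_left_mono) auto
  also have "\<dots> = e powr (1 - p) * y powr p"
    using False assms by (simp add: powr_divide powr_diff field_simps)
  finally show ?thesis using assms by simp
qed (use assms in \<open>simp add: add_increasing2\<close>)

lemma pos_op_mono_AE: "(AE w in disc_borel. F w \<le> G w) \<Longrightarrow> pos_op b c F z \<le> pos_op b c G z"
  unfolding pos_op_def by (intro nn_integral_mono_AE) (auto elim!: eventually_mono intro!: mult_left_mono)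

lemma pos_op_add:
  assumes [measurable]: "F \<in> borel_measurable borel" "G \<in> borel_measurable borel"
  shows "pos_op b c (\<lambda>w. F w + G w) z = pos_op b c F z + pos_op b c G z"
  unfolding pos_op_def by (simp add: distrib_left nn_integral_add)

lemma pos_op_cmult:
  assumes [measurable]: "F \<in> borel_measurable borel"
  shows "pos_op b c (\<lambda>w. k * F w) z = k * pos_op b c F z"
  unfolding pos_op_def by (subst nn_integral_cmult[symmetric]) (auto simp: mult_ac)

text \<open>Splitting the input at the height where its radial part produces half of the level
  leaves a part to which Markov's inequality on the circle applies.\<close>

lemma circle_weak_pos_op:
  assumes c: "1 < c" and z: "cmod z < 1" and l: "0 < l" and A: "0 < A" and p: "1 \<le> p"
    and [measurable]: "F \<in> borel_measurable borel" "F2 \<in> borel_measurable borel" "\<phi> \<in> borel_measurable borel"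
    and le: "\<And>e. 0 < e \<Longrightarrow> AE w in disc_borel. F w \<le> ennreal e * \<phi> (defect w) + ennreal (e powr (1 - p)) * F2 w"
    and A_le: "(\<integral>\<^sup>+w. ennreal (kernel_const c * radial_weight b c (defect z) (defect w)) * \<phi> (defect w) \<partial>disc_borel) \<le> ennreal A"
    and B_le: "(\<integral>\<^sup>+w. ennreal (kernel_const c * radial_weight b c (defect z) (defect w)) * F2 w \<partial>disc_borel) \<le> B"
  shows "emeasure circle_measure {\<zeta>. ennreal l < pos_op b c F (\<zeta> * z)} \<le> ennreal ((2 / l) powr p * A powr (p - 1)) * B"
proof -
  define e where "e = l / (2 * A)"
  have e: "0 < e" using l A by (simp add: e_def)
  define k where "k = ennreal (2 / l * e powr (1 - p))"
  have "emeasure circle_measure {\<zeta>. ennreal l < pos_op b c F (\<zeta> * z)} \<le>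
      emeasure circle_measure {\<zeta> \<in> UNIV. 1 \<le> k * pos_op b c F2 (\<zeta> * z)}"
  proof (rule emeasure_mono_AE)
    show "AE \<zeta> in circle_measure. \<zeta> \<in> {\<zeta>. ennreal l < pos_op b c F (\<zeta> * z)} \<longrightarrow>
        \<zeta> \<in> {\<zeta> \<in> UNIV. 1 \<le> k * pos_op b c F2 (\<zeta> * z)}"
      using AE_circle_measure
    proof (eventually_elim, intro impI, elim CollectE)
      fix \<zeta> assume \<zeta>: "cmod \<zeta> = 1" and less: "ennreal l < pos_op b c F (\<zeta> * z)"
      have "pos_op b c F (\<zeta> * z) \<le> pos_op b c (\<lambda>w. ennreal e * \<phi> (defect w) + ennreal (e powr (1 - p)) * F2 w) (\<zeta> * z)"
        by (rule pos_op_mono_AE[OF le[OF e]])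
      also have "\<dots> = ennreal e * pos_op b c (\<lambda>w. \<phi> (defect w)) (\<zeta> * z) + ennreal (e powr (1 - p)) * pos_op b c F2 (\<zeta> * z)"
        by (subst pos_op_add, simp, simp) (simp add: pos_op_cmult)
      also have "pos_op b c (\<lambda>w. \<phi> (defect w)) (\<zeta> * z) \<le> ennreal A"
        using pos_op_radial_le[OF c z, of \<phi> b] A_le by (simp add: pos_op_radial_rotate[OF \<zeta>] order_trans)
      then have "ennreal e * pos_op b c (\<lambda>w. \<phi> (defect w)) (\<zeta> * z) \<le> ennreal e * ennreal A"
        by (rule mult_left_mono) simp
      also have "ennreal e * ennreal A = ennreal (l / 2)"
        using A l by (simp add: e_def flip: ennreal_mult)
      finally have *: "ennreal l < ennreal (l / 2) + ennreal (e powr (1 - p)) * pos_op b c F2 (\<zeta> * z)"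
        using less by (simp add: add_right_mono order.strict_trans1 order.strict_trans2)
      have "ennreal (l / 2) \<le> ennreal (e powr (1 - p)) * pos_op b c F2 (\<zeta> * z)"
      proof (rule ccontr)
        assume "\<not> ?thesis"
        then have "ennreal (l / 2) + ennreal (e powr (1 - p)) * pos_op b c F2 (\<zeta> * z) \<le> ennreal (l / 2) + ennreal (l / 2)"
          by (intro add_left_mono) simp
        also have "\<dots> = ennreal l" using l by (simp flip: ennreal_plus)
        finally show False using * by simp
      qed
      then have "ennreal (2 / l) * ennreal (l / 2) \<le> ennreal (2 / l) * (ennreal (e powr (1 - p)) * pos_op b c F2 (\<zeta> * z))"
        by (rule mult_left_mono) simp
      then show "\<zeta> \<in> {\<zeta> \<in> UNIV. 1 \<le> k * pos_op b c F2 (\<zeta> * z)}"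
        using l by (simp add: k_def ennreal_mult mult.assoc[symmetric] flip: ennreal_mult'')
    qed
  qed measurable
  also have "\<dots> \<le> k * (\<integral>\<^sup>+\<zeta>. pos_op b c F2 (\<zeta> * z) * indicator UNIV \<zeta> \<partial>circle_measure)"
    by (rule nn_integral_Markov_inequality) auto
  also have "\<dots> \<le> k * B"
    using order_trans[OF pos_op_circle_average[OF c z, of F2 b] B_le] by (intro mult_left_mono) auto
  also have "2 / l * e powr (1 - p) = (2 / l) powr p * A powr (p - 1)"
    using l A by (simp add: e_def powr_divide powr_mult powr_diff field_simps)
  then have "k = ennreal ((2 / l) powr p * A powr (p - 1))"
    by (simp add: k_def)
  finally show ?thesis .
qed

text \<open>The estimates work with a strictly positive norm bound; right continuity in that bound
  recovers a vanishing norm.\<close>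

lemma weak_type_limit:
  fixes q C X l :: real
  assumes q: "0 < q" and X: "0 \<le> X" and l: "0 < l"
    and le: "\<And>Y. X < Y \<Longrightarrow> m \<le> ennreal (C * (Y / l) powr q)"
  shows "m \<le> ennreal (C * (X / l) powr q)"
proof (rule tendsto_lowerbound)
  show "((\<lambda>Y. ennreal (C * (Y / l) powr q)) \<longlongrightarrow> ennreal (C * (X / l) powr q)) (at_right X)"
    using q X l
    by (intro tendsto_ennrealI tendsto_mult tendsto_const tendsto_powr2 tendsto_divide tendsto_ident_at)
       (auto simp: eventually_at_filter intro!: always_eventually)
  show "\<forall>\<^sub>F Y in at_right X. m \<le> ennreal (C * (Y / l) powr q)"
    using le by (auto simp: eventually_at_filter)
qed simp

text \<open>A weak-type inequality for the positive operator. The norm enters only through real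
  upper bounds X, which keeps all powers and quotients in the reals, and \<open>N\<close> is a
  parameter so that Lebesgue and Lorentz norms share the transfer to the operators.\<close>

definition weak_bound :: "real \<Rightarrow> real \<Rightarrow> real \<Rightarrow> real \<Rightarrow> ((complex \<Rightarrow> real) \<Rightarrow> ennreal) \<Rightarrow> bool" where
  "weak_bound a b c q N \<longleftrightarrow> (\<exists>C\<ge>0. \<forall>f\<in>borel_measurable borel. (\<forall>w. 0 \<le> f w) \<longrightarrow>
     (\<forall>X\<ge>0. N f \<le> ennreal X \<longrightarrow> (\<forall>l>0. emeasure disc_borel
        {z. ennreal l < ennreal (defect z powr a) * pos_op b c (\<lambda>w. ennreal (f w)) z}
        \<le> ennreal (C * (X / l) powr q))))"

lemma weak_boundI:
  assumes q: "0 < q" and C: "0 \<le> C"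
    and le: "\<And>f X l. \<lbrakk>f \<in> borel_measurable borel; \<And>w. 0 \<le> f w; 0 < X; N f \<le> ennreal X; 0 < l\<rbrakk> \<Longrightarrow>
      emeasure disc_borel {z. ennreal l < ennreal (defect z powr a) * pos_op b c (\<lambda>w. ennreal (f w)) z}
        \<le> ennreal (C * (X / l) powr q)"
  shows "weak_bound a b c q N"
  unfolding weak_bound_def
proof (intro exI[of _ C] conjI C ballI impI allI)
  fix f :: "complex \<Rightarrow> real" and X l :: real
  assume f: "f \<in> borel_measurable borel" "\<forall>w. 0 \<le> f w" and X: "0 \<le> X" "N f \<le> ennreal X" and l: "0 < l"
  show "emeasure disc_borel {z. ennreal l < ennreal (defect z powr a) * pos_op b c (\<lambda>w. ennreal (f w)) z}
        \<le> ennreal (C * (X / l) powr q)"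
  proof (rule weak_type_limit[OF q X(1) l])
    fix Y assume "X < Y"
    then show "emeasure disc_borel {z. ennreal l < ennreal (defect z powr a) * pos_op b c (\<lambda>w. ennreal (f w)) z}
        \<le> ennreal (C * (Y / l) powr q)"
      using f X l by (intro le) (auto intro: order_trans[OF X(2)] ennreal_leI)
  qed
qed

section \<open>Weak-type bounds on Lebesgue spaces\<close>

definition Lp_norm_nonneg :: "real \<Rightarrow> (complex \<Rightarrow> real) \<Rightarrow> ennreal" where
  "Lp_norm_nonneg p f = Lp_norm (ereal p) (\<lambda>w. of_real (f w))"

lemma nn_integral_disc_measure:
  "f \<in> borel_measurable borel \<Longrightarrow> (\<integral>\<^sup>+w. f w \<partial>disc_measure) = (\<integral>\<^sup>+w. f w \<partial>disc_borel)"
  unfolding disc_borel_def by (subst nn_integral_distr) (auto intro: measurable_id_disc_measure)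

lemma Lp_norm_le_iff:
  assumes p: "0 < p" and X: "0 \<le> X" and [measurable]: "f \<in> borel_measurable borel"
  shows "Lp_norm (ereal p) f \<le> ennreal X \<longleftrightarrow> (\<integral>\<^sup>+w. ennreal (cmod (f w) powr p) \<partial>disc_borel) \<le> ennreal (X powr p)"
proof -
  define I where "I = (\<integral>\<^sup>+w. ennreal (cmod (f w) powr p) \<partial>disc_borel)"
  have eq: "Lp_norm (ereal p) f = (if I = \<infinity> then \<infinity> else ennreal (enn2real I powr (1 / p)))"
    by (simp add: Lp_norm_def I_def nn_integral_disc_measure)
  show ?thesis
  proof (cases "I = \<infinity>")
    case False
    then obtain r where r: "0 \<le> r" "I = ennreal r" by (cases I) auto
    have "r powr (1 / p) \<le> X \<longleftrightarrow> r \<le> X powr p"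
    proof
      assume "r powr (1 / p) \<le> X"
      then have "(r powr (1 / p)) powr p \<le> X powr p"
        using p by (intro powr_mono2) auto
      then show "r \<le> X powr p" using p r by (simp add: powr_powr)
    next
      assume "r \<le> X powr p"
      then have "r powr (1 / p) \<le> (X powr p) powr (1 / p)"
        using p r by (intro powr_mono2) auto
      then show "r powr (1 / p) \<le> X" using p X by (simp add: powr_powr)
    qed
    then show ?thesis
      using r X by (simp add: eq flip: I_def)
  qed (simp add: eq top_unique flip: I_def)
qed

text \<open>A Schur test with the weight u^(-s): \<open>hA\<close> integrates the averaged kernel
  against the weight, \<open>hB\<close> bounds the kernel times the dual power u^(s (p - 1)), and
  \<open>hexp\<close> says that the resulting powers of v are the ones that
  \<open>weak_type_from_circle\<close> asks for.\<close>

lemma Lp_weak_bound: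
  assumes c: "1 < c" and p: "1 < p" and q: "0 < q" "q < p" and A0: "0 < A0" and B0: "0 \<le> B0"
    and hA: "\<And>v. 0 < v \<Longrightarrow> v \<le> 1 \<Longrightarrow>
      (\<integral>\<^sup>+w. ennreal (radial_weight b c v (defect w) * defect w powr (-s)) \<partial>disc_borel) \<le> ennreal (A0 * v powr \<alpha>)"
    and hB: "\<And>v u. 0 < v \<Longrightarrow> v \<le> 1 \<Longrightarrow> 0 < u \<Longrightarrow> u < 1 \<Longrightarrow> radial_weight b c v u * u powr (s * (p - 1)) \<le> B0 * v powr \<beta>"
    and hexp: "\<alpha> * (p - 1) + \<beta> = - (a + 1 / q) * p"
  shows "weak_bound a b c q (Lp_norm_nonneg p)"
proof -
  define K where "K = 2 powr p * (kernel_const c * A0) powr (p - 1) * (kernel_const c * B0)"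
  have kc: "0 < kernel_const c" by (rule kernel_const_pos[OF c])
  have K: "0 \<le> K" using kc B0 by (simp add: K_def)
  show ?thesis
  proof (rule weak_boundI[OF q(1)])
    show "0 \<le> 1 + K / (p / q - 1)" using K q by simp
    fix f :: "complex \<Rightarrow> real" and X l :: real
    assume f [measurable]: "f \<in> borel_measurable borel" and f0: "\<And>w. 0 \<le> f w" and X: "0 < X"
      and fX: "Lp_norm_nonneg p f \<le> ennreal X" and l: "0 < l"
    have fI: "(\<integral>\<^sup>+w. ennreal (f w powr p) \<partial>disc_borel) \<le> ennreal (X powr p)"
      using fX X p f0 by (simp add: Lp_norm_nonneg_def Lp_norm_le_iff)
    show "emeasure disc_borel {z. ennreal l < ennreal (defect z powr a) * pos_op b c (\<lambda>w. ennreal (f w)) z}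
        \<le> ennreal ((1 + K / (p / q - 1)) * (X / l) powr q)"
    proof (rule weak_type_from_circle[OF _ q X K _ l])
      fix z :: complex and l :: real assume z: "cmod z < 1" and l: "0 < l"
      define v where "v = defect z"
      have v: "0 < v" "v \<le> 1" using defect_pos_le[OF z] by (auto simp: v_def)
      define A where "A = kernel_const c * A0 * v powr \<alpha>"
      define B where "B = kernel_const c * B0 * v powr \<beta> * X powr p"
      have A: "0 < A" using kc A0 v by (simp add: A_def)
      have "emeasure circle_measure {\<zeta>. ennreal l < pos_op b c (\<lambda>w. ennreal (f w)) (\<zeta> * z)} \<le>
          ennreal ((2 / l) powr p * A powr (p - 1)) * ennreal B"
      proof (rule circle_weak_pos_op[OF c z l A, where \<phi> = "\<lambda>u. ennreal (u powr (-s))" and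
            ?F2.0 = "\<lambda>w. ennreal (defect w powr (s * (p - 1)) * f w powr p)"])
        fix e :: real assume e: "0 < e"
        show "AE w in disc_borel. ennreal (f w) \<le> ennreal e * ennreal (defect w powr (-s)) +
            ennreal (e powr (1 - p)) * ennreal (defect w powr (s * (p - 1)) * f w powr p)"
        proof (rule eventually_mono[OF AE_disc_borel])
          fix w assume w: "0 < defect w \<and> defect w < 1 \<and> cmod w < 1 \<and> w \<noteq> 0"
          \<comment> \<open>Young's splitting is applied to u^s f, so that f is cut at the height e
            u^(-s), which varies with the radius.\<close>
          have "f w = defect w powr (-s) * (defect w powr s * f w)"
            using w by (simp add: powr_minus)
          also have "\<dots> \<le> defect w powr (-s) * (e + e powr (1 - p) * (defect w powr s * f w) powr p)"
            using e p f0 by (intro mult_left_mono young_powr_le) auto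
          also have "\<dots> = e * defect w powr (-s) + e powr (1 - p) * (defect w powr (s * (p - 1)) * f w powr p)"
          proof -
            have "defect w powr (-s) * (defect w powr s * f w) powr p = defect w powr (s * (p - 1)) * f w powr p"
              using f0[of w] by (simp add: powr_mult powr_powr powr_add[symmetric] algebra_simps flip: mult.assoc)
            then show ?thesis by (simp add: algebra_simps)
          qed
          finally show "ennreal (f w) \<le> ennreal e * ennreal (defect w powr (-s)) +
            ennreal (e powr (1 - p)) * ennreal (defect w powr (s * (p - 1)) * f w powr p)"
            using e by (simp add: ennreal_leI flip: ennreal_mult ennreal_plus)
        qed
      next
        have "(\<integral>\<^sup>+w. ennreal (kernel_const c * radial_weight b c (defect z) (defect w)) * ennreal (defect w powr (-s)) \<partial>disc_borel) =
            ennreal (kernel_const c) * (\<integral>\<^sup>+w. ennreal (radial_weight b c v (defect w) * defect w powr (-s)) \<partial>disc_borel)"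
          using kc by (subst nn_integral_cmult[symmetric])
            (auto simp: v_def radial_weight_def mult.assoc ennreal_mult[symmetric] intro!: nn_integral_cong)
        also have "\<dots> \<le> ennreal (kernel_const c) * ennreal (A0 * v powr \<alpha>)"
          by (intro mult_left_mono hA v) auto
        also have "\<dots> = ennreal A"
          using kc A0 by (simp add: A_def mult.assoc flip: ennreal_mult)
        finally show "(\<integral>\<^sup>+w. ennreal (kernel_const c * radial_weight b c (defect z) (defect w)) *
          ennreal (defect w powr (-s)) \<partial>disc_borel) \<le> ennreal A" .
      next
        have "(\<integral>\<^sup>+w. ennreal (kernel_const c * radial_weight b c (defect z) (defect w)) *
            ennreal (defect w powr (s * (p - 1)) * f w powr p) \<partial>disc_borel) \<le>
            (\<integral>\<^sup>+w. ennreal (kernel_const c * B0 * v powr \<beta>) * ennreal (f w powr p) \<partial>disc_borel)"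
        proof (intro nn_integral_mono_AE eventually_mono[OF AE_disc_borel])
          fix w assume w: "0 < defect w \<and> defect w < 1 \<and> cmod w < 1 \<and> w \<noteq> 0"
          have "kernel_const c * ((radial_weight b c v (defect w) * defect w powr (s * (p - 1))) * f w powr p) \<le>
              kernel_const c * ((B0 * v powr \<beta>) * f w powr p)"
            using w kc by (intro mult_left_mono mult_right_mono hB v) auto
          then show "ennreal (kernel_const c * radial_weight b c (defect z) (defect w)) *
            ennreal (defect w powr (s * (p - 1)) * f w powr p) \<le> ennreal (kernel_const c * B0 * v powr \<beta>) * ennreal (f w powr p)"
            using kc B0 by (simp add: v_def radial_weight_def mult.assoc ennreal_leI flip: ennreal_mult)
        qed
        also have "\<dots> = ennreal (kernel_const c * B0 * v powr \<beta>) * (\<integral>\<^sup>+w. ennreal (f w powr p) \<partial>disc_borel)"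
          by (rule nn_integral_cmult) simp
        also have "\<dots> \<le> ennreal (kernel_const c * B0 * v powr \<beta>) * ennreal (X powr p)"
          by (intro mult_left_mono fI) simp
        also have "\<dots> = ennreal B"
          using kc B0 by (simp add: B_def flip: ennreal_mult)
        finally show "(\<integral>\<^sup>+w. ennreal (kernel_const c * radial_weight b c (defect z) (defect w)) *
            ennreal (defect w powr (s * (p - 1)) * f w powr p) \<partial>disc_borel) \<le> ennreal B" .
      qed (use p in simp_all)
      also have "\<dots> = ennreal ((2 / l) powr p * A powr (p - 1) * B)"
        using kc B0 by (simp add: B_def flip: ennreal_mult)
      also have "(2 / l) powr p * A powr (p - 1) * B = K * (X * defect z powr (- (a + 1 / q)) / l) powr p"
      proof -
        have "A powr (p - 1) = (kernel_const c * A0) powr (p - 1) * v powr (\<alpha> * (p - 1))"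
          using kc A0 by (simp add: A_def powr_mult powr_powr)
        moreover have "(X * v powr (- (a + 1 / q)) / l) powr p = X powr p * v powr (\<alpha> * (p - 1) + \<beta>) / l powr p"
          unfolding hexp using X l v by (simp add: powr_mult powr_divide powr_powr)
        moreover have "(2 / l) powr p = 2 powr p / l powr p"
          using l by (simp add: powr_divide)
        ultimately show ?thesis
          by (simp add: v_def[symmetric] K_def B_def powr_add)
      qed
      finally show "emeasure circle_measure {\<zeta>. ennreal l < pos_op b c (\<lambda>w. ennreal (f w)) (\<zeta> * z)} \<le>
        ennreal (K * (X * defect z powr (- (a + 1 / q)) / l) powr p)" .
    qed simp
  qed
qed

text \<open>Each bound replaces the maximum by one of its arguments; the first is sharp for u >= v,
  the second for u <= v.\<close>

lemma radial_weight_le_powr: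
  assumes c: "1 < c" and "0 < u" "0 < v"
  shows "radial_weight b c v u \<le> u powr (b + 1 - c)"
    and "radial_weight b c v u \<le> u powr b * v powr (1 - c)"
proof -
  have "max u v powr (1 - c) \<le> u powr (1 - c)" "max u v powr (1 - c) \<le> v powr (1 - c)"
    using assms by (auto intro!: powr_mono2')
  then have "radial_weight b c v u \<le> u powr b * u powr (1 - c)" "radial_weight b c v u \<le> u powr b * v powr (1 - c)"
    by (auto simp: radial_weight_def intro!: mult_left_mono)
  then show "radial_weight b c v u \<le> u powr (b + 1 - c)" "radial_weight b c v u \<le> u powr b * v powr (1 - c)"
    by (simp_all add: powr_add[symmetric] add_diff_eq)
qed

text \<open>Here q = -1/a, so a + 1/q = 0 and no power of v may be lost: the weight has to make both
  Schur bounds constant.\<close>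

lemma Lp_weak_bound_small:
  assumes c: "1 < c" and a: "a < 0" and p: "1 < p" and \<sigma>: "1 / p < b + 2 - c" "b + 2 - c < - a"
  shows "weak_bound a b c (- 1 / a) (Lp_norm_nonneg p)"
proof -
  define \<sigma> where "\<sigma> = b + 2 - c"
  \<comment> \<open>This exponent makes u^(\<sigma> - 1) u^(s (p - 1)) identically 1. Then s <
    \<sigma>, the integrability of u^(\<sigma> - 1 - s), is equivalent to \<sigma> p > 1.\<close>
  define s where "s = (1 - \<sigma>) / (p - 1)"
  have \<sigma>': "1 < \<sigma> * p" "\<sigma> < - a" using \<sigma> p by (auto simp: \<sigma>_def field_simps)
  have s: "s < \<sigma>" "s * (p - 1) = 1 - \<sigma>" using p \<sigma>' by (auto simp: s_def field_simps)
  have "- 1 / a < 1 / \<sigma>"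
    using \<sigma>' a p by (smt (verit, best) divide_minus_left divide_minus_right frac_less2 mult_pos_pos mult_nonpos_nonneg)
  also have "1 / \<sigma> < p"
    using \<sigma>' p by (smt (verit, best) mult_nonpos_nonneg pos_divide_less_eq mult.commute)
  finally have q: "- 1 / a < p" .
  show ?thesis
  proof (rule Lp_weak_bound[OF c p, where s = s and \<alpha> = 0 and \<beta> = 0 and ?A0.0 = "1 / (\<sigma> - s)" and ?B0.0 = 1])
    fix v :: real assume v: "0 < v" "v \<le> 1"
    have "(\<integral>\<^sup>+w. ennreal (radial_weight b c v (defect w) * defect w powr (-s)) \<partial>disc_borel) \<le>
        (\<integral>\<^sup>+w. ennreal (defect w powr (\<sigma> - 1 - s)) \<partial>disc_borel)"
    proof (intro nn_integral_mono_AE eventually_mono[OF AE_disc_borel] ennreal_leI)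
      fix w assume w: "0 < defect w \<and> defect w < 1 \<and> cmod w < 1 \<and> w \<noteq> 0"
      have "radial_weight b c v (defect w) * defect w powr (-s) \<le> defect w powr (\<sigma> - 1) * defect w powr (-s)"
        using radial_weight_le_powr(1)[OF c, of "defect w" v b] w v
        by (intro mult_right_mono) (auto simp: \<sigma>_def algebra_simps)
      then show "radial_weight b c v (defect w) * defect w powr (-s) \<le> defect w powr (\<sigma> - 1 - s)"
        by (simp add: powr_add[symmetric])
    qed
    also have "\<dots> \<le> ennreal (1 / (\<sigma> - 1 - s + 1))"
      using s by (intro nn_integral_disc_powr) simp
    finally show "(\<integral>\<^sup>+w. ennreal (radial_weight b c v (defect w) * defect w powr (-s)) \<partial>disc_borel) \<le> ennreal (1 / (\<sigma> - s) * v powr 0)"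
      using v by (simp add: algebra_simps)
  next
    fix v u :: real assume v: "0 < v" "v \<le> 1" and u: "0 < u" "u < 1"
    have "radial_weight b c v u * u powr (s * (p - 1)) \<le> u powr (\<sigma> - 1) * u powr (1 - \<sigma>)"
      unfolding s(2) using radial_weight_le_powr(1)[OF c, of u v b] u v
      by (intro mult_right_mono) (auto simp: \<sigma>_def algebra_simps)
    then show "radial_weight b c v u * u powr (s * (p - 1)) \<le> 1 * v powr 0"
      using u v by (simp add: powr_add[symmetric])
  qed (use a q s in \<open>auto simp: field_simps\<close>)
qed

text \<open>With 1/p above \<sigma> the operator loses a power of v. The averaged kernel is cut at u
  = v; both pieces of its integral against the weight scale like v^(\<sigma> - s).\<close>

lemma Lp_weak_bound_large:
  assumes c: "1 < c" and p: "1 < p" and \<sigma>: "0 < b + 2 - c" "b + 2 - c < 1 / p" and b: "1 / p < b + 1"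
    and q: "0 < q" "q < p" "1 / q = 1 / p - a - (b + 2 - c)"
  shows "weak_bound a b c q (Lp_norm_nonneg p)"
proof -
  define \<sigma> where "\<sigma> = b + 2 - c"
  have \<sigma>': "0 < \<sigma>" "\<sigma> * p < 1" using \<sigma> p by (auto simp: \<sigma>_def field_simps)
  have bp: "1 < (b + 1) * p" using b p by (simp add: field_simps)
  have b0: "0 < b + 1" using b p by (smt (verit) divide_pos_pos)
  \<comment> \<open>Four conditions on the weight exponent. Convergence of the pieces u < v and u >=
    v needs s < b + 1 and s > \<sigma>; the pointwise bound has its maximum at u = v if -b < s (p -
    1) < 1 - \<sigma>. The hypotheses \<sigma> < 1/p < b + 1 and c > 1 leave room for a common
    s.\<close>
  have "max \<sigma> (- b / (p - 1)) < min (b + 1) ((1 - \<sigma>) / (p - 1))"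
  proof -
    have "\<sigma> < b + 1" using c by (simp add: \<sigma>_def)
    moreover have "\<sigma> < (1 - \<sigma>) / (p - 1)" using \<sigma>' p by (simp add: field_simps)
    moreover have "- b / (p - 1) < b + 1" using bp p by (simp add: field_simps)
    moreover have "- b / (p - 1) < (1 - \<sigma>) / (p - 1)"
      using p c by (intro divide_strict_right_mono) (auto simp: \<sigma>_def)
    ultimately show ?thesis by simp
  qed
  then obtain s where "max \<sigma> (- b / (p - 1)) < s" "s < min (b + 1) ((1 - \<sigma>) / (p - 1))"
    using dense by blast
  then have s: "\<sigma> < s" "- b < s * (p - 1)" "s < b + 1" "s * (p - 1) < 1 - \<sigma>"
    using p by (auto simp: field_simps)
  define A0 where "A0 = 1 / (b - s + 1) + 1 / (s - \<sigma>)"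
  show ?thesis
  proof (rule Lp_weak_bound[OF c p q(1,2), where s = s and \<alpha> = "\<sigma> - s" and \<beta> = "\<sigma> - 1 + s * (p - 1)" and ?A0.0 = A0 and ?B0.0 = 1])
    show "0 < A0" using s by (auto simp: A0_def intro!: add_pos_pos)
    have "(\<sigma> - s) * (p - 1) + (\<sigma> - 1 + s * (p - 1)) = \<sigma> * p - 1" by (simp add: algebra_simps)
    also have "\<dots> = - (a + 1 / q) * p"
      using p unfolding q(3) by (simp add: \<sigma>_def field_simps)
    finally show "(\<sigma> - s) * (p - 1) + (\<sigma> - 1 + s * (p - 1)) = - (a + 1 / q) * p" .
  next
    fix v :: real assume v: "0 < v" "v \<le> 1"
    have "(\<integral>\<^sup>+w. ennreal (radial_weight b c v (defect w) * defect w powr (-s)) \<partial>disc_borel) \<le>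
        (\<integral>\<^sup>+w. ennreal (v powr (1 - c)) * (ennreal (defect w powr (b - s)) * indicator {..<v} (defect w)) +
          ennreal (defect w powr (\<sigma> - 1 - s)) * indicator {v..} (defect w) \<partial>disc_borel)"
    proof (intro nn_integral_mono_AE eventually_mono[OF AE_disc_borel])
      fix w assume w: "0 < defect w \<and> defect w < 1 \<and> cmod w < 1 \<and> w \<noteq> 0"
      show "ennreal (radial_weight b c v (defect w) * defect w powr (-s)) \<le>
        ennreal (v powr (1 - c)) * (ennreal (defect w powr (b - s)) * indicator {..<v} (defect w)) +
          ennreal (defect w powr (\<sigma> - 1 - s)) * indicator {v..} (defect w)"
      proof (cases "defect w < v")
        case True
        have "radial_weight b c v (defect w) * defect w powr (-s) \<le> (defect w powr b * v powr (1 - c)) * defect w powr (-s)"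
          using radial_weight_le_powr(2)[OF c, of "defect w" v b] w v by (intro mult_right_mono) auto
        also have "\<dots> = v powr (1 - c) * defect w powr (b - s)"
          by (simp add: powr_add[symmetric] mult_ac)
        finally show ?thesis using True by (simp add: ennreal_leI flip: ennreal_mult)
      next
        case False
        have "radial_weight b c v (defect w) * defect w powr (-s) \<le> defect w powr (\<sigma> - 1) * defect w powr (-s)"
          using radial_weight_le_powr(1)[OF c, of "defect w" v b] w v
          by (intro mult_right_mono) (auto simp: \<sigma>_def algebra_simps)
        then have "radial_weight b c v (defect w) * defect w powr (-s) \<le> defect w powr (\<sigma> - 1 - s)"
          by (simp add: powr_add[symmetric])
        then show ?thesis using False by (simp add: ennreal_leI)
      qed
    qed
    also have "\<dots> = ennreal (v powr (1 - c)) * (\<integral>\<^sup>+w. ennreal (defect w powr (b - s)) * indicator {..<v} (defect w) \<partial>disc_borel) +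
        (\<integral>\<^sup>+w. ennreal (defect w powr (\<sigma> - 1 - s)) * indicator {v..} (defect w) \<partial>disc_borel)"
      by (subst nn_integral_add, simp, simp, subst nn_integral_cmult, simp) (rule refl)
    also have "\<dots> \<le> ennreal (v powr (1 - c)) * ennreal (v powr (b - s + 1) / (b - s + 1)) +
        ennreal (v powr (\<sigma> - 1 - s + 1) / (- (\<sigma> - 1 - s) - 1))"
      using s v by (intro add_mono mult_left_mono nn_integral_disc_powr_near nn_integral_disc_powr_far) auto
    also have "\<dots> = ennreal (v powr (1 - c) * v powr (b - s + 1) / (b - s + 1) + v powr (\<sigma> - s) / (s - \<sigma>))"
      using s by (simp add: algebra_simps flip: ennreal_mult ennreal_plus)
    also have "v powr (1 - c) * v powr (b - s + 1) = v powr (\<sigma> - s)"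
      by (subst powr_add[symmetric]) (simp add: \<sigma>_def algebra_simps)
    finally show "(\<integral>\<^sup>+w. ennreal (radial_weight b c v (defect w) * defect w powr (-s)) \<partial>disc_borel) \<le> ennreal (A0 * v powr (\<sigma> - s))"
      by (simp add: A0_def algebra_simps)
  next
    fix v u :: real assume v: "0 < v" "v \<le> 1" and u: "0 < u" "u < 1"
    show "radial_weight b c v u * u powr (s * (p - 1)) \<le> 1 * v powr (\<sigma> - 1 + s * (p - 1))"
    proof (cases "u < v")
      case True
      have "radial_weight b c v u * u powr (s * (p - 1)) \<le> (u powr b * v powr (1 - c)) * u powr (s * (p - 1))"
        using radial_weight_le_powr(2)[OF c u(1) v(1)] by (intro mult_right_mono) auto
      also have "\<dots> = u powr (b + s * (p - 1)) * v powr (1 - c)"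
        by (simp add: powr_add)
      also have "\<dots> \<le> v powr (b + s * (p - 1)) * v powr (1 - c)"
        using True u s by (intro mult_right_mono powr_mono2) auto
      also have "\<dots> = v powr (\<sigma> - 1 + s * (p - 1))"
        by (subst powr_add[symmetric]) (simp add: \<sigma>_def algebra_simps)
      finally show ?thesis by simp
    next
      case False
      have "radial_weight b c v u * u powr (s * (p - 1)) \<le> u powr (\<sigma> - 1) * u powr (s * (p - 1))"
        using radial_weight_le_powr(1)[OF c u(1) v(1), of b] by (intro mult_right_mono) (auto simp: \<sigma>_def algebra_simps)
      also have "\<dots> = u powr (\<sigma> - 1 + s * (p - 1))"
        by (simp add: powr_add)
      also have "\<dots> \<le> v powr (\<sigma> - 1 + s * (p - 1))"
        using False v s by (intro powr_mono2') auto
      finally show ?thesis by simp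
    qed
  qed simp
qed

text \<open>A bounded input is dominated by a constant, which is radial, so that a pointwise bound
  is available; \<sigma> > 0 is the integrability of u^(\<sigma> - 1).\<close>

lemma Linfty_weak_bound:
  assumes c: "1 < c" and a: "a < 0" and \<sigma>: "0 < b + 2 - c"
  shows "weak_bound a b c (- 1 / a) (\<lambda>f. Lp_norm \<infinity> (\<lambda>w. of_real (f w)))"
proof -
  define \<sigma> where "\<sigma> = b + 2 - c"
  define k where "k = kernel_const c / \<sigma>"
  have k: "0 < k" using kernel_const_pos[OF c] \<sigma> by (simp add: k_def \<sigma>_def)
  show ?thesis
  proof (rule weak_boundI[where C = "k powr (- 1 / a)"])
    fix f :: "complex \<Rightarrow> real" and X l :: real
    assume [measurable]: "f \<in> borel_measurable borel" and f0: "\<And>w. 0 \<le> f w" and X: "0 < X"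
      and fX: "Lp_norm \<infinity> (\<lambda>w. of_real (f w)) \<le> ennreal X" and l: "0 < l"
    have "AE w in disc_measure. ennreal (cmod (of_real (f w))) \<le> esssup disc_measure (\<lambda>w. ennreal (cmod (of_real (f w))))"
      by (intro esssup_AE borel_measurable_disc_measure) measurable
    then have "AE w in disc_measure. ennreal (f w) \<le> ennreal X"
      using fX f0 by (auto simp: Lp_norm_def elim!: eventually_mono order_trans)
    then have fX': "AE w in disc_borel. ennreal (f w) \<le> ennreal X"
      unfolding disc_borel_def by (subst AE_distr_iff) (auto intro: measurable_id_disc_measure)
    have "emeasure disc_borel {z. ennreal l < ennreal (defect z powr a) * pos_op b c (\<lambda>w. ennreal (f w)) z}
        \<le> ennreal ((k * X / l) powr (- 1 / a))"
    proof (rule weak_type_pointwise[OF _ _ _ _ l])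
      fix z :: complex assume z: "cmod z < 1"
      note v = defect_pos[OF z]
      have "pos_op b c (\<lambda>w. ennreal (f w)) z \<le> pos_op b c (\<lambda>w. ennreal X) z"
        by (rule pos_op_mono_AE[OF fX'])
      also have "\<dots> \<le> (\<integral>\<^sup>+w. ennreal (kernel_const c * radial_weight b c (defect z) (defect w)) * ennreal X \<partial>disc_borel)"
        using pos_op_radial_le[OF c z, of "\<lambda>_. ennreal X" b] by simp
      also have "\<dots> \<le> (\<integral>\<^sup>+w. ennreal (kernel_const c * X) * ennreal (defect w powr (\<sigma> - 1)) \<partial>disc_borel)"
      proof (intro nn_integral_mono_AE eventually_mono[OF AE_disc_borel])
        fix w assume w: "0 < defect w \<and> defect w < 1 \<and> cmod w < 1 \<and> w \<noteq> 0"
        have "kernel_const c * X * radial_weight b c (defect z) (defect w) \<le> kernel_const c * X * defect w powr (\<sigma> - 1)"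
          using radial_weight_le_powr(1)[OF c, of "defect w" "defect z" b] w v kernel_const_pos[OF c] X
          by (intro mult_left_mono) (auto simp: \<sigma>_def algebra_simps)
        then show "ennreal (kernel_const c * radial_weight b c (defect z) (defect w)) * ennreal X \<le>
            ennreal (kernel_const c * X) * ennreal (defect w powr (\<sigma> - 1))"
          using X kernel_const_pos[OF c]
          by (simp add: radial_weight_def mult_ac ennreal_leI flip: ennreal_mult)
      qed
      also have "\<dots> = ennreal (kernel_const c * X) * (\<integral>\<^sup>+w. ennreal (defect w powr (\<sigma> - 1)) \<partial>disc_borel)"
        by (rule nn_integral_cmult) simp
      also have "\<dots> \<le> ennreal (kernel_const c * X) * ennreal (1 / (\<sigma> - 1 + 1))"
        using \<sigma> by (intro mult_left_mono nn_integral_disc_powr) (auto simp: \<sigma>_def)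
      also have "\<dots> = ennreal (k * X)"
        using X kernel_const_pos[OF c] \<sigma> by (simp add: k_def \<sigma>_def flip: ennreal_mult)
      finally show "pos_op b c (\<lambda>w. ennreal (f w)) z \<le> ennreal (k * X * defect z powr - (a + 1 / (- 1 / a)))"
        using v a by simp
    qed (use k X a in auto)
    also have "(k * X / l) powr (- 1 / a) = k powr (- 1 / a) * (X / l) powr (- 1 / a)"
      using k X l by (simp add: powr_mult powr_divide)
    finally show "emeasure disc_borel {z. ennreal l < ennreal (defect z powr a) * pos_op b c (\<lambda>w. ennreal (f w)) z}
        \<le> ennreal (k powr (- 1 / a) * (X / l) powr (- 1 / a))" .
  qed (use a in auto)
qed

section \<open>Lorentz endpoints\<close>

lemma distribution_eq:
  assumes [measurable]: "f \<in> borel_measurable borel"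
  shows "distribution f t = measure disc_borel {w. t < cmod (f w)}"
proof -
  have "{z \<in> ball 0 1. t < cmod (f z)} = (\<lambda>w. w) -` {w. t < cmod (f w)} \<inter> space disc_measure"
    by auto
  then show ?thesis
    unfolding distribution_def disc_borel_def
    by (subst measure_distr) (auto intro: measurable_id_disc_measure)
qed

text \<open>The majorant in \<open>weight\<close> is a product of a power of v and of u^(\<tau> -
  1), and the latter lies in the weak Lebesgue space dual to the Lorentz space with indices 1/\<tau>
  and 1. Both endpoints of the theorem are instances.\<close>

lemma Lorentz_weak_bound:
  assumes c: "1 < c" and \<tau>: "0 < \<tau>" "\<tau> < 1" and q: "0 < q" "\<tau> < 1 / q"
    and weight: "\<And>v u. 0 < v \<Longrightarrow> v \<le> 1 \<Longrightarrow> 0 < u \<Longrightarrow> u < 1 \<Longrightarrow>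
      radial_weight b c v u \<le> v powr (- (a + 1 / q)) * u powr (\<tau> - 1)"
  shows "weak_bound a b c q (\<lambda>f. Lorentz1_norm (1 / \<tau>) (\<lambda>w. of_real (f w)))"
proof -
  define \<gamma> where "\<gamma> = a + 1 / q"
  define kc where "kc = kernel_const c"
  have kc: "0 < kc" using kernel_const_pos[OF c] by (simp add: kc_def)
  \<comment> \<open>The auxiliary exponent \<open>p\<close> has to exceed q for
    \<open>weak_type_from_circle\<close>, and to stay below 1/\<tau> so that s > \<tau>
    below.\<close>
  have "max 1 q < 1 / \<tau>" using \<tau> q by (simp add: field_simps)
  then obtain p where p0: "max 1 q < p" "p < 1 / \<tau>" using dense by blast
  then have p: "1 < p" "q < p" "\<tau> * p < 1" using \<tau> by (auto simp: field_simps)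
  \<comment> \<open>Chosen so that (d t / u)^s raised to the power 1 - p is (d t / u)^(\<tau> - 1),
    whose dependence on u cancels the factor u^(\<tau> - 1) of the majorant.\<close>
  define s where "s = (1 - \<tau>) / (p - 1)"
  have s: "\<tau> < s" "s * (p - 1) = 1 - \<tau>" using p by (auto simp: s_def field_simps)
  have s': "s * (1 - p) = \<tau> - 1" using s(2) by (simp add: algebra_simps)
  define K where "K = 2 powr p * kc powr p * (1 / (s - \<tau>)) powr (p - 1) * \<tau> powr p"
  have K: "0 \<le> K" by (simp add: K_def)
  show ?thesis
  proof (rule weak_boundI[OF q(1)])
    show "0 \<le> (2 * kc) powr q + (1 + K / (p / q - 1)) * 2 powr q" using K p q by simp
    fix f :: "complex \<Rightarrow> real" and X l :: real
    assume f [measurable]: "f \<in> borel_measurable borel" and f0: "\<And>w. 0 \<le> f w" and X: "0 < X"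
      and fX: "Lorentz1_norm (1 / \<tau>) (\<lambda>w. complex_of_real (f w)) \<le> ennreal X" and l: "0 < l"
    define d where "d t = measure disc_borel {w. t < f w}" for t
    have d0: "0 \<le> d t" for t by (simp add: d_def)
    have "(\<lambda>t. - d t) \<in> borel_measurable borel"
      by (intro borel_measurable_mono monoI) (auto simp: d_def intro!: disc_borel.finite_measure_mono)
    then have [measurable]: "d \<in> borel_measurable borel"
      using borel_measurable_uminus[of "\<lambda>t. - d t" borel] by simp
    define L where "L = \<tau> * X"
    have L: "0 < L" using \<tau> X by (simp add: L_def)
    have dL: "(\<integral>\<^sup>+t\<in>{0<..}. ennreal (d t powr \<tau>) \<partial>lborel) \<le> ennreal L"
    proof -
      have eq: "Lorentz1_norm (1 / \<tau>) (\<lambda>w. complex_of_real (f w)) = ennreal (1 / \<tau>) * (\<integral>\<^sup>+t\<in>{0<..}. ennreal (d t powr \<tau>) \<partial>lborel)"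
        using f0 by (simp add: Lorentz1_norm_def distribution_eq d_def)
      have "ennreal \<tau> * (ennreal (1 / \<tau>) * (\<integral>\<^sup>+t\<in>{0<..}. ennreal (d t powr \<tau>) \<partial>lborel)) \<le> ennreal \<tau> * ennreal X"
        using fX unfolding eq by (rule mult_left_mono) simp
      then show ?thesis
        using \<tau> X by (simp add: L_def mult.assoc[symmetric] flip: ennreal_mult)
    qed
    \<comment> \<open>Since \<open>d\<close> is the distribution function of f, N u is the
      decreasing rearrangement of f at u. F w is the excess of f w over that rearrangement at the
      defect of w. Levels with d t = 0 are left out of it, because d t is going to be raised to the
      negative power \<tau> - 1.\<close>
    define N where "N u = (\<integral>\<^sup>+t\<in>{0<..}. (if u < d t then 1 else 0) \<partial>lborel)" for u
    define F where "F w = (\<integral>\<^sup>+t\<in>{0<..}. (if t < f w \<and> 0 < d t \<and> d t \<le> defect w then 1 else 0) \<partial>lborel)" for w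
    have [measurable]: "N \<in> borel_measurable borel" unfolding N_def by measurable
    have [measurable]: "F \<in> borel_measurable borel" unfolding F_def by measurable
    interpret P: pair_sigma_finite disc_borel lborel ..
    \<comment> \<open>A level t with d t = 0 has a null level set, so by Tonelli these levels
      contribute nothing at almost every w.\<close>
    have null: "AE w in disc_borel. (\<integral>\<^sup>+t\<in>{0<..}. (if t < f w \<and> d t = 0 then 1 else 0) \<partial>lborel) = 0"
    proof (subst nn_integral_0_iff_AE[symmetric])
      have "(\<integral>\<^sup>+w. (\<integral>\<^sup>+t\<in>{0<..}. (if t < f w \<and> d t = 0 then 1 else 0) \<partial>lborel) \<partial>disc_borel) =
          (\<integral>\<^sup>+t. \<integral>\<^sup>+w. (if t < f w \<and> d t = 0 then 1 else 0) * indicator {0<..} t \<partial>disc_borel \<partial>lborel)"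
        by (rule P.Fubini'[symmetric]) measurable
      also have "\<dots> \<le> (\<integral>\<^sup>+t. 0 \<partial>(lborel :: real measure))"
      proof (rule nn_integral_mono)
        fix t :: real
        show "(\<integral>\<^sup>+w. (if t < f w \<and> d t = 0 then 1 else 0) * indicator {0<..} t \<partial>disc_borel) \<le> 0"
        proof (cases "d t = 0")
          case True
          have "(\<integral>\<^sup>+w. (if t < f w \<and> d t = 0 then 1 else 0) * indicator {0<..} t \<partial>disc_borel) \<le>
              (\<integral>\<^sup>+w. indicator {w. t < f w} w \<partial>disc_borel)"
            by (intro nn_integral_mono) (auto simp: indicator_def)
          also have "\<dots> = emeasure disc_borel {w. t < f w}" by (rule nn_integral_indicator) simp
          also have "\<dots> = 0" using True by (simp add: disc_borel.emeasure_eq_measure d_def)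
          finally show ?thesis .
        qed simp
      qed
      finally show "(\<integral>\<^sup>+w. (\<integral>\<^sup>+t\<in>{0<..}. (if t < f w \<and> d t = 0 then 1 else 0) \<partial>lborel) \<partial>disc_borel) = 0"
        by simp
    qed measurable
    have split: "AE w in disc_borel. ennreal (f w) \<le> N (defect w) + F w"
    proof (rule eventually_mono[OF null])
      fix w assume w: "(\<integral>\<^sup>+t\<in>{0<..}. (if t < f w \<and> d t = 0 then 1 else 0) \<partial>lborel) = (0::ennreal)"
      define g1 g2 g3 :: "real \<Rightarrow> ennreal" where
        "g1 t = (if defect w < d t then 1 else 0) * indicator {0<..} t" and
        "g2 t = (if t < f w \<and> 0 < d t \<and> d t \<le> defect w then 1 else 0) * indicator {0<..} t" and
        "g3 t = (if t < f w \<and> d t = 0 then 1 else 0) * indicator {0<..} t" for t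
      have g [measurable]: "g1 \<in> borel_measurable lborel" "g2 \<in> borel_measurable lborel" "g3 \<in> borel_measurable lborel"
        unfolding g1_def g2_def g3_def by measurable
      have "ennreal (f w) = (\<integral>\<^sup>+t. indicator {0<..<f w} t \<partial>lborel)" using f0[of w] by simp
      also have "\<dots> \<le> (\<integral>\<^sup>+t. (g1 t + g2 t) + g3 t \<partial>lborel)"
      proof (rule nn_integral_mono)
        fix t
        consider "d t = 0" | "0 < d t" "d t \<le> defect w" | "defect w < d t" "d t \<noteq> 0"
          using d0[of t] by fastforce
        then show "indicator {0<..<f w} t \<le> g1 t + g2 t + g3 t"
          by cases (auto simp: indicator_def g1_def g2_def g3_def)
      qed
      also have "\<dots> = integral\<^sup>N lborel g1 + integral\<^sup>N lborel g2 + integral\<^sup>N lborel g3"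
        by (simp add: nn_integral_add)
      also have "integral\<^sup>N lborel g1 = N (defect w)"
        by (simp add: N_def g1_def[abs_def])
      also have "integral\<^sup>N lborel g2 = F w"
        by (simp add: F_def g2_def[abs_def])
      also have "integral\<^sup>N lborel g3 = 0"
        using w by (simp add: g3_def[abs_def])
      finally show "ennreal (f w) \<le> N (defect w) + F w" by simp
    qed
    \<comment> \<open>The rearrangement part is radial and hence estimated pointwise. Integrating
      u^(\<tau> - 1) over u < d t gives (d t)^\<tau> / \<tau>, and the remaining integral over t is
      the Lorentz norm up to the factor \<tau>.\<close>
    have near: "emeasure disc_borel {z. ennreal (l / 2) < ennreal (defect z powr a) * pos_op b c (\<lambda>w. N (defect w)) z}
        \<le> ennreal ((kc * X / (l / 2)) powr q)"
    proof (rule weak_type_pointwise[OF _ q(1)])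
      fix z :: complex assume z: "cmod z < 1"
      define v where "v = defect z"
      have v: "0 < v" "v \<le> 1" using defect_pos_le[OF z] by (auto simp: v_def)
      have "pos_op b c (\<lambda>w. N (defect w)) z \<le> (\<integral>\<^sup>+w. ennreal (kc * radial_weight b c v (defect w)) * N (defect w) \<partial>disc_borel)"
        unfolding kc_def v_def by (intro pos_op_radial_le c z) simp
      also have "\<dots> \<le> (\<integral>\<^sup>+w. ennreal (kc * v powr (-\<gamma>)) * (ennreal (defect w powr (\<tau> - 1)) * N (defect w)) \<partial>disc_borel)"
      proof (intro nn_integral_mono_AE eventually_mono[OF AE_disc_borel])
        fix w assume w: "0 < defect w \<and> defect w < 1 \<and> cmod w < 1 \<and> w \<noteq> 0"
        have "kc * radial_weight b c v (defect w) \<le> kc * (v powr (-\<gamma>) * defect w powr (\<tau> - 1))"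
          using w v kc weight by (intro mult_left_mono) (auto simp: \<gamma>_def)
        then have "ennreal (kc * radial_weight b c v (defect w)) \<le> ennreal (kc * v powr (-\<gamma>)) * ennreal (defect w powr (\<tau> - 1))"
          using kc by (simp add: mult.assoc ennreal_leI flip: ennreal_mult)
        then show "ennreal (kc * radial_weight b c v (defect w)) * N (defect w) \<le>
            ennreal (kc * v powr (-\<gamma>)) * (ennreal (defect w powr (\<tau> - 1)) * N (defect w))"
          unfolding mult.assoc[symmetric] by (rule mult_right_mono) simp
      qed
      also have "\<dots> = ennreal (kc * v powr (-\<gamma>)) * (\<integral>\<^sup>+w. ennreal (defect w powr (\<tau> - 1)) * N (defect w) \<partial>disc_borel)"
        by (rule nn_integral_cmult) simp
      also have "(\<integral>\<^sup>+w. ennreal (defect w powr (\<tau> - 1)) * N (defect w) \<partial>disc_borel) =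
          (\<integral>\<^sup>+w. \<integral>\<^sup>+t. ennreal (defect w powr (\<tau> - 1)) * ((if defect w < d t then 1 else 0) * indicator {0<..} t) \<partial>lborel \<partial>disc_borel)"
        unfolding N_def by (subst nn_integral_cmult) auto
      also have "\<dots> = (\<integral>\<^sup>+t. \<integral>\<^sup>+w. ennreal (defect w powr (\<tau> - 1)) * ((if defect w < d t then 1 else 0) * indicator {0<..} t) \<partial>disc_borel \<partial>lborel)"
        by (rule P.Fubini'[symmetric]) measurable
      also have "\<dots> \<le> (\<integral>\<^sup>+t. ennreal (1 / \<tau>) * (ennreal (d t powr \<tau>) * indicator {0<..} t) \<partial>lborel)"
      proof (rule nn_integral_mono)
        fix t :: real
        have "(\<integral>\<^sup>+w. ennreal (defect w powr (\<tau> - 1)) * ((if defect w < d t then 1 else 0) * indicator {0<..} t) \<partial>disc_borel) =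
            (\<integral>\<^sup>+w. (ennreal (defect w powr (\<tau> - 1)) * indicator {..<d t} (defect w)) * indicator {0<..} t \<partial>disc_borel)"
          by (intro nn_integral_cong) (auto simp: indicator_def)
        also have "\<dots> = (\<integral>\<^sup>+w. ennreal (defect w powr (\<tau> - 1)) * indicator {..<d t} (defect w) \<partial>disc_borel) * indicator {0<..} t"
          by (rule nn_integral_multc) simp
        also have "\<dots> \<le> ennreal (d t powr (\<tau> - 1 + 1) / (\<tau> - 1 + 1)) * indicator {0<..} t"
          using \<tau> d0 by (intro mult_right_mono nn_integral_disc_powr_near) auto
        also have "\<dots> = ennreal (1 / \<tau>) * (ennreal (d t powr \<tau>) * indicator {0<..} t)"
          using \<tau> by (simp add: mult.assoc[symmetric] flip: ennreal_mult)
        finally show "(\<integral>\<^sup>+w. ennreal (defect w powr (\<tau> - 1)) * ((if defect w < d t then 1 else 0) * indicator {0<..} t) \<partial>disc_borel) \<le>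
            ennreal (1 / \<tau>) * (ennreal (d t powr \<tau>) * indicator {0<..} t)" .
      qed
      also have "\<dots> = ennreal (1 / \<tau>) * (\<integral>\<^sup>+t\<in>{0<..}. ennreal (d t powr \<tau>) \<partial>lborel)"
        by (rule nn_integral_cmult) simp
      also have "\<dots> \<le> ennreal (1 / \<tau>) * ennreal L" by (intro mult_left_mono dL) simp
      also have "\<dots> = ennreal X" using \<tau> X by (simp add: L_def flip: ennreal_mult)
      also have "ennreal (kc * v powr (-\<gamma>)) * ennreal X = ennreal (kc * X * v powr (-\<gamma>))"
        using kc X by (simp add: mult_ac flip: ennreal_mult)
      finally show "pos_op b c (\<lambda>w. N (defect w)) z \<le> ennreal (kc * X * defect z powr (- (a + 1 / q)))"
        by (simp add: v_def \<gamma>_def mult_left_mono)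
    qed (use kc X l in auto)
    \<comment> \<open>Young's splitting, layer by layer, with M = (d t / u)^s: each indicator is at
      most e M + e^(1 - p) M^(1 - p). The first term is made radial by dropping the level set, the
      second keeps it.\<close>
    let ?g1 = "\<lambda>u t. if 0 < d t \<and> d t \<le> u then ennreal (d t powr s * u powr (-s)) else 0"
    let ?g2 = "\<lambda>w t. if t < f w \<and> 0 < d t \<and> d t \<le> defect w then ennreal ((d t powr s * defect w powr (-s)) powr (1 - p)) else 0"
    have far: "emeasure disc_borel {z. ennreal (l / 2) < ennreal (defect z powr a) * pos_op b c F z}
        \<le> ennreal ((1 + K / (p / q - 1)) * (X / (l / 2)) powr q)"
    proof (rule weak_type_from_circle[OF _ q(1) p(2) X K])
      fix z :: complex and l :: real assume z: "cmod z < 1" and l: "0 < l"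
      define v where "v = defect z"
      have v: "0 < v" "v \<le> 1" using defect_pos_le[OF z] by (auto simp: v_def)
      define A where "A = kc * v powr (-\<gamma>) * (L / (s - \<tau>))"
      define B where "B = kc * v powr (-\<gamma>) * L"
      have A: "0 < A" using kc v L s by (simp add: A_def)
      have circ: "emeasure circle_measure {\<zeta>. ennreal l < pos_op b c F (\<zeta> * z)} \<le> ennreal ((2 / l) powr p * A powr (p - 1)) * ennreal B"
      proof (rule circle_weak_pos_op[OF c z l A, where
            \<phi> = "\<lambda>u. \<integral>\<^sup>+t\<in>{0<..}. ?g1 u t \<partial>lborel" and
            ?F2.0 = "\<lambda>w. \<integral>\<^sup>+t\<in>{0<..}. ?g2 w t \<partial>lborel"])
        fix e :: real assume e: "0 < e"
        show "AE w in disc_borel. F w \<le> ennreal e * (\<integral>\<^sup>+t\<in>{0<..}. ?g1 (defect w) t \<partial>lborel) +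
            ennreal (e powr (1 - p)) * (\<integral>\<^sup>+t\<in>{0<..}. ?g2 w t \<partial>lborel)"
        proof (rule AE_I2)
          fix w
          define g1 g2 :: "real \<Rightarrow> ennreal" where
            "g1 t = ?g1 (defect w) t * indicator {0<..} t" and
            "g2 t = ?g2 w t * indicator {0<..} t" for t
          have g [measurable]: "g1 \<in> borel_measurable lborel" "g2 \<in> borel_measurable lborel"
            unfolding g1_def g2_def by measurable
          have "F w \<le> (\<integral>\<^sup>+t. ennreal e * g1 t + ennreal (e powr (1 - p)) * g2 t \<partial>lborel)"
            unfolding F_def
          proof (rule nn_integral_mono)
            fix t :: real
            show "(if t < f w \<and> 0 < d t \<and> d t \<le> defect w then 1 else 0) * indicator {0<..} t \<le>
              ennreal e * g1 t + ennreal (e powr (1 - p)) * g2 t"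
            proof (cases "t < f w \<and> 0 < d t \<and> d t \<le> defect w \<and> 0 < t")
              case True
              define M where "M = d t powr s * defect w powr (-s)"
              have M: "0 < M" using True by (simp add: M_def)
              have "1 = M * (1 / M)" using M by simp
              also have "\<dots> \<le> M * (e + e powr (1 - p) * (1 / M) powr p)"
                using M e p by (intro mult_left_mono young_powr_le) auto
              also have "\<dots> = e * M + e powr (1 - p) * M powr (1 - p)"
                using M by (simp add: powr_divide powr_diff field_simps)
              finally have "ennreal 1 \<le> ennreal (e * M + e powr (1 - p) * M powr (1 - p))"
                by (rule ennreal_leI)
              then show ?thesis
                using True M e unfolding g1_def g2_def M_def[symmetric] by (simp add: ennreal_mult)
            qed (auto simp: indicator_def)
          qed
          also have "\<dots> = ennreal e * integral\<^sup>N lborel g1 + ennreal (e powr (1 - p)) * integral\<^sup>N lborel g2"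
            by (simp add: nn_integral_add nn_integral_cmult)
          finally show "F w \<le> ennreal e * (\<integral>\<^sup>+t\<in>{0<..}. ?g1 (defect w) t \<partial>lborel) +
            ennreal (e powr (1 - p)) * (\<integral>\<^sup>+t\<in>{0<..}. ?g2 w t \<partial>lborel)"
            by (simp only: g1_def[abs_def] g2_def[abs_def])
        qed
      next
        have "(\<integral>\<^sup>+w. ennreal (kernel_const c * radial_weight b c (defect z) (defect w)) *
            (\<integral>\<^sup>+t\<in>{0<..}. ?g1 (defect w) t \<partial>lborel) \<partial>disc_borel) =
            (\<integral>\<^sup>+w. \<integral>\<^sup>+t. ennreal (kc * radial_weight b c v (defect w)) *
              (?g1 (defect w) t * indicator {0<..} t) \<partial>lborel \<partial>disc_borel)"
          unfolding kc_def v_def by (subst nn_integral_cmult) auto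
        also have "\<dots> = (\<integral>\<^sup>+t. \<integral>\<^sup>+w. ennreal (kc * radial_weight b c v (defect w)) *
              (?g1 (defect w) t * indicator {0<..} t) \<partial>disc_borel \<partial>lborel)"
          by (rule P.Fubini'[symmetric]) measurable
        also have "\<dots> \<le> (\<integral>\<^sup>+t. ennreal (kc * v powr (-\<gamma>) / (s - \<tau>)) * (ennreal (d t powr \<tau>) * indicator {0<..} t) \<partial>lborel)"
        proof (rule nn_integral_mono)
          fix t :: real
          show "(\<integral>\<^sup>+w. ennreal (kc * radial_weight b c v (defect w)) *
              (?g1 (defect w) t * indicator {0<..} t) \<partial>disc_borel) \<le>
              ennreal (kc * v powr (-\<gamma>) / (s - \<tau>)) * (ennreal (d t powr \<tau>) * indicator {0<..} t)"
          proof (cases "0 < d t \<and> 0 < t")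
            case True
            have "(\<integral>\<^sup>+w. ennreal (kc * radial_weight b c v (defect w)) *
              (?g1 (defect w) t * indicator {0<..} t) \<partial>disc_borel) \<le>
              (\<integral>\<^sup>+w. ennreal (kc * v powr (-\<gamma>) * d t powr s) * (ennreal (defect w powr (\<tau> - 1 - s)) * indicator {d t..} (defect w)) \<partial>disc_borel)"
            proof (intro nn_integral_mono_AE eventually_mono[OF AE_disc_borel])
              fix w assume w: "0 < defect w \<and> defect w < 1 \<and> cmod w < 1 \<and> w \<noteq> 0"
              have "kc * (d t powr s * defect w powr (-s)) * radial_weight b c v (defect w) \<le>
                  kc * (d t powr s * defect w powr (-s)) * (v powr (-\<gamma>) * defect w powr (\<tau> - 1))"
                using w v kc weight by (intro mult_left_mono) (auto simp: \<gamma>_def)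
              also have "\<dots> = kc * v powr (-\<gamma>) * d t powr s * (defect w powr (\<tau> - 1) * defect w powr (-s))" by simp
              also have "defect w powr (\<tau> - 1) * defect w powr (-s) = defect w powr (\<tau> - 1 - s)"
                by (simp add: powr_add[symmetric])
              finally have "ennreal (kc * (d t powr s * defect w powr (-s)) * radial_weight b c v (defect w)) \<le>
                ennreal (kc * v powr (-\<gamma>) * d t powr s * defect w powr (\<tau> - 1 - s))" by (rule ennreal_leI)
              then show "ennreal (kc * radial_weight b c v (defect w)) *
                (?g1 (defect w) t * indicator {0<..} t) \<le>
                ennreal (kc * v powr (-\<gamma>) * d t powr s) * (ennreal (defect w powr (\<tau> - 1 - s)) * indicator {d t..} (defect w))"
                using True kc by (cases "d t \<le> defect w") (simp_all add: radial_weight_def mult_ac flip: ennreal_mult)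
            qed
            also have "\<dots> = ennreal (kc * v powr (-\<gamma>) * d t powr s) * (\<integral>\<^sup>+w. ennreal (defect w powr (\<tau> - 1 - s)) * indicator {d t..} (defect w) \<partial>disc_borel)"
              by (rule nn_integral_cmult) simp
            \<comment> \<open>As s > \<tau>, the integral of u^(\<tau> - 1 - s) over u >= d t is of
              order (d t)^(\<tau> - s); the factor (d t)^s restores (d t)^\<tau>.\<close>
            also have "\<dots> \<le> ennreal (kc * v powr (-\<gamma>) * d t powr s) * ennreal (d t powr (\<tau> - 1 - s + 1) / (- (\<tau> - 1 - s) - 1))"
              using True s by (intro mult_left_mono nn_integral_disc_powr_far) auto
            also have "\<dots> = ennreal (kc * v powr (-\<gamma>) / (s - \<tau>) * (d t powr s * d t powr (\<tau> - s)))"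
              using kc s by (simp add: algebra_simps flip: ennreal_mult)
            also have "d t powr s * d t powr (\<tau> - s) = d t powr \<tau>"
              by (simp flip: powr_add)
            also have "ennreal (kc * v powr (-\<gamma>) / (s - \<tau>) * d t powr \<tau>) =
                ennreal (kc * v powr (-\<gamma>) / (s - \<tau>)) * (ennreal (d t powr \<tau>) * indicator {0<..} t)"
              using True kc s by (subst ennreal_mult) auto
            finally show ?thesis .
          qed (auto simp: indicator_def)
        qed
        also have "\<dots> = ennreal (kc * v powr (-\<gamma>) / (s - \<tau>)) * (\<integral>\<^sup>+t\<in>{0<..}. ennreal (d t powr \<tau>) \<partial>lborel)"
          by (rule nn_integral_cmult) simp
        also have "\<dots> \<le> ennreal (kc * v powr (-\<gamma>) / (s - \<tau>)) * ennreal L" by (intro mult_left_mono dL) simp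
        also have "\<dots> = ennreal A" using kc s L by (simp add: A_def flip: ennreal_mult)
        finally show "(\<integral>\<^sup>+w. ennreal (kernel_const c * radial_weight b c (defect z) (defect w)) *
            (\<integral>\<^sup>+t\<in>{0<..}. ?g1 (defect w) t \<partial>lborel) \<partial>disc_borel) \<le> ennreal A" .
      next
        have "(\<integral>\<^sup>+w. ennreal (kernel_const c * radial_weight b c (defect z) (defect w)) *
            (\<integral>\<^sup>+t\<in>{0<..}. ?g2 w t \<partial>lborel) \<partial>disc_borel) =
            (\<integral>\<^sup>+w. \<integral>\<^sup>+t. ennreal (kc * radial_weight b c v (defect w)) *
              (?g2 w t * indicator {0<..} t) \<partial>lborel \<partial>disc_borel)"
          unfolding kc_def v_def by (subst nn_integral_cmult) auto
        also have "\<dots> = (\<integral>\<^sup>+t. \<integral>\<^sup>+w. ennreal (kc * radial_weight b c v (defect w)) *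
              (?g2 w t * indicator {0<..} t) \<partial>disc_borel \<partial>lborel)"
          by (rule P.Fubini'[symmetric]) measurable
        also have "\<dots> \<le> (\<integral>\<^sup>+t. ennreal (kc * v powr (-\<gamma>)) * (ennreal (d t powr \<tau>) * indicator {0<..} t) \<partial>lborel)"
        proof (rule nn_integral_mono)
          fix t :: real
          show "(\<integral>\<^sup>+w. ennreal (kc * radial_weight b c v (defect w)) *
              (?g2 w t * indicator {0<..} t) \<partial>disc_borel) \<le>
              ennreal (kc * v powr (-\<gamma>)) * (ennreal (d t powr \<tau>) * indicator {0<..} t)"
          proof (cases "0 < d t \<and> 0 < t")
            case True
            have "(\<integral>\<^sup>+w. ennreal (kc * radial_weight b c v (defect w)) *
              (?g2 w t * indicator {0<..} t) \<partial>disc_borel) \<le>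
              (\<integral>\<^sup>+w. ennreal (kc * v powr (-\<gamma>) * d t powr (\<tau> - 1)) * indicator {w. t < f w} w \<partial>disc_borel)"
            proof (intro nn_integral_mono_AE eventually_mono[OF AE_disc_borel])
              fix w assume w: "0 < defect w \<and> defect w < 1 \<and> cmod w < 1 \<and> w \<noteq> 0"
              have M: "(d t powr s * defect w powr (-s)) powr (1 - p) = d t powr (\<tau> - 1) * defect w powr (1 - \<tau>)"
                using s' by (simp add: powr_mult powr_powr)
              have "kc * d t powr (\<tau> - 1) * defect w powr (1 - \<tau>) * radial_weight b c v (defect w) \<le>
                  kc * d t powr (\<tau> - 1) * defect w powr (1 - \<tau>) * (v powr (-\<gamma>) * defect w powr (\<tau> - 1))"
                using w v kc weight by (intro mult_left_mono) (auto simp: \<gamma>_def)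
              also have "\<dots> = kc * v powr (-\<gamma>) * d t powr (\<tau> - 1) * (defect w powr (1 - \<tau>) * defect w powr (\<tau> - 1))" by simp
              also have "defect w powr (1 - \<tau>) * defect w powr (\<tau> - 1) = 1"
                using w by (simp flip: powr_add)
              finally have "ennreal (kc * d t powr (\<tau> - 1) * defect w powr (1 - \<tau>) * radial_weight b c v (defect w)) \<le>
                ennreal (kc * v powr (-\<gamma>) * d t powr (\<tau> - 1) * 1)" by (rule ennreal_leI)
              then show "ennreal (kc * radial_weight b c v (defect w)) *
                (?g2 w t * indicator {0<..} t) \<le>
                ennreal (kc * v powr (-\<gamma>) * d t powr (\<tau> - 1)) * indicator {w. t < f w} w"
                using True kc unfolding M
                by (cases "t < f w \<and> d t \<le> defect w") (auto simp add: radial_weight_def mult_ac simp flip: ennreal_mult)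
            qed
            also have "\<dots> = ennreal (kc * v powr (-\<gamma>) * d t powr (\<tau> - 1)) * emeasure disc_borel {w. t < f w}"
              by (rule nn_integral_cmult_indicator) simp
            \<comment> \<open>The level set has measure d t, which turns (d t)^(\<tau> - 1) into (d
              t)^\<tau>.\<close>
            also have "\<dots> = ennreal (kc * v powr (-\<gamma>) * (d t powr (\<tau> - 1) * d t powr 1))"
              using kc True by (simp add: disc_borel.emeasure_eq_measure d_def[symmetric] mult.assoc flip: ennreal_mult)
            also have "d t powr (\<tau> - 1) * d t powr 1 = d t powr \<tau>"
              by (subst powr_add[symmetric]) simp
            finally show ?thesis using True kc by (simp add: ennreal_mult)
          qed (auto simp: indicator_def)
        qed
        also have "\<dots> = ennreal (kc * v powr (-\<gamma>)) * (\<integral>\<^sup>+t\<in>{0<..}. ennreal (d t powr \<tau>) \<partial>lborel)"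
          by (rule nn_integral_cmult) simp
        also have "\<dots> \<le> ennreal (kc * v powr (-\<gamma>)) * ennreal L" by (intro mult_left_mono dL) simp
        also have "\<dots> = ennreal B" using kc L by (simp add: B_def flip: ennreal_mult)
        finally show "(\<integral>\<^sup>+w. ennreal (kernel_const c * radial_weight b c (defect z) (defect w)) *
            (\<integral>\<^sup>+t\<in>{0<..}. ?g2 w t \<partial>lborel) \<partial>disc_borel) \<le> ennreal B" .
      qed (use p in \<open>simp_all\<close>)
      note circ
      also have "ennreal ((2 / l) powr p * A powr (p - 1)) * ennreal B = ennreal ((2 / l) powr p * A powr (p - 1) * B)"
        using kc L by (simp add: B_def flip: ennreal_mult)
      \<comment> \<open>\<open>A\<close> and \<open>B\<close> differ only by the factor 1 / (s -
        \<tau>), so the product is a multiple of B^p and has the required degree p in X and in the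
        power of v.\<close>
      also have "(2 / l) powr p * A powr (p - 1) * B = K * (X * v powr (- \<gamma>) / l) powr p"
      proof -
        have "A powr (p - 1) = B powr (p - 1) * (1 / (s - \<tau>)) powr (p - 1)"
          using kc L s v by (subst powr_mult[symmetric]) (simp_all add: A_def B_def)
        moreover have "B powr (p - 1) * B = B powr p"
          using kc L v by (simp add: B_def powr_diff)
        moreover have "B powr p = kc powr p * (v powr (-\<gamma>)) powr p * (\<tau> powr p * X powr p)"
          using kc X \<tau> by (simp add: B_def L_def powr_mult)
        moreover have "(X * v powr (- \<gamma>) / l) powr p = X powr p * (v powr (-\<gamma>)) powr p / l powr p"
          using X l v by (simp add: powr_mult powr_divide)
        moreover have "(2 / l) powr p = 2 powr p / l powr p"
          using l by (simp add: powr_divide)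
        moreover have "(2 / l) powr p * A powr (p - 1) * B = (2 / l) powr p * (1 / (s - \<tau>)) powr (p - 1) * (B powr (p - 1) * B)"
          using calculation(1) by simp
        ultimately show ?thesis
          by (simp add: K_def)
      qed
      finally show "emeasure circle_measure {\<zeta>. ennreal l < pos_op b c F (\<zeta> * z)} \<le>
        ennreal (K * (X * defect z powr (- (a + 1 / q)) / l) powr p)"
        by (simp add: v_def \<gamma>_def)
    qed (use l in simp_all)
    have "emeasure disc_borel {z. ennreal l < ennreal (defect z powr a) * pos_op b c (\<lambda>w. ennreal (f w)) z} \<le>
        emeasure disc_borel ({z. ennreal (l / 2) < ennreal (defect z powr a) * pos_op b c (\<lambda>w. N (defect w)) z} \<union>
          {z. ennreal (l / 2) < ennreal (defect z powr a) * pos_op b c F z})"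
    proof (rule emeasure_mono)
      show "{z. ennreal l < ennreal (defect z powr a) * pos_op b c (\<lambda>w. ennreal (f w)) z} \<subseteq>
        {z. ennreal (l / 2) < ennreal (defect z powr a) * pos_op b c (\<lambda>w. N (defect w)) z} \<union>
          {z. ennreal (l / 2) < ennreal (defect z powr a) * pos_op b c F z}"
      proof (rule subsetI, elim CollectE)
        fix z assume less: "ennreal l < ennreal (defect z powr a) * pos_op b c (\<lambda>w. ennreal (f w)) z"
        show "z \<in> {z. ennreal (l / 2) < ennreal (defect z powr a) * pos_op b c (\<lambda>w. N (defect w)) z} \<union>
          {z. ennreal (l / 2) < ennreal (defect z powr a) * pos_op b c F z}"
        proof (rule ccontr)
          assume not: "\<not> ?thesis"
          have "pos_op b c (\<lambda>w. ennreal (f w)) z \<le> pos_op b c (\<lambda>w. N (defect w) + F w) z"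
            by (rule pos_op_mono_AE[OF split])
          also have "\<dots> = pos_op b c (\<lambda>w. N (defect w)) z + pos_op b c F z"
            by (rule pos_op_add) simp_all
          finally have "ennreal (defect z powr a) * pos_op b c (\<lambda>w. ennreal (f w)) z \<le>
              ennreal (defect z powr a) * pos_op b c (\<lambda>w. N (defect w)) z + ennreal (defect z powr a) * pos_op b c F z"
            unfolding distrib_left[symmetric] by (rule mult_left_mono) simp
          also have "\<dots> \<le> ennreal (l / 2) + ennreal (l / 2)"
            using not by (intro add_mono) auto
          also have "\<dots> = ennreal l" using l by (simp flip: ennreal_plus)
          finally show False using less by simp
        qed
      qed
    qed measurable
    also have "\<dots> \<le> emeasure disc_borel {z. ennreal (l / 2) < ennreal (defect z powr a) * pos_op b c (\<lambda>w. N (defect w)) z} +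
          emeasure disc_borel {z. ennreal (l / 2) < ennreal (defect z powr a) * pos_op b c F z}"
      by (rule emeasure_subadditive) measurable
    also have "\<dots> \<le> ennreal ((kc * X / (l / 2)) powr q) + ennreal ((1 + K / (p / q - 1)) * (X / (l / 2)) powr q)"
      by (rule add_mono[OF near far])
    also have "\<dots> = ennreal ((kc * X / (l / 2)) powr q + (1 + K / (p / q - 1)) * (X / (l / 2)) powr q)"
      using K p q by (subst ennreal_plus) auto
    also have "(kc * X / (l / 2)) powr q = (2 * kc) powr q * (X / l) powr q"
      using kc X l by (subst powr_mult[symmetric]) (auto simp: mult_ac)
    also have "(X / (l / 2)) powr q = 2 powr q * (X / l) powr q"
      using X l by (subst powr_mult[symmetric]) (auto simp: mult_ac)
    finally show "emeasure disc_borel {z. ennreal l < ennreal (defect z powr a) * pos_op b c (\<lambda>w. ennreal (f w)) z}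
        \<le> ennreal (((2 * kc) powr q + (1 + K / (p / q - 1)) * 2 powr q) * (X / l) powr q)"
      by (simp add: algebra_simps)
  qed
qed

section \<open>Transfer to boundedness of the operators\<close>

text \<open>Extension by zero and splitting into real and imaginary part reduce this to the
  existence of Borel versions of real Lebesgue measurable functions.\<close>

lemma disc_measure_borel_version:
  assumes "f \<in> borel_measurable disc_measure"
  obtains g where "g \<in> borel_measurable borel" "AE w in disc_measure. f w = (g w :: complex)"
proof -
  have "f \<in> borel_measurable (lebesgue_on (ball 0 1))"
    using assms by (simp add: disc_measure_def)
  then have F [measurable]: "(\<lambda>x. if x \<in> ball 0 1 then f x else 0) \<in> borel_measurable lebesgue"
    by (rule borel_measurable_if_I) simp
  let ?F = "\<lambda>x. if x \<in> ball 0 1 then f x else 0"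
  have "(\<lambda>x. Re (?F x)) \<in> borel_measurable lebesgue" "(\<lambda>x. Im (?F x)) \<in> borel_measurable lebesgue"
    using measurable_compose[OF F borel_measurable_Re] measurable_compose[OF F borel_measurable_Im] by simp_all
  from this[THEN completion_ex_borel_measurable_real] obtain gr gi where
    [measurable]: "gr \<in> borel_measurable lborel" "gi \<in> borel_measurable lborel" and
    g: "AE x in lborel. Re (?F x) = gr x" "AE x in lborel. Im (?F x) = gi x" by blast
  define g where "g x = complex_of_real (gr x) + \<i> * complex_of_real (gi x)" for x
  have m: "g \<in> borel_measurable borel" unfolding g_def by measurable
  have "AE x in lborel. ?F x = g x"
    using g by eventually_elim (simp only: g_def complex_eq_iff, simp)
  then have "AE x in lebesgue. ?F x = g x"
    by (rule AE_completion)
  then have "AE x in lebesgue. x \<in> ball 0 1 \<longrightarrow> f x = g x"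
    by eventually_elim (simp split: if_splits)
  then have "AE x in lebesgue_on (ball 0 1). f x = g x"
    by (subst AE_restrict_space_iff) auto
  then have "AE x in disc_measure. f x = g x"
    unfolding disc_measure_def by (subst AE_density) auto
  then show ?thesis using m that by blast
qed

lemma cmod_T_kernel: "cmod (T_kernel b c z w) = disc_kernel b c z w"
  by (simp add: T_kernel_def disc_kernel_def defect_def norm_divide norm_powr_real_powr' powr_minus_divide)

lemma cmod_S_kernel: "cmod (S_kernel b c z w) = disc_kernel b c z w"
  by (simp add: S_kernel_def disc_kernel_def defect_def norm_divide powr_minus_divide)

lemma measurable_cnj [measurable]: "cnj \<in> borel_measurable borel"
  by (intro borel_measurable_continuous_onI continuous_intros)

lemma measurable_T_kernel [measurable (raw)]:
  assumes [measurable]: "f \<in> borel_measurable M" "g \<in> borel_measurable M"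
  shows "(\<lambda>x. T_kernel b c (f x) (g x)) \<in> borel_measurable M"
  unfolding T_kernel_def by measurable

lemma measurable_S_kernel [measurable (raw)]:
  assumes [measurable]: "f \<in> borel_measurable M" "g \<in> borel_measurable M"
  shows "(\<lambda>x. S_kernel b c (f x) (g x)) \<in> borel_measurable M"
  unfolding S_kernel_def by measurable

text \<open>A Harnack comparison: for fixed z the denominators at z and at 0 are comparable
  uniformly in w. Absolute convergence at one point of the disc therefore implies it at 0, and from
  there at every point.\<close>

lemma disc_kernel_le_kernel_0:
  assumes c: "0 < c" and z: "cmod z < 1" and w: "cmod w < 1"
  shows "disc_kernel b c z w \<le> (1 - cmod z) powr (-c) * disc_kernel b c 0 w"
    and "disc_kernel b c 0 w \<le> 2 powr c * disc_kernel b c z w"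
proof -
  have zw: "cmod (z * cnj w) \<le> cmod z * 1"
    unfolding norm_mult using w by (intro mult_left_mono) auto
  have 1: "1 - cmod z \<le> cmod (1 - z * cnj w)"
    using zw norm_triangle_ineq2[of 1 "z * cnj w"] by simp
  have 2: "cmod (1 - z * cnj w) \<le> 2"
    using zw z norm_triangle_ineq4[of 1 "z * cnj w"] by simp
  have "cmod (1 - z * cnj w) powr (-c) \<le> (1 - cmod z) powr (-c)"
    using 1 z c by (intro powr_mono2') auto
  then have "defect w powr b * cmod (1 - z * cnj w) powr (-c) \<le> defect w powr b * (1 - cmod z) powr (-c)"
    by (rule mult_left_mono) simp
  then show "disc_kernel b c z w \<le> (1 - cmod z) powr (-c) * disc_kernel b c 0 w"
    by (simp add: disc_kernel_def mult.commute)
  have "1 = 2 powr c * 2 powr (-c)" by (simp flip: powr_add)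
  also have "\<dots> \<le> 2 powr c * cmod (1 - z * cnj w) powr (-c)"
    using 1 2 z c by (intro mult_left_mono powr_mono2') auto
  finally have "defect w powr b * 1 \<le> defect w powr b * (2 powr c * cmod (1 - z * cnj w) powr (-c))"
    by (rule mult_left_mono) simp
  then show "disc_kernel b c 0 w \<le> 2 powr c * disc_kernel b c z w"
    by (simp add: disc_kernel_def mult_ac)
qed

lemma integrable_kernel:
  fixes K :: "complex \<Rightarrow> complex \<Rightarrow> complex"
  assumes c: "0 < c" and [measurable]: "f \<in> borel_measurable borel"
    and K: "(\<lambda>x. K (fst x) (snd x)) \<in> borel_measurable (borel \<Otimes>\<^sub>M borel)"
    and K_norm: "\<And>z w. cmod (K z w) = disc_kernel b c z w"
    and fin: "pos_op b c (\<lambda>w. ennreal (cmod (f w))) 0 < \<infinity>" and z: "cmod z < 1"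
  shows "integrable disc_borel (\<lambda>w. K z w * f w)"
proof (rule integrableI_bounded)
  have [measurable]: "(\<lambda>w. K z w) \<in> borel_measurable borel"
    using measurable_compose[OF measurable_Pair1'[of z] K] by simp
  show "(\<lambda>w. K z w * f w) \<in> borel_measurable disc_borel" by measurable
  have "(\<integral>\<^sup>+w. ennreal (norm (K z w * f w)) \<partial>disc_borel) \<le>
      (\<integral>\<^sup>+w. ennreal ((1 - cmod z) powr (-c)) * (ennreal (disc_kernel b c 0 w) * ennreal (cmod (f w))) \<partial>disc_borel)"
  proof (intro nn_integral_mono_AE eventually_mono[OF AE_disc_borel_cmod])
    fix w assume "cmod w < 1"
    from disc_kernel_le_kernel_0(1)[OF c z this, of b]
    have "disc_kernel b c z w * cmod (f w) \<le> (1 - cmod z) powr (-c) * disc_kernel b c 0 w * cmod (f w)"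
      by (rule mult_right_mono) simp
    then show "ennreal (norm (K z w * f w)) \<le> ennreal ((1 - cmod z) powr (-c)) * (ennreal (disc_kernel b c 0 w) * ennreal (cmod (f w)))"
      by (simp add: norm_mult K_norm disc_kernel_nonneg mult.assoc ennreal_leI flip: ennreal_mult)
  qed
  also have "\<dots> = ennreal ((1 - cmod z) powr (-c)) * pos_op b c (\<lambda>w. ennreal (cmod (f w))) 0"
    unfolding pos_op_def by (rule nn_integral_cmult) simp
  also have "\<dots> < \<infinity>" using fin by (simp add: ennreal_mult_less_top)
  finally show "(\<integral>\<^sup>+w. ennreal (norm (K z w * f w)) \<partial>disc_borel) < \<infinity>" .
qed

text \<open>The analytic input is reduced to Borel functions, to one weak-type inequality and to
  convergence at the single point z = 0; the operator norm becomes C^(1/q).\<close>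

lemma disc_op_boundedI:
  fixes N :: "(complex \<Rightarrow> complex) \<Rightarrow> ennreal" and K :: "complex \<Rightarrow> complex \<Rightarrow> complex"
  assumes q: "0 < q" and c: "0 < c" and C: "0 \<le> C"
    and N_cong: "\<And>f g. f \<in> borel_measurable disc_measure \<Longrightarrow> g \<in> borel_measurable disc_measure \<Longrightarrow>
      AE w in disc_measure. f w = g w \<Longrightarrow> N f = N g"
    and K: "(\<lambda>x. K (fst x) (snd x)) \<in> borel_measurable (borel \<Otimes>\<^sub>M borel)"
    and K_norm: "\<And>z w. cmod (K z w) = disc_kernel b c z w"
    and fin: "\<And>f. f \<in> borel_measurable borel \<Longrightarrow> N f < \<infinity> \<Longrightarrow> pos_op b c (\<lambda>w. ennreal (cmod (f w))) 0 < \<infinity>"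
    and weak: "\<And>f X l. f \<in> borel_measurable borel \<Longrightarrow> 0 \<le> X \<Longrightarrow> N f \<le> ennreal X \<Longrightarrow> 0 < l \<Longrightarrow>
      emeasure disc_borel {z. l < defect z powr a * cmod (\<integral>w. K z w * f w \<partial>disc_borel)} \<le> ennreal (C * (X / l) powr q)"
  shows "disc_op_bounded a K N (weak_Lp_norm (ereal q))"
  unfolding disc_op_bounded_def
proof (intro exI[of _ "C powr (1 / q)"] ballI impI)
  fix f assume f: "f \<in> borel_measurable disc_measure" and Nf: "N f < \<infinity>"
  obtain g where g [measurable]: "g \<in> borel_measurable borel" and fg: "AE w in disc_measure. f w = g w"
    using disc_measure_borel_version[OF f] .
  have g': "g \<in> borel_measurable disc_measure" by (rule borel_measurable_disc_measure[OF g])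
  have Ng: "N g = N f" using N_cong[OF f g' fg] by simp
  have [measurable]: "(\<lambda>w. K z w) \<in> borel_measurable borel" for z
    using measurable_compose[OF measurable_Pair1'[of z] K] by simp
  have Kd: "(\<lambda>w. K z w) \<in> borel_measurable disc_measure" for z
    by (rule borel_measurable_disc_measure) measurable
  have int_eq: "(\<integral>w. K z w * f w \<partial>disc_measure) = (\<integral>w. K z w * g w \<partial>disc_borel)" for z
  proof -
    have "(\<integral>w. K z w * f w \<partial>disc_measure) = (\<integral>w. K z w * g w \<partial>disc_measure)"
      using fg by (intro integral_cong_AE borel_measurable_times Kd f g') auto
    also have "\<dots> = (\<integral>w. K z w * g w \<partial>disc_borel)"
      unfolding disc_borel_def by (subst integral_distr) (auto intro: measurable_id_disc_measure)
    finally show ?thesis .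
  qed
  define G where "G z = complex_of_real (defect z powr a) * (\<integral>w. K z w * g w \<partial>disc_borel)" for z
  have G [measurable]: "G \<in> borel_measurable borel"
  proof -
    have [measurable]: "(\<lambda>x. K (fst x) (snd x)) \<in> borel_measurable (borel \<Otimes>\<^sub>M disc_borel)"
      using K by (simp cong: measurable_cong_sets)
    have "(\<lambda>z. \<integral>w. K z w * g w \<partial>disc_borel) \<in> borel_measurable borel"
      by (rule disc_borel.borel_measurable_lebesgue_integral) (simp add: split_beta')
    then show ?thesis unfolding G_def by measurable
  qed
  have op: "disc_op a K f = G"
    by (simp add: disc_op_def G_def int_eq fun_eq_iff defect_def)
  show "(AE z in disc_measure. integrable disc_measure (\<lambda>w. K z w * f w)) \<and>
      disc_op a K f \<in> borel_measurable disc_measure \<and>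
      weak_Lp_norm (ereal q) (disc_op a K f) \<le> ennreal (C powr (1 / q)) * N f"
  proof (intro conjI AE_I2)
    fix z assume "z \<in> space disc_measure"
    then have z: "cmod z < 1" by simp
    have "integrable disc_borel (\<lambda>w. K z w * g w)"
      using fin[OF g] Ng Nf by (intro integrable_kernel[OF c g K K_norm _ z]) auto
    then have "integrable disc_measure (\<lambda>w. K z w * g w)"
      unfolding disc_borel_def by (subst (asm) integrable_distr_eq) (auto intro: measurable_id_disc_measure)
    then show "integrable disc_measure (\<lambda>w. K z w * f w)"
      using fg by (subst integrable_cong_AE[where g = "\<lambda>w. K z w * g w"]) (auto intro!: borel_measurable_times Kd f g')
  next
    show "disc_op a K f \<in> borel_measurable disc_measure"
      unfolding op by (rule borel_measurable_disc_measure[OF G])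
  next
    obtain X where X: "0 \<le> X" "N f = ennreal X"
      using Nf by (cases "N f") auto
    have "t * distribution G t powr (1 / q) \<le> C powr (1 / q) * X" if t: "0 < t" for t
    proof -
      have "emeasure disc_borel {z. t < cmod (G z)} = emeasure disc_borel {z. t < defect z powr a * cmod (\<integral>w. K z w * g w \<partial>disc_borel)}"
        by (simp add: G_def norm_mult)
      also have "\<dots> \<le> ennreal (C * (X / t) powr q)"
        using X Ng t by (intro weak g) auto
      finally have "measure disc_borel {z. t < cmod (G z)} \<le> C * (X / t) powr q"
        using C by (simp add: disc_borel.emeasure_eq_measure)
      then have "distribution G t powr (1 / q) \<le> (C * (X / t) powr q) powr (1 / q)"
        using q by (intro powr_mono2) (auto simp: distribution_eq)
      also have "\<dots> = C powr (1 / q) * (X / t)"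
        using q C X t by (simp add: powr_mult powr_powr)
      finally have "t * distribution G t powr (1 / q) \<le> t * (C powr (1 / q) * (X / t))"
        using t by (intro mult_left_mono) auto
      then show ?thesis using t by simp
    qed
    then show "weak_Lp_norm (ereal q) (disc_op a K f) \<le> ennreal (C powr (1 / q)) * N f"
      using X by (auto simp: weak_Lp_norm_def op intro!: SUP_least ennreal_leI simp flip: ennreal_mult)
  qed
qed

lemma Lp_norm_cong:
  assumes "f \<in> borel_measurable disc_measure" "g \<in> borel_measurable disc_measure" "AE w in disc_measure. cmod (f w) = cmod (g w)"
  shows "Lp_norm p f = Lp_norm p g"
proof -
  have "esssup disc_measure (\<lambda>z. ennreal (cmod (f z))) = esssup disc_measure (\<lambda>z. ennreal (cmod (g z)))"
    using assms by (intro esssup_AE_cong) auto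
  moreover have "(\<integral>\<^sup>+z. ennreal (cmod (f z) powr r) \<partial>disc_measure) = (\<integral>\<^sup>+z. ennreal (cmod (g z) powr r) \<partial>disc_measure)" for r
    using assms by (intro nn_integral_cong_AE) auto
  ultimately show ?thesis by (simp add: Lp_norm_def)
qed

lemma Lorentz1_norm_cong:
  assumes [measurable]: "f \<in> borel_measurable disc_measure" "g \<in> borel_measurable disc_measure"
    and eq: "AE w in disc_measure. cmod (f w) = cmod (g w)"
  shows "Lorentz1_norm p f = Lorentz1_norm p g"
proof -
  have "distribution f = distribution g"
  proof
    fix t
    have "{z \<in> space disc_measure. t < cmod (f z)} \<in> sets disc_measure"
      "{z \<in> space disc_measure. t < cmod (g z)} \<in> sets disc_measure" by measurable
    then have "measure disc_measure {z \<in> ball 0 1. t < cmod (f z)} = measure disc_measure {z \<in> ball 0 1. t < cmod (g z)}"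
      using eq by (intro measure_eq_AE) auto
    then show "distribution f t = distribution g t" by (simp add: distribution_def)
  qed
  then show ?thesis by (simp add: Lorentz1_norm_def)
qed

text \<open>Absolute convergence is read off from the weak-type bound itself: at a high level the
  level set does not fill the disc, so the integral is finite at some z, and the comparison of
  kernels moves this to 0.\<close>

lemma weak_bound_finite:
  assumes wb: "weak_bound a b c q N" and q: "0 < q" and c: "0 < c"
    and f [measurable]: "f \<in> borel_measurable borel" and f0: "\<And>w. 0 \<le> f w" and Nf: "N f < \<infinity>"
  shows "pos_op b c (\<lambda>w. ennreal (f w)) 0 < \<infinity>"
proof -
  obtain C where C: "0 \<le> C" and le: "\<And>X l. 0 \<le> X \<Longrightarrow> N f \<le> ennreal X \<Longrightarrow> 0 < l \<Longrightarrow>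
      emeasure disc_borel {z. ennreal l < ennreal (defect z powr a) * pos_op b c (\<lambda>w. ennreal (f w)) z}
        \<le> ennreal (C * (X / l) powr q)"
    using wb f f0 unfolding weak_bound_def by blast
  obtain X where X: "0 \<le> X" "N f = ennreal X" using Nf by (cases "N f") auto
  \<comment> \<open>At this level the weak-type bound is at most C / (2 C + 1), which is less than
    1, the measure of the disc.\<close>
  define l where "l = (X + 1) * (2 * C + 1) powr (1 / q)"
  have l: "0 < l" using X C by (simp add: l_def)
  have "X / l \<le> (2 * C + 1) powr (- 1 / q)"
  proof -
    have "X / l = X / (X + 1) * (2 * C + 1) powr (- 1 / q)"
      by (simp add: l_def powr_minus_divide)
    also have "\<dots> \<le> 1 * (2 * C + 1) powr (- 1 / q)"
      using X by (intro mult_right_mono) auto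
    finally show ?thesis by simp
  qed
  then have "(X / l) powr q \<le> ((2 * C + 1) powr (- 1 / q)) powr q"
    using X l q by (intro powr_mono2) auto
  also have "\<dots> = (2 * C + 1) powr (- 1)" using q by (simp only: powr_powr) simp
  also have "\<dots> = 1 / (2 * C + 1)" using C by (simp only: powr_minus_divide) simp
  finally have "C * (X / l) powr q \<le> C * (1 / (2 * C + 1))"
    using C by (rule mult_left_mono)
  also have "\<dots> < 1" using C by (simp add: field_simps)
  finally have lt: "C * (X / l) powr q < 1" .
  define A where "A = {z. ennreal l < ennreal (defect z powr a) * pos_op b c (\<lambda>w. ennreal (f w)) z}"
  have [measurable]: "A \<in> sets borel" unfolding A_def by measurable
  have "emeasure disc_borel A < 1"
    using le[of X l] X l lt by (auto simp: A_def intro: order.strict_trans1)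
  have "\<exists>z. cmod z < 1 \<and> z \<notin> A"
  proof (rule ccontr)
    assume "\<not> ?thesis"
    then have "AE z in disc_borel. z \<in> A"
      using AE_disc_borel_cmod by (auto elim: eventually_mono)
    then have "emeasure disc_borel A = emeasure disc_borel UNIV"
      by (intro emeasure_eq_AE) auto
    then show False using \<open>emeasure disc_borel A < 1\<close> disc_borel.emeasure_space_1 by simp
  qed
  then obtain z where z: "cmod z < 1" "z \<notin> A" by blast
  have "ennreal (defect z powr a) * pos_op b c (\<lambda>w. ennreal (f w)) z < \<infinity>"
    using z(2) by (auto simp: A_def not_less intro: order.strict_trans1)
  moreover have "0 < defect z powr a" using defect_pos[OF z(1)] by simp
  ultimately have fin: "pos_op b c (\<lambda>w. ennreal (f w)) z < \<infinity>"
    by (auto simp: ennreal_mult_less_top)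
  have "pos_op b c (\<lambda>w. ennreal (f w)) 0 \<le> (\<integral>\<^sup>+w. ennreal (2 powr c) * (ennreal (disc_kernel b c z w) * ennreal (f w)) \<partial>disc_borel)"
    unfolding pos_op_def
  proof (intro nn_integral_mono_AE eventually_mono[OF AE_disc_borel_cmod])
    fix w assume "cmod w < 1"
    from disc_kernel_le_kernel_0(2)[OF c z(1) this, of b]
    have "disc_kernel b c 0 w * f w \<le> 2 powr c * disc_kernel b c z w * f w"
      using f0 by (rule mult_right_mono)
    then show "ennreal (disc_kernel b c 0 w) * ennreal (f w) \<le> ennreal (2 powr c) * (ennreal (disc_kernel b c z w) * ennreal (f w))"
      using f0 by (simp add: disc_kernel_nonneg mult.assoc ennreal_leI flip: ennreal_mult)
  qed
  also have "\<dots> = ennreal (2 powr c) * pos_op b c (\<lambda>w. ennreal (f w)) z"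
    unfolding pos_op_def by (rule nn_integral_cmult) simp
  also have "\<dots> < \<infinity>" using fin by (simp add: ennreal_mult_less_top)
  finally show ?thesis .
qed

text \<open>Both kernels have the modulus \<open>disc_kernel\<close>, and the norms depend only on
  the modulus of the input, so one inequality for nonnegative functions settles T and S
  together.\<close>

lemma weak_bound_imp_disc_op_bounded:
  fixes N :: "(complex \<Rightarrow> complex) \<Rightarrow> ennreal" and K :: "complex \<Rightarrow> complex \<Rightarrow> complex"
  assumes wb: "weak_bound a b c q (\<lambda>f. N (\<lambda>w. complex_of_real (f w)))" and q: "0 < q" and c: "0 < c"
    and N_cong: "\<And>f g. f \<in> borel_measurable disc_measure \<Longrightarrow> g \<in> borel_measurable disc_measure \<Longrightarrow>
      AE w in disc_measure. cmod (f w) = cmod (g w) \<Longrightarrow> N f = N g"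
    and K: "(\<lambda>x. K (fst x) (snd x)) \<in> borel_measurable (borel \<Otimes>\<^sub>M borel)"
    and K_norm: "\<And>z w. cmod (K z w) = disc_kernel b c z w"
  shows "disc_op_bounded a K N (weak_Lp_norm (ereal q))"
proof -
  obtain C where C: "0 \<le> C" and le: "\<And>f X l. f \<in> borel_measurable borel \<Longrightarrow> (\<And>w. 0 \<le> f w) \<Longrightarrow>
      0 \<le> X \<Longrightarrow> N (\<lambda>w. complex_of_real (f w)) \<le> ennreal X \<Longrightarrow> 0 < l \<Longrightarrow>
      emeasure disc_borel {z. ennreal l < ennreal (defect z powr a) * pos_op b c (\<lambda>w. ennreal (f w)) z}
        \<le> ennreal (C * (X / l) powr q)"
    using wb unfolding weak_bound_def by blast
  have N_cmod: "N (\<lambda>w. complex_of_real (cmod (f w))) = N f" if "f \<in> borel_measurable borel" for f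
    using that by (intro N_cong borel_measurable_disc_measure) auto
  have fin: "pos_op b c (\<lambda>w. ennreal (cmod (f w))) 0 < \<infinity>" if "f \<in> borel_measurable borel" "N f < \<infinity>" for f
    using that by (intro weak_bound_finite[OF wb q c]) (auto simp: N_cmod)
  show ?thesis
  proof (rule disc_op_boundedI[OF q c C _ K K_norm fin])
    fix f g :: "complex \<Rightarrow> complex" assume "f \<in> borel_measurable disc_measure" "g \<in> borel_measurable disc_measure" "AE w in disc_measure. f w = g w"
    then show "N f = N g" by (intro N_cong) auto
  next
    fix f :: "complex \<Rightarrow> complex" and X l :: real assume f [measurable]: "f \<in> borel_measurable borel" and X: "0 \<le> X" "N f \<le> ennreal X" and l: "0 < l"
    have [measurable]: "(\<lambda>w. K z w) \<in> borel_measurable borel" for z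
      using measurable_compose[OF measurable_Pair1'[of z] K] by simp
    have "emeasure disc_borel {z. l < defect z powr a * cmod (\<integral>w. K z w * f w \<partial>disc_borel)} \<le>
        emeasure disc_borel {z. ennreal l < ennreal (defect z powr a) * pos_op b c (\<lambda>w. ennreal (cmod (f w))) z}"
    proof (rule emeasure_mono)
      show "{z. l < defect z powr a * cmod (\<integral>w. K z w * f w \<partial>disc_borel)} \<subseteq>
        {z. ennreal l < ennreal (defect z powr a) * pos_op b c (\<lambda>w. ennreal (cmod (f w))) z}"
      proof safe
        fix z assume less: "l < defect z powr a * cmod (\<integral>w. K z w * f w \<partial>disc_borel)"
        have *: "ennreal (cmod (\<integral>w. K z w * f w \<partial>disc_borel)) \<le> pos_op b c (\<lambda>w. ennreal (cmod (f w))) z"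
        proof (cases "integrable disc_borel (\<lambda>w. K z w * f w)")
          case True
          then have "ennreal (cmod (\<integral>w. K z w * f w \<partial>disc_borel)) \<le> (\<integral>\<^sup>+w. ennreal (norm (K z w * f w)) \<partial>disc_borel)"
            by (rule integral_norm_bound_ennreal)
          also have "\<dots> = pos_op b c (\<lambda>w. ennreal (cmod (f w))) z"
            by (simp add: pos_op_def norm_mult K_norm disc_kernel_nonneg ennreal_mult)
          finally show ?thesis .
        qed (simp add: not_integrable_integral_eq)
        have "ennreal l < ennreal (defect z powr a * cmod (\<integral>w. K z w * f w \<partial>disc_borel))"
          using less l by (subst ennreal_less_iff) auto
        also have "\<dots> \<le> ennreal (defect z powr a) * pos_op b c (\<lambda>w. ennreal (cmod (f w))) z"
          using mult_left_mono[OF *, of "ennreal (defect z powr a)"] by (simp add: ennreal_mult)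
        finally show "ennreal l < ennreal (defect z powr a) * pos_op b c (\<lambda>w. ennreal (cmod (f w))) z" .
      qed
    qed measurable
    also have "\<dots> \<le> ennreal (C * (X / l) powr q)"
      using X l by (intro le) (auto simp: N_cmod)
    finally show "emeasure disc_borel {z. l < defect z powr a * cmod (\<integral>w. K z w * f w \<partial>disc_borel)} \<le> ennreal (C * (X / l) powr q)" .
  qed
qed

lemma weak_bound_T_S_bounded:
  fixes N :: "(complex \<Rightarrow> complex) \<Rightarrow> ennreal"
  assumes "weak_bound a b c q (\<lambda>f. N (\<lambda>w. complex_of_real (f w)))" "0 < q" "0 < c"
    and "\<And>f g. f \<in> borel_measurable disc_measure \<Longrightarrow> g \<in> borel_measurable disc_measure \<Longrightarrow>
      AE w in disc_measure. cmod (f w) = cmod (g w) \<Longrightarrow> N f = N g"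
  shows "T_bounded a b c N (weak_Lp_norm (ereal q)) \<and> S_bounded a b c N (weak_Lp_norm (ereal q))"
proof
  show "T_bounded a b c N (weak_Lp_norm (ereal q))"
    by (rule weak_bound_imp_disc_op_bounded[OF assms]) (auto simp: cmod_T_kernel)
  show "S_bounded a b c N (weak_Lp_norm (ereal q))"
    by (rule weak_bound_imp_disc_op_bounded[OF assms]) (auto simp: cmod_S_kernel)
qed

lemma T_S_bounded_Lp_small:
  assumes c: "1 < c" and a: "-1 < a" "a < 0" and \<sigma>: "0 < b + 2 - c" "b + 2 - c < - a"
    and p: "1 \<le> p" "1 / p < ereal (b + 2 - c)"
  shows "T_bounded a b c (Lp_norm p) (weak_Lp_norm (ereal (- 1 / a))) \<and>
    S_bounded a b c (Lp_norm p) (weak_Lp_norm (ereal (- 1 / a)))"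
proof (rule weak_bound_T_S_bounded)
  show "weak_bound a b c (- 1 / a) (\<lambda>f. Lp_norm p (\<lambda>w. complex_of_real (f w)))"
  proof (cases p)
    case (real r)
    have r: "1 \<le> r" "1 / r < b + 2 - c" using p real by (auto simp: one_ereal_def)
    have "1 < r" using r \<sigma> a by (cases "r = 1") auto
    then show ?thesis
      using Lp_weak_bound_small[OF c a(2) _ r(2) \<sigma>(2)] by (simp add: real Lp_norm_nonneg_def[abs_def])
  qed (use p Linfty_weak_bound[OF c a(2) \<sigma>(1)] in auto)
qed (use a c in \<open>auto intro: Lp_norm_cong\<close>)

lemma T_S_bounded_Lp_large:
  assumes c: "1 < c" and p: "1 < p" and \<sigma>: "0 < b + 2 - c" "b + 2 - c < 1 / p" and b: "1 / p < b + 1"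
    and q: "0 < q" "q < p" "1 / q = 1 / p - a - (b + 2 - c)"
  shows "T_bounded a b c (Lp_norm (ereal p)) (weak_Lp_norm (ereal q)) \<and>
    S_bounded a b c (Lp_norm (ereal p)) (weak_Lp_norm (ereal q))"
  using Lp_weak_bound_large[OF assms] c q(1)
  by (intro weak_bound_T_S_bounded) (auto simp: Lp_norm_nonneg_def[abs_def] intro: Lp_norm_cong)

lemma T_S_bounded_Lorentz:
  assumes c: "1 < c" and \<tau>: "0 < \<tau>" "\<tau> < 1" and q: "0 < q" "\<tau> < 1 / q"
    and weight: "\<And>v u. 0 < v \<Longrightarrow> v \<le> 1 \<Longrightarrow> 0 < u \<Longrightarrow> u < 1 \<Longrightarrow>
      radial_weight b c v u \<le> v powr (- (a + 1 / q)) * u powr (\<tau> - 1)"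
  shows "T_bounded a b c (Lorentz1_norm (1 / \<tau>)) (weak_Lp_norm (ereal q)) \<and>
    S_bounded a b c (Lorentz1_norm (1 / \<tau>)) (weak_Lp_norm (ereal q))"
  using Lorentz_weak_bound[OF assms] c q(1)
  by (intro weak_bound_T_S_bounded) (auto intro: Lorentz1_norm_cong)

section \<open>Fourier expansion of the kernel\<close>

lemma integral_circle_rotate:
  fixes f :: "complex \<Rightarrow> 'a::{banach, second_countable_topology}"
  assumes "cmod \<eta> = 1" and [measurable]: "f \<in> borel_measurable borel"
  shows "(\<integral>\<zeta>. f (\<eta> * \<zeta>) \<partial>circle_measure) = (\<integral>\<zeta>. f \<zeta> \<partial>circle_measure)"
  by (subst (2) circle_measure_rotate[OF assms(1), symmetric], subst integral_distr) auto

lemma integral_disc_rotate: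
  fixes f :: "complex \<Rightarrow> 'a::{banach, second_countable_topology}"
  assumes "cmod \<eta> = 1" and [measurable]: "f \<in> borel_measurable borel"
  shows "(\<integral>w. f (\<eta> * w) \<partial>disc_borel) = (\<integral>w. f w \<partial>disc_borel)"
  by (subst (2) disc_borel_rotate[OF assms(1), symmetric], subst integral_distr) auto

lemma integral_disc_average:
  fixes f :: "complex \<Rightarrow> 'a::{banach, second_countable_topology}"
  assumes [measurable]: "f \<in> borel_measurable borel" and f: "integrable disc_borel f"
  shows "(\<integral>w. f w \<partial>disc_borel) = (\<integral>w. \<integral>\<zeta>. f (\<zeta> * w) \<partial>circle_measure \<partial>disc_borel)"
proof -
  interpret P: pair_sigma_finite circle_measure disc_borel ..
  have int: "integrable (circle_measure \<Otimes>\<^sub>M disc_borel) (\<lambda>(\<zeta>, w). f (\<zeta> * w))"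
  proof (rule integrableI_bounded)
    have "(\<integral>\<^sup>+x. ennreal (norm (case x of (\<zeta>, w) \<Rightarrow> f (\<zeta> * w))) \<partial>(circle_measure \<Otimes>\<^sub>M disc_borel)) =
        (\<integral>\<^sup>+w. \<integral>\<^sup>+\<zeta>. ennreal (norm (f (\<zeta> * w))) \<partial>circle_measure \<partial>disc_borel)"
      by (subst P.nn_integral_snd[symmetric]) (auto simp: split_beta')
    also have "\<dots> = (\<integral>\<^sup>+w. ennreal (norm (f w)) \<partial>disc_borel)"
      by (rule nn_integral_disc_average[symmetric]) simp
    also have "\<dots> < \<infinity>" using f by (simp add: integrable_iff_bounded)
    finally show "(\<integral>\<^sup>+x. ennreal (norm (case x of (\<zeta>, w) \<Rightarrow> f (\<zeta> * w))) \<partial>(circle_measure \<Otimes>\<^sub>M disc_borel)) < \<infinity>" .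
  qed measurable
  have "(\<integral>w. \<integral>\<zeta>. f (\<zeta> * w) \<partial>circle_measure \<partial>disc_borel) = (\<integral>\<zeta>. \<integral>w. f (\<zeta> * w) \<partial>disc_borel \<partial>circle_measure)"
    by (rule P.Fubini_integral[OF int])
  also have "\<dots> = (\<integral>\<zeta>. \<integral>w. f w \<partial>disc_borel \<partial>circle_measure)"
  proof (rule integral_cong_AE)
    show "AE \<zeta> in circle_measure. (\<integral>w. f (\<zeta> * w) \<partial>disc_borel) = (\<integral>w. f w \<partial>disc_borel)"
      by (rule eventually_mono[OF AE_circle_measure]) (auto intro: integral_disc_rotate)
    have "(\<lambda>\<zeta>. \<integral>w. f (\<zeta> * w) \<partial>disc_borel) \<in> borel_measurable circle_measure"
      by (rule disc_borel.borel_measurable_lebesgue_integral) simp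
    then show "(\<lambda>\<zeta>. \<integral>w. f (\<zeta> * w) \<partial>disc_borel) \<in> borel_measurable circle_measure" .
  qed simp
  also have "\<dots> = (\<integral>w. f w \<partial>disc_borel)"
    using circle_measure.prob_space by simp
  finally show ?thesis by simp
qed

lemma circle_integrable_bounded:
  fixes f :: "complex \<Rightarrow> 'a::{banach, second_countable_topology}"
  assumes "f \<in> borel_measurable borel" and "\<And>\<zeta>. cmod \<zeta> = 1 \<Longrightarrow> norm (f \<zeta>) \<le> B"
  shows "integrable circle_measure f"
  by (rule circle_measure.integrable_const_bound[where B = B])
     (use assms in \<open>auto intro: eventually_mono[OF AE_circle_measure]\<close>)

lemma circle_orthonormal:
  "(\<integral>\<zeta>. \<zeta> ^ m * cnj \<zeta> ^ n \<partial>circle_measure) = (if m = n then 1 else 0)"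
proof (cases "m = n")
  case True
  have "(\<integral>\<zeta>. \<zeta> ^ m * cnj \<zeta> ^ n \<partial>circle_measure) = (\<integral>\<zeta>. 1 \<partial>circle_measure)"
    using True
    by (intro integral_cong_AE eventually_mono[OF AE_circle_measure])
       (auto simp flip: power_mult_distrib complex_norm_square)
  then show ?thesis using True circle_measure.prob_space by simp
next
  case False
  \<comment> \<open>A unit number for which \<eta>^m times the conjugate of \<eta>^n is -1: rotating
    by it turns the integral into its own negative.\<close>
  define \<eta> where "\<eta> = cis (pi / (real m - real n))"
  have "\<eta> ^ m * cnj \<eta> ^ n = cis (real m * (pi / (real m - real n)) + real n * (- (pi / (real m - real n))))"
    unfolding \<eta>_def by (simp only: cis_cnj Complex.DeMoivre cis_mult)
  also have "real m * (pi / (real m - real n)) + real n * (- (pi / (real m - real n))) = pi"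
  proof -
    have "real m * (pi / (real m - real n)) + real n * (- (pi / (real m - real n))) = (real m - real n) * (pi / (real m - real n))"
      by (simp only: left_diff_distrib mult_minus_right add_uminus_conv_diff)
    also have "\<dots> = pi" using False by simp
    finally show ?thesis .
  qed
  finally have \<eta>: "\<eta> ^ m * cnj \<eta> ^ n = -1" by simp
  let ?I = "\<integral>\<zeta>. \<zeta> ^ m * cnj \<zeta> ^ n \<partial>circle_measure"
  have "?I = (\<integral>\<zeta>. (\<eta> * \<zeta>) ^ m * cnj (\<eta> * \<zeta>) ^ n \<partial>circle_measure)"
    by (rule integral_circle_rotate[symmetric]) (simp_all add: \<eta>_def)
  also have "\<dots> = (\<integral>\<zeta>. (\<eta> ^ m * cnj \<eta> ^ n) * (\<zeta> ^ m * cnj \<zeta> ^ n) \<partial>circle_measure)"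
    by (simp add: power_mult_distrib mult_ac)
  also have "\<dots> = - ?I" unfolding \<eta> by simp
  finally show ?thesis using False by (simp add: equation_minus_iff)
qed

lemma circle_parseval:
  "(\<integral>\<zeta>. (cmod (\<Sum>n<N. \<beta> n * \<zeta> ^ n))\<^sup>2 \<partial>circle_measure) = (\<Sum>n<N. (cmod (\<beta> n))\<^sup>2)"
proof -
  have "complex_of_real (\<integral>\<zeta>. (cmod (\<Sum>n<N. \<beta> n * \<zeta> ^ n))\<^sup>2 \<partial>circle_measure) =
      (\<integral>\<zeta>. complex_of_real ((cmod (\<Sum>n<N. \<beta> n * \<zeta> ^ n))\<^sup>2) \<partial>circle_measure)"
    by (rule integral_complex_of_real[symmetric])
  also have "\<dots> = (\<integral>\<zeta>. (\<Sum>m<N. \<Sum>n<N. \<beta> m * cnj (\<beta> n) * (\<zeta> ^ m * cnj \<zeta> ^ n)) \<partial>circle_measure)"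
    by (intro Bochner_Integration.integral_cong refl)
       (simp add: complex_norm_square sum_product mult_ac flip: of_real_power)
  also have "\<dots> = (\<Sum>m<N. \<Sum>n<N. \<beta> m * cnj (\<beta> n) * (\<integral>\<zeta>. \<zeta> ^ m * cnj \<zeta> ^ n \<partial>circle_measure))"
  proof -
    have int: "integrable circle_measure (\<lambda>\<zeta>. \<zeta> ^ m * cnj \<zeta> ^ n)" for m n
      by (rule circle_integrable_bounded[where B = 1]) (auto simp: norm_mult norm_power)
    show ?thesis
      by (subst Bochner_Integration.integral_sum, intro Bochner_Integration.integrable_sum integrable_mult_right int,
          subst Bochner_Integration.integral_sum, intro integrable_mult_right int) simp
  qed
  also have "\<dots> = (\<Sum>m<N. \<beta> m * cnj (\<beta> m))"
    by (intro sum.cong refl) (simp add: circle_orthonormal if_distrib[of "\<lambda>x. _ * x"] cong: if_cong)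
  also have "\<dots> = complex_of_real (\<Sum>n<N. (cmod (\<beta> n))\<^sup>2)"
    by (simp add: complex_norm_square flip: of_real_power)
  finally show ?thesis by (simp only: of_real_eq_iff)
qed

text \<open>The squared distance from h to a trigonometric polynomial is nonnegative. The
  coefficients pair h with \<zeta>^n without a conjugate, so it is the conjugate of \<open>S\<close>
  that is subtracted.\<close>

lemma circle_bessel:
  assumes [measurable]: "h \<in> borel_measurable borel" and H: "\<And>\<zeta>. cmod \<zeta> = 1 \<Longrightarrow> cmod (h \<zeta>) \<le> H"
  shows "(\<Sum>n<N. (cmod (\<integral>\<zeta>. h \<zeta> * \<zeta> ^ n \<partial>circle_measure))\<^sup>2) \<le> (\<integral>\<zeta>. (cmod (h \<zeta>))\<^sup>2 \<partial>circle_measure)"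
proof -
  define c where "c n = (\<integral>\<zeta>. h \<zeta> * \<zeta> ^ n \<partial>circle_measure)" for n
  define S where "S \<zeta> = (\<Sum>n<N. cnj (c n) * \<zeta> ^ n)" for \<zeta>
  have [measurable]: "S \<in> borel_measurable borel" unfolding S_def by measurable
  have H0: "0 \<le> H" using order_trans[OF norm_ge_zero H[of 1]] by simp
  have S_bd: "cmod (S \<zeta>) \<le> (\<Sum>n<N. cmod (c n))" if "cmod \<zeta> = 1" for \<zeta>
    unfolding S_def using that by (intro order_trans[OF norm_sum] sum_mono) (simp add: norm_mult norm_power)
  have hS: "(\<integral>\<zeta>. h \<zeta> * S \<zeta> \<partial>circle_measure) = of_real (\<Sum>n<N. (cmod (c n))\<^sup>2)"
  proof -
    have int: "integrable circle_measure (\<lambda>\<zeta>. h \<zeta> * \<zeta> ^ n)" for n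
      by (rule circle_integrable_bounded[where B = H]) (auto simp: norm_mult norm_power H)
    have "(\<integral>\<zeta>. h \<zeta> * S \<zeta> \<partial>circle_measure) = (\<integral>\<zeta>. (\<Sum>n<N. cnj (c n) * (h \<zeta> * \<zeta> ^ n)) \<partial>circle_measure)"
      by (simp add: S_def sum_distrib_left mult_ac)
    also have "\<dots> = (\<Sum>n<N. cnj (c n) * c n)"
      unfolding c_def by (subst Bochner_Integration.integral_sum, intro integrable_mult_right int) simp
    also have "\<dots> = of_real (\<Sum>n<N. (cmod (c n))\<^sup>2)"
      by (simp add: complex_norm_square mult.commute flip: of_real_power)
    finally show ?thesis .
  qed
  have "0 \<le> (\<integral>\<zeta>. (cmod (h \<zeta> - cnj (S \<zeta>)))\<^sup>2 \<partial>circle_measure)"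
    by (rule Bochner_Integration.integral_nonneg) simp
  also have "\<dots> = (\<integral>\<zeta>. (cmod (h \<zeta>))\<^sup>2 + (cmod (S \<zeta>))\<^sup>2 - 2 * Re (h \<zeta> * S \<zeta>) \<partial>circle_measure)"
    by (intro Bochner_Integration.integral_cong refl)
       (simp only: cmod_power2, simp add: power2_eq_square algebra_simps)
  also have "\<dots> = (\<integral>\<zeta>. (cmod (h \<zeta>))\<^sup>2 \<partial>circle_measure) + (\<integral>\<zeta>. (cmod (S \<zeta>))\<^sup>2 \<partial>circle_measure) - 2 * Re (\<integral>\<zeta>. h \<zeta> * S \<zeta> \<partial>circle_measure)"
  proof -
    have 1: "integrable circle_measure (\<lambda>\<zeta>. (cmod (h \<zeta>))\<^sup>2)"
      by (rule circle_integrable_bounded[where B = "H\<^sup>2"]) (auto intro!: power_mono H)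
    have 2: "integrable circle_measure (\<lambda>\<zeta>. (cmod (S \<zeta>))\<^sup>2)"
      by (rule circle_integrable_bounded[where B = "(\<Sum>n<N. cmod (c n))\<^sup>2"]) (auto intro!: power_mono S_bd)
    have 3: "integrable circle_measure (\<lambda>\<zeta>. h \<zeta> * S \<zeta>)"
      by (rule circle_integrable_bounded[where B = "H * (\<Sum>n<N. cmod (c n))"])
         (auto simp: norm_mult intro!: mult_mono H S_bd H0)
    have 4: "integrable circle_measure (\<lambda>\<zeta>. Re (h \<zeta> * S \<zeta>))"
      "(\<integral>\<zeta>. Re (h \<zeta> * S \<zeta>) \<partial>circle_measure) = Re (\<integral>\<zeta>. h \<zeta> * S \<zeta> \<partial>circle_measure)"
      using 3 by (rule integrable_Re, rule integral_Re)
    show ?thesis using 1 2 4 by (simp del: times_complex.simps)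
  qed
  also have "(\<integral>\<zeta>. (cmod (S \<zeta>))\<^sup>2 \<partial>circle_measure) = (\<Sum>n<N. (cmod (c n))\<^sup>2)"
    unfolding S_def by (simp add: circle_parseval)
  finally show ?thesis
    unfolding hS by (simp add: c_def)
qed

text \<open>The Taylor coefficients of (1 - x)^(-c), which grow like n^(c - 1) for c > 0.\<close>

definition kernel_coeff :: "real \<Rightarrow> nat \<Rightarrow> real" where
  "kernel_coeff c n = pochhammer c n / fact n"

lemma kernel_coeff_pos: "0 < c \<Longrightarrow> 0 < kernel_coeff c n"
  by (simp add: kernel_coeff_def pochhammer_pos)

lemma kernel_sums:
  assumes "cmod x < 1"
  shows "(\<lambda>n. of_real (kernel_coeff c n) * x ^ n) sums (1 / (1 - x) powr of_real c)"
proof -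
  have "(\<lambda>n. ((- of_real c :: complex) gchoose n) * (- x) ^ n) sums (1 + (- x)) powr (- of_real c)"
    using assms by (intro gen_binomial_complex) simp
  moreover have "((- of_real c :: complex) gchoose n) * (- x) ^ n = of_real (kernel_coeff c n) * x ^ n" for n
  proof -
    have "(-1 :: complex) ^ n * (- x) ^ n = x ^ n" by (simp flip: power_mult_distrib)
    then show ?thesis
      by (simp add: gbinomial_pochhammer kernel_coeff_def pochhammer_of_real field_simps)
  qed
  ultimately show ?thesis
    by (simp add: powr_minus_divide)
qed

lemma kernel_coeff_summable:
  assumes "0 < c" "0 \<le> r" "r < 1"
  shows "summable (\<lambda>n. kernel_coeff c n * r ^ n)"
proof -
  \<comment> \<open>Convergence of the binomial series at this point, whose modulus lies strictly
    between r and 1, gives absolute convergence at r.\<close>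
  define s where "s = complex_of_real ((1 + r) / 2)"
  have s: "cmod s = (1 + r) / 2" unfolding s_def norm_of_real using assms by simp
  have "summable (\<lambda>n. of_real (kernel_coeff c n) * s ^ n)"
    using kernel_sums[of s c] s assms by (intro sums_summable) auto
  then have "summable (\<lambda>n. norm (of_real (kernel_coeff c n) * complex_of_real r ^ n))"
    by (rule powser_insidea) (use s assms in auto)
  then show ?thesis
    using assms kernel_coeff_pos[OF assms(1)] by (simp add: norm_mult norm_power less_imp_le)
qed

text \<open>Termwise integration of the binomial series, dominated on the circle by \<open>H\<close>
  times a convergent series.\<close>

lemma circle_kernel_expansion:
  assumes c: "0 < c" and x: "cmod x < 1" and [measurable]: "h \<in> borel_measurable borel"
    and H: "\<And>\<zeta>. cmod \<zeta> = 1 \<Longrightarrow> cmod (h \<zeta>) \<le> H"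
  shows "(\<lambda>n. of_real (kernel_coeff c n) * x ^ n * (\<integral>\<zeta>. h \<zeta> * \<zeta> ^ n \<partial>circle_measure)) sums
    (\<integral>\<zeta>. h \<zeta> / (1 - \<zeta> * x) powr of_real c \<partial>circle_measure)"
proof -
  have H0: "0 \<le> H" using order_trans[OF norm_ge_zero H[of 1]] by simp
  define f where "f n \<zeta> = of_real (kernel_coeff c n) * x ^ n * (h \<zeta> * \<zeta> ^ n)" for n \<zeta>
  have [measurable]: "f n \<in> borel_measurable borel" for n unfolding f_def by measurable
  have f_bd: "cmod (f n \<zeta>) \<le> H * (kernel_coeff c n * cmod x ^ n)" if "cmod \<zeta> = 1" for n \<zeta>
  proof -
    have "cmod (f n \<zeta>) = cmod (h \<zeta>) * (kernel_coeff c n * cmod x ^ n)"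
      using that kernel_coeff_pos[OF c, of n] by (simp add: f_def norm_mult norm_power)
    also have "\<dots> \<le> H * (kernel_coeff c n * cmod x ^ n)"
      using kernel_coeff_pos[OF c, of n] that by (intro mult_right_mono H) auto
    finally show ?thesis .
  qed
  have sm: "summable (\<lambda>n. H * (kernel_coeff c n * cmod x ^ n))"
    by (intro summable_mult kernel_coeff_summable c x) simp
  have int: "integrable circle_measure (f n)" for n
    by (rule circle_integrable_bounded[where B = "H * (kernel_coeff c n * cmod x ^ n)"]) (auto intro: f_bd)
  have "(\<lambda>n. integral\<^sup>L circle_measure (f n)) sums (\<integral>\<zeta>. (\<Sum>n. f n \<zeta>) \<partial>circle_measure)"
  proof (rule sums_integral[OF int])
    show "AE \<zeta> in circle_measure. summable (\<lambda>n. norm (f n \<zeta>))"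
    proof (rule eventually_mono[OF AE_circle_measure])
      fix \<zeta> assume "cmod \<zeta> = 1"
      then show "summable (\<lambda>n. norm (f n \<zeta>))"
        by (intro summable_comparison_test'[OF sm, of 0]) (auto intro: f_bd)
    qed
    show "summable (\<lambda>n. \<integral>\<zeta>. norm (f n \<zeta>) \<partial>circle_measure)"
    proof (rule summable_comparison_test'[OF sm, of 0])
      fix n
      have "(\<integral>\<zeta>. norm (f n \<zeta>) \<partial>circle_measure) \<le> (\<integral>\<zeta>. H * (kernel_coeff c n * cmod x ^ n) \<partial>circle_measure)"
        by (intro integral_mono_AE integrable_norm int eventually_mono[OF AE_circle_measure]) (auto intro: f_bd)
      then show "norm (\<integral>\<zeta>. norm (f n \<zeta>) \<partial>circle_measure) \<le> H * (kernel_coeff c n * cmod x ^ n)"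
        using circle_measure.prob_space by simp
    qed
  qed
  moreover have "integral\<^sup>L circle_measure (f n) = of_real (kernel_coeff c n) * x ^ n * (\<integral>\<zeta>. h \<zeta> * \<zeta> ^ n \<partial>circle_measure)" for n
    unfolding f_def by simp
  moreover have "(\<integral>\<zeta>. (\<Sum>n. f n \<zeta>) \<partial>circle_measure) = (\<integral>\<zeta>. h \<zeta> / (1 - \<zeta> * x) powr of_real c \<partial>circle_measure)"
  proof (rule integral_cong_AE)
    show "AE \<zeta> in circle_measure. (\<Sum>n. f n \<zeta>) = h \<zeta> / (1 - \<zeta> * x) powr of_real c"
    proof (rule eventually_mono[OF AE_circle_measure])
      fix \<zeta> assume "cmod \<zeta> = 1"
      then have "(\<lambda>n. h \<zeta> * (of_real (kernel_coeff c n) * (\<zeta> * x) ^ n)) sums (h \<zeta> * (1 / (1 - \<zeta> * x) powr of_real c))"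
        using x by (intro sums_mult kernel_sums) (simp add: norm_mult)
      moreover have "h \<zeta> * (of_real (kernel_coeff c n) * (\<zeta> * x) ^ n) = f n \<zeta>" for n
        by (simp add: f_def power_mult_distrib mult_ac)
      ultimately show "(\<Sum>n. f n \<zeta>) = h \<zeta> / (1 - \<zeta> * x) powr of_real c"
        by (simp add: sums_iff)
    qed
  qed measurable
  ultimately show ?thesis by simp
qed

text \<open>By orthogonality the expansion with h the conjugate of \<zeta>^n has a single nonzero
  term; conjugating the identity gives the form that occurs for T. Conjugation commutes with the
  power because its base has positive real part.\<close>

lemma circle_kernel_coefficient:
  assumes c: "0 < c" and x: "cmod x < 1"
  shows "(\<integral>\<zeta>. \<zeta> ^ n / (1 - cnj \<zeta> * x) powr of_real c \<partial>circle_measure) = of_real (kernel_coeff c n) * x ^ n"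
proof -
  have "(\<lambda>k. of_real (kernel_coeff c k) * cnj x ^ k * (\<integral>\<zeta>. cnj \<zeta> ^ n * \<zeta> ^ k \<partial>circle_measure)) sums
    (\<integral>\<zeta>. cnj \<zeta> ^ n / (1 - \<zeta> * cnj x) powr of_real c \<partial>circle_measure)"
    using x by (intro circle_kernel_expansion[where H = 1] c) (auto simp: norm_power)
  moreover have "of_real (kernel_coeff c k) * cnj x ^ k * (\<integral>\<zeta>. cnj \<zeta> ^ n * \<zeta> ^ k \<partial>circle_measure) =
      (if k = n then of_real (kernel_coeff c n) * cnj x ^ n else 0)" for k
    using circle_orthonormal[of k n] by (simp add: mult.commute)
  ultimately have "(\<lambda>k. if k = n then of_real (kernel_coeff c n) * cnj x ^ n else 0) sums
    (\<integral>\<zeta>. cnj \<zeta> ^ n / (1 - \<zeta> * cnj x) powr of_real c \<partial>circle_measure)" by simp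
  then have "(\<integral>\<zeta>. cnj \<zeta> ^ n / (1 - \<zeta> * cnj x) powr of_real c \<partial>circle_measure) = of_real (kernel_coeff c n) * cnj x ^ n"
    using sums_single[of n "\<lambda>_. of_real (kernel_coeff c n) * cnj x ^ n"] sums_unique2 by (auto simp: eq_commute)
  then have "cnj (\<integral>\<zeta>. cnj \<zeta> ^ n / (1 - \<zeta> * cnj x) powr of_real c \<partial>circle_measure) = of_real (kernel_coeff c n) * x ^ n"
    by simp
  moreover have "cnj (\<integral>\<zeta>. cnj \<zeta> ^ n / (1 - \<zeta> * cnj x) powr of_real c \<partial>circle_measure) =
      (\<integral>\<zeta>. \<zeta> ^ n / (1 - cnj \<zeta> * x) powr of_real c \<partial>circle_measure)"
  proof -
    have "cnj ((1 - \<zeta> * cnj x) powr of_real c) = (1 - cnj \<zeta> * x) powr of_real c" if "cmod \<zeta> = 1" for \<zeta>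
    proof -
      have "cmod (\<zeta> * cnj x) < 1" using that x by (simp add: norm_mult)
      then have "0 < Re (1 - \<zeta> * cnj x)"
        using complex_Re_le_cmod[of "\<zeta> * cnj x"] by simp
      then have "1 - \<zeta> * cnj x \<notin> \<real>\<^sub>\<le>\<^sub>0"
        by (metis complex_nonpos_Reals_iff not_le)
      then show ?thesis
        by (subst cnj_powr) (use \<open>0 < Re (1 - \<zeta> * cnj x)\<close> in auto)
    qed
    then have "(\<integral>\<zeta>. cnj (cnj \<zeta> ^ n / (1 - \<zeta> * cnj x) powr of_real c) \<partial>circle_measure) =
        (\<integral>\<zeta>. \<zeta> ^ n / (1 - cnj \<zeta> * x) powr of_real c \<partial>circle_measure)"
      by (intro integral_cong_AE eventually_mono[OF AE_circle_measure]) auto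
    then show ?thesis by (simp only: Bochner_Integration.integral_cnj)
  qed
  ultimately show ?thesis by simp
qed

text \<open>Averaging over rotations of w extracts the n-th Taylor term of the kernel, so T sends a
  radial multiple of w^n to a multiple of z^n, apart from the outer weight. Both counterexamples for
  T rest on this, one with n = 0 and one with n = 2^k.\<close>

lemma integral_radial_monomial:
  assumes c: "0 < c" and z: "cmod z < 1" and [measurable]: "\<phi> \<in> borel_measurable borel"
    and int: "integrable disc_borel (\<lambda>w. complex_of_real (\<phi> (defect w)) * w ^ n / (1 - z * cnj w) powr of_real c)"
  shows "(\<integral>w. complex_of_real (\<phi> (defect w)) * w ^ n / (1 - z * cnj w) powr of_real c \<partial>disc_borel) =
    of_real (kernel_coeff c n * (\<integral>w. \<phi> (defect w) * (cmod w ^ 2) ^ n \<partial>disc_borel)) * z ^ n"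
proof -
  have "(\<integral>w. complex_of_real (\<phi> (defect w)) * w ^ n / (1 - z * cnj w) powr of_real c \<partial>disc_borel) =
      (\<integral>w. \<integral>\<zeta>. complex_of_real (\<phi> (defect (\<zeta> * w))) * (\<zeta> * w) ^ n / (1 - z * cnj (\<zeta> * w)) powr of_real c \<partial>circle_measure \<partial>disc_borel)"
    by (rule integral_disc_average[OF _ int]) measurable
  also have "\<dots> = (\<integral>w. of_real (kernel_coeff c n) * z ^ n * of_real (\<phi> (defect w) * (cmod w ^ 2) ^ n) \<partial>disc_borel)"
  proof (rule integral_cong_AE)
    show "AE w in disc_borel. (\<integral>\<zeta>. complex_of_real (\<phi> (defect (\<zeta> * w))) * (\<zeta> * w) ^ n / (1 - z * cnj (\<zeta> * w)) powr of_real c \<partial>circle_measure) =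
        of_real (kernel_coeff c n) * z ^ n * of_real (\<phi> (defect w) * (cmod w ^ 2) ^ n)"
    proof (rule eventually_mono[OF AE_disc_borel_cmod])
      fix w assume w: "cmod w < 1"
      have "cmod z * cmod w \<le> cmod z * 1" using w by (intro mult_left_mono) auto
      then have zw: "cmod (z * cnj w) < 1" using z by (simp add: norm_mult)
      have "(\<integral>\<zeta>. complex_of_real (\<phi> (defect (\<zeta> * w))) * (\<zeta> * w) ^ n / (1 - z * cnj (\<zeta> * w)) powr of_real c \<partial>circle_measure) =
          (\<integral>\<zeta>. complex_of_real (\<phi> (defect w)) * w ^ n * (\<zeta> ^ n / (1 - cnj \<zeta> * (z * cnj w)) powr of_real c) \<partial>circle_measure)"
        by (intro integral_cong_AE eventually_mono[OF AE_circle_measure])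
           (auto simp: defect_rotate power_mult_distrib mult_ac)
      also have "\<dots> = complex_of_real (\<phi> (defect w)) * w ^ n * (of_real (kernel_coeff c n) * (z * cnj w) ^ n)"
        by (simp only: integral_mult_right_zero circle_kernel_coefficient[OF c zw])
      also have "w ^ n * (z * cnj w) ^ n = z ^ n * of_real ((cmod w ^ 2) ^ n)"
      proof -
        have "w * (z * cnj w) = z * of_real (cmod w ^ 2)"
          by (simp only: complex_norm_square mult_ac)
        then have "(w * (z * cnj w)) ^ n = (z * of_real (cmod w ^ 2)) ^ n" by (simp only:)
        then show ?thesis by (simp add: power_mult_distrib)
      qed
      then have "complex_of_real (\<phi> (defect w)) * w ^ n * (of_real (kernel_coeff c n) * (z * cnj w) ^ n) =
          of_real (kernel_coeff c n) * z ^ n * of_real (\<phi> (defect w) * (cmod w ^ 2) ^ n)"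
        by (simp add: mult_ac)
      finally show "(\<integral>\<zeta>. complex_of_real (\<phi> (defect (\<zeta> * w))) * (\<zeta> * w) ^ n / (1 - z * cnj (\<zeta> * w)) powr of_real c \<partial>circle_measure) =
        of_real (kernel_coeff c n) * z ^ n * of_real (\<phi> (defect w) * (cmod w ^ 2) ^ n)" .
    qed
    show "(\<lambda>w. \<integral>\<zeta>. complex_of_real (\<phi> (defect (\<zeta> * w))) * (\<zeta> * w) ^ n / (1 - z * cnj (\<zeta> * w)) powr of_real c \<partial>circle_measure) \<in> borel_measurable disc_borel"
      by (rule circle_measure.borel_measurable_lebesgue_integral) measurable
  qed measurable
  also have "\<dots> = of_real (kernel_coeff c n) * z ^ n * of_real (\<integral>w. \<phi> (defect w) * (cmod w ^ 2) ^ n \<partial>disc_borel)"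
    by (simp only: integral_mult_right_zero integral_complex_of_real)
  finally show ?thesis by (simp add: mult_ac)
qed

section \<open>Size of the Taylor coefficients by log-convexity of Gamma\<close>

lemma Gamma_midpoint_le:
  fixes x y :: real
  assumes "0 < x" "0 < y"
  shows "Gamma ((x + y) / 2) ^ 2 \<le> Gamma x * Gamma y"
proof -
  have *: "(ln \<circ> Gamma) ((1 - 1/2) *\<^sub>R x + (1/2) *\<^sub>R y) \<le> (1 - 1/2) * (ln \<circ> Gamma) x + (1/2) * (ln \<circ> Gamma) y"
    using assms by (intro convex_onD[OF log_convex_Gamma_real]) auto
  have "0 < Gamma ((x + y) / 2)" using assms by (intro Gamma_real_pos) simp
  from * have "2 * ln (Gamma ((x + y) / 2)) \<le> ln (Gamma x) + ln (Gamma y)"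
    by (simp add: algebra_simps add_divide_distrib)
  also have "\<dots> = ln (Gamma x * Gamma y)"
    using Gamma_real_pos[of x] Gamma_real_pos[of y] assms by (simp add: ln_mult_pos)
  also have "2 * ln (Gamma ((x + y) / 2)) = ln (Gamma ((x + y) / 2) ^ 2)"
    using \<open>0 < Gamma ((x + y) / 2)\<close> by (simp add: ln_realpow)
  finally have "ln (Gamma ((x + y) / 2) ^ 2) \<le> ln (Gamma x * Gamma y)" .
  moreover have "0 < Gamma ((x + y) / 2) ^ 2" "0 < Gamma x * Gamma y"
    using \<open>0 < Gamma ((x + y) / 2)\<close> Gamma_real_pos[of x] Gamma_real_pos[of y] assms by (blast intro: zero_less_power mult_pos_pos)+
  ultimately show ?thesis by (simp only: ln_le_cancel_iff)
qed

lemma kernel_coeff_Gamma: "0 < c \<Longrightarrow> kernel_coeff c n = Gamma (c + n) / (Gamma c * fact n)"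
  by (simp add: kernel_coeff_def pochhammer_Gamma nonpos_Ints_def)

text \<open>The squared coefficient grows like n^(2 c - 2) and the Beta factor decays at the same
  rate. The bound is uniform in n because c + n is the midpoint of n + 1 and 2 c - 1 + n, the
  arguments of Gamma left in the denominator.\<close>

lemma kernel_coeff_Beta_le:
  assumes c: "1 < c"
  shows "(kernel_coeff c n)\<^sup>2 * Beta (2 * c - 2) (real n + 1) \<le> Gamma (2 * c - 2) / (Gamma c)\<^sup>2"
proof -
  have pos: "0 < Gamma c" "0 < Gamma (2 * c - 2)" "0 < Gamma (2 * c - 1 + n)" "0 < Gamma (real n + 1)"
    using c by (auto intro!: Gamma_real_pos)
  have fact: "Gamma (real n + 1) = fact n" using Gamma_fact[of n, where 'a = real] by (simp add: add.commute)
  have "Gamma (((real n + 1) + (2 * c - 1 + n)) / 2) ^ 2 \<le> Gamma (real n + 1) * Gamma (2 * c - 1 + n)"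
    using c by (intro Gamma_midpoint_le) auto
  moreover have "((real n + 1) + (2 * c - 1 + n)) / 2 = c + n" by (simp add: field_simps)
  ultimately have le: "Gamma (c + n) ^ 2 \<le> fact n * Gamma (2 * c - 1 + n)"
    by (simp only: fact)
  have "(kernel_coeff c n)\<^sup>2 * Beta (2 * c - 2) (real n + 1) =
      Gamma (2 * c - 2) / (Gamma c)\<^sup>2 * (Gamma (c + n) ^ 2 / (fact n * Gamma (2 * c - 1 + n)))"
    using c pos by (simp add: kernel_coeff_Gamma Beta_def fact fact[unfolded add.commute[of _ 1]] power2_eq_square field_simps)
  also have "\<dots> \<le> Gamma (2 * c - 2) / (Gamma c)\<^sup>2 * 1"
    using le pos by (intro mult_left_mono) auto
  finally show ?thesis by simp
qed

section \<open>Interpolation for the holomorphic kernel\<close>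

text \<open>The transposed operator: pairing the inner integral of T with h on the circle through z
  leaves the integral of u^b f against this function.\<close>

definition circle_transform :: "real \<Rightarrow> complex \<Rightarrow> (complex \<Rightarrow> complex) \<Rightarrow> complex \<Rightarrow> complex" where
  "circle_transform c z h w = (\<integral>\<zeta>. h \<zeta> / (1 - \<zeta> * (z * cnj w)) powr of_real c \<partial>circle_measure)"

lemma measurable_circle_transform [measurable]:
  assumes [measurable]: "h \<in> borel_measurable borel"
  shows "circle_transform c z h \<in> borel_measurable borel"
proof -
  have "(\<lambda>w. \<integral>\<zeta>. h \<zeta> / (1 - \<zeta> * (z * cnj w)) powr of_real c \<partial>circle_measure) \<in> borel_measurable borel"
    by (rule circle_measure.borel_measurable_lebesgue_integral) measurable
  then show ?thesis by (simp add: circle_transform_def[abs_def])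
qed

lemma cmod_mult_cnj_less_1: "cmod z < 1 \<Longrightarrow> cmod w < 1 \<Longrightarrow> cmod (z * cnj w) < 1"
  using mult_left_mono[of "cmod w" 1 "cmod z"] by (simp add: norm_mult)

text \<open>Since u is uniform and |w|^2 = 1 - u, this is a Beta integral.\<close>

lemma nn_integral_disc_Beta_le:
  assumes "0 < a"
  shows "(\<integral>\<^sup>+w. ennreal (defect w powr (a - 1) * (cmod w ^ 2) ^ n) \<partial>disc_borel) \<le> ennreal (Beta a (real n + 1))"
proof -
  have "(\<integral>\<^sup>+w. ennreal (defect w powr (a - 1) * (cmod w ^ 2) ^ n) \<partial>disc_borel) =
      (\<integral>\<^sup>+w. ennreal (defect w powr (a - 1) * (1 - defect w) ^ n) \<partial>disc_borel)"
    by (simp add: defect_def)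
  also have "\<dots> = (\<integral>\<^sup>+x\<in>{0<..<1}. ennreal (x powr (a - 1) * (1 - x) ^ n) \<partial>lborel)"
    by (rule nn_integral_radial) measurable
  also have "\<dots> \<le> (\<integral>\<^sup>+x. ennreal (indicator {0..1} x * (x powr (a - 1) * (1 - x) powr (real n + 1 - 1))) \<partial>lborel)"
    by (intro nn_integral_mono) (auto simp: indicator_def powr_realpow)
  also have "\<dots> = ennreal (Beta a (real n + 1))"
    using assms
    by (intro nn_integral_has_integral_lebesgue has_integral_Beta_real) auto
  finally show ?thesis .
qed

text \<open>Parseval on each circle |w| = const makes the square integral diagonal: the n-th
  coefficient of h is multiplied by the n-th Taylor coefficient, and the radial integral contributes
  a Beta value. Their combination is uniformly bounded, and Bessel's inequality sums what is
  left.\<close>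

lemma circle_transform_L2:
  assumes c: "1 < c" and z: "cmod z < 1" and [measurable]: "h \<in> borel_measurable borel"
    and H: "\<And>\<zeta>. cmod \<zeta> = 1 \<Longrightarrow> cmod (h \<zeta>) \<le> H"
  shows "(\<integral>\<^sup>+w. ennreal (defect w powr (2 * c - 3) * (cmod (circle_transform c z h w))\<^sup>2) \<partial>disc_borel) \<le>
    ennreal (Gamma (2 * c - 2) / (Gamma c)\<^sup>2) * (\<integral>\<^sup>+\<zeta>. ennreal ((cmod (h \<zeta>))\<^sup>2) \<partial>circle_measure)"
proof -
  define B where "B = Gamma (2 * c - 2) / (Gamma c)\<^sup>2"
  have B: "0 < B" using c by (auto simp: B_def intro!: divide_pos_pos Gamma_real_pos zero_less_power)
  define hh where "hh n = (\<integral>\<zeta>. h \<zeta> * \<zeta> ^ n \<partial>circle_measure)" for n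
  define \<beta> where "\<beta> n = of_real (kernel_coeff c n) * z ^ n * hh n" for n
  define P where "P N w = (\<Sum>n<N. \<beta> n * cnj w ^ n)" for N w
  have [measurable]: "P N \<in> borel_measurable borel" for N unfolding P_def by measurable
  have lim: "(\<lambda>N. P N w) \<longlonglongrightarrow> circle_transform c z h w" if "cmod w < 1" for w
  proof -
    have "(\<lambda>n. of_real (kernel_coeff c n) * (z * cnj w) ^ n * hh n) sums circle_transform c z h w"
      unfolding hh_def circle_transform_def
      using c by (intro circle_kernel_expansion[where H = H] H cmod_mult_cnj_less_1 z that) auto
    moreover have "of_real (kernel_coeff c n) * (z * cnj w) ^ n * hh n = \<beta> n * cnj w ^ n" for n
      by (simp add: \<beta>_def power_mult_distrib mult_ac)
    ultimately show ?thesis by (simp add: sums_def P_def)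
  qed
  have fin: "(\<integral>\<^sup>+w. ennreal (defect w powr (2 * c - 3) * (cmod (P N w))\<^sup>2) \<partial>disc_borel) \<le>
      ennreal (B * (\<integral>\<zeta>. (cmod (h \<zeta>))\<^sup>2 \<partial>circle_measure))" for N
  proof -
    have "(\<integral>\<^sup>+w. ennreal (defect w powr (2 * c - 3) * (cmod (P N w))\<^sup>2) \<partial>disc_borel) =
        (\<integral>\<^sup>+w. \<integral>\<^sup>+\<zeta>. ennreal (defect (\<zeta> * w) powr (2 * c - 3) * (cmod (P N (\<zeta> * w)))\<^sup>2) \<partial>circle_measure \<partial>disc_borel)"
      by (rule nn_integral_disc_average) measurable
    also have "\<dots> = (\<integral>\<^sup>+w. (\<Sum>n<N. ennreal ((cmod (\<beta> n))\<^sup>2) * ennreal (defect w powr (2 * c - 2 - 1) * (cmod w ^ 2) ^ n)) \<partial>disc_borel)"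
    proof (rule nn_integral_cong)
      fix w
      define \<gamma> where "\<gamma> n = cnj (\<beta> n * cnj w ^ n)" for n
      have "cmod (P N (\<zeta> * w)) = cmod (\<Sum>n<N. \<gamma> n * \<zeta> ^ n)" for \<zeta>
      proof -
        have "cnj (P N (\<zeta> * w)) = (\<Sum>n<N. \<gamma> n * \<zeta> ^ n)"
          by (simp add: P_def \<gamma>_def power_mult_distrib mult_ac)
        then show ?thesis by (metis complex_mod_cnj)
      qed
      then have "(\<integral>\<^sup>+\<zeta>. ennreal (defect (\<zeta> * w) powr (2 * c - 3) * (cmod (P N (\<zeta> * w)))\<^sup>2) \<partial>circle_measure) =
          (\<integral>\<^sup>+\<zeta>. ennreal (defect w powr (2 * c - 3)) * ennreal ((cmod (\<Sum>n<N. \<gamma> n * \<zeta> ^ n))\<^sup>2) \<partial>circle_measure)"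
        by (intro nn_integral_cong_AE eventually_mono[OF AE_circle_measure]) (simp add: defect_rotate ennreal_mult)
      also have "\<dots> = ennreal (defect w powr (2 * c - 3)) * (\<integral>\<^sup>+\<zeta>. ennreal ((cmod (\<Sum>n<N. \<gamma> n * \<zeta> ^ n))\<^sup>2) \<partial>circle_measure)"
        by (rule nn_integral_cmult) measurable
      also have "(\<integral>\<^sup>+\<zeta>. ennreal ((cmod (\<Sum>n<N. \<gamma> n * \<zeta> ^ n))\<^sup>2) \<partial>circle_measure) =
          ennreal (\<integral>\<zeta>. (cmod (\<Sum>n<N. \<gamma> n * \<zeta> ^ n))\<^sup>2 \<partial>circle_measure)"
      proof (rule nn_integral_eq_integral)
        show "integrable circle_measure (\<lambda>\<zeta>. (cmod (\<Sum>n<N. \<gamma> n * \<zeta> ^ n))\<^sup>2)"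
        proof (rule circle_integrable_bounded[where B = "(\<Sum>n<N. cmod (\<gamma> n))\<^sup>2"])
          fix \<zeta> :: complex assume "cmod \<zeta> = 1"
          then have "cmod (\<Sum>n<N. \<gamma> n * \<zeta> ^ n) \<le> (\<Sum>n<N. cmod (\<gamma> n))"
            by (intro order_trans[OF norm_sum] sum_mono) (simp add: norm_mult norm_power)
          then show "norm ((cmod (\<Sum>n<N. \<gamma> n * \<zeta> ^ n))\<^sup>2) \<le> (\<Sum>n<N. cmod (\<gamma> n))\<^sup>2"
            by (simp add: power_mono)
        qed measurable
      qed simp
      also have "(\<integral>\<zeta>. (cmod (\<Sum>n<N. \<gamma> n * \<zeta> ^ n))\<^sup>2 \<partial>circle_measure) = (\<Sum>n<N. (cmod (\<beta> n))\<^sup>2 * (cmod w ^ 2) ^ n)"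
        by (subst circle_parseval) (simp add: \<gamma>_def norm_mult norm_power power_mult_distrib mult.commute flip: power_mult)
      also have "ennreal (defect w powr (2 * c - 3)) * ennreal (\<Sum>n<N. (cmod (\<beta> n))\<^sup>2 * (cmod w ^ 2) ^ n) =
          ennreal (\<Sum>n<N. (cmod (\<beta> n))\<^sup>2 * (defect w powr (2 * c - 2 - 1) * (cmod w ^ 2) ^ n))"
        by (subst ennreal_mult[symmetric]) (auto simp: sum_distrib_left mult_ac intro!: sum_nonneg)
      also have "\<dots> = (\<Sum>n<N. ennreal ((cmod (\<beta> n))\<^sup>2) * ennreal (defect w powr (2 * c - 2 - 1) * (cmod w ^ 2) ^ n))"
        by (subst sum_ennreal[symmetric]) (auto simp: ennreal_mult)
      finally show "(\<integral>\<^sup>+\<zeta>. ennreal (defect (\<zeta> * w) powr (2 * c - 3) * (cmod (P N (\<zeta> * w)))\<^sup>2) \<partial>circle_measure) =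
        (\<Sum>n<N. ennreal ((cmod (\<beta> n))\<^sup>2) * ennreal (defect w powr (2 * c - 2 - 1) * (cmod w ^ 2) ^ n))" .
    qed
    also have "\<dots> = (\<Sum>n<N. ennreal ((cmod (\<beta> n))\<^sup>2) * (\<integral>\<^sup>+w. ennreal (defect w powr (2 * c - 2 - 1) * (cmod w ^ 2) ^ n) \<partial>disc_borel))"
      by (subst nn_integral_sum) (auto simp: nn_integral_cmult)
    also have "\<dots> \<le> (\<Sum>n<N. ennreal ((cmod (\<beta> n))\<^sup>2) * ennreal (Beta (2 * c - 2) (real n + 1)))"
      using c by (intro sum_mono mult_left_mono nn_integral_disc_Beta_le) auto
    also have "\<dots> \<le> (\<Sum>n<N. ennreal (B * (cmod (hh n))\<^sup>2))"
    proof (rule sum_mono)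
      fix n
      have "0 \<le> Beta (2 * c - 2) (real n + 1)"
        using c by (auto simp: Beta_def intro!: divide_nonneg_nonneg mult_nonneg_nonneg Gamma_real_nonneg less_imp_le[OF Gamma_real_pos])
      have "(cmod (\<beta> n))\<^sup>2 * Beta (2 * c - 2) (real n + 1) =
          ((kernel_coeff c n)\<^sup>2 * Beta (2 * c - 2) (real n + 1)) * ((cmod z ^ n)\<^sup>2 * (cmod (hh n))\<^sup>2)"
        by (simp add: \<beta>_def norm_mult norm_power power_mult_distrib)
      also have "\<dots> \<le> B * (1 * (cmod (hh n))\<^sup>2)"
        unfolding B_def using z
        by (intro mult_mono kernel_coeff_Beta_le c mult_right_mono power_le_one)
           (auto simp: c less_imp_le[OF B[unfolded B_def]])
      finally show "ennreal ((cmod (\<beta> n))\<^sup>2) * ennreal (Beta (2 * c - 2) (real n + 1)) \<le> ennreal (B * (cmod (hh n))\<^sup>2)"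
        using \<open>0 \<le> Beta _ _\<close> by (simp add: ennreal_leI flip: ennreal_mult)
    qed
    also have "\<dots> = ennreal (B * (\<Sum>n<N. (cmod (hh n))\<^sup>2))"
      using B by (subst sum_ennreal) (auto simp: sum_distrib_left)
    also have "\<dots> \<le> ennreal (B * (\<integral>\<zeta>. (cmod (h \<zeta>))\<^sup>2 \<partial>circle_measure))"
      unfolding hh_def using B by (intro ennreal_leI mult_left_mono circle_bessel[where H = H] H) auto
    finally show ?thesis .
  qed
  have "(\<integral>\<^sup>+w. ennreal (defect w powr (2 * c - 3) * (cmod (circle_transform c z h w))\<^sup>2) \<partial>disc_borel) =
      (\<integral>\<^sup>+w. liminf (\<lambda>N. ennreal (defect w powr (2 * c - 3) * (cmod (P N w))\<^sup>2)) \<partial>disc_borel)"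
  proof (intro nn_integral_cong_AE eventually_mono[OF AE_disc_borel_cmod])
    fix w assume "cmod w < 1"
    from lim[OF this] have "(\<lambda>N. ennreal (defect w powr (2 * c - 3) * (cmod (P N w))\<^sup>2)) \<longlonglongrightarrow>
        ennreal (defect w powr (2 * c - 3) * (cmod (circle_transform c z h w))\<^sup>2)"
      by (intro tendsto_ennrealI tendsto_mult tendsto_const tendsto_power tendsto_norm)
    then show "ennreal (defect w powr (2 * c - 3) * (cmod (circle_transform c z h w))\<^sup>2) =
        liminf (\<lambda>N. ennreal (defect w powr (2 * c - 3) * (cmod (P N w))\<^sup>2))"
      by (intro lim_imp_Liminf[symmetric]) auto
  qed
  \<comment> \<open>Parseval was applied to the partial sums \<open>P N\<close>, with a bound
    independent of N; Fatou's lemma passes to the limit.\<close>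
  also have "\<dots> \<le> liminf (\<lambda>N. \<integral>\<^sup>+w. ennreal (defect w powr (2 * c - 3) * (cmod (P N w))\<^sup>2) \<partial>disc_borel)"
    by (rule nn_integral_liminf) measurable
  also have "\<dots> \<le> liminf (\<lambda>N::nat. ennreal (B * (\<integral>\<zeta>. (cmod (h \<zeta>))\<^sup>2 \<partial>circle_measure)))"
    by (intro Liminf_mono always_eventually allI fin)
  also have "\<dots> = ennreal (B * (\<integral>\<zeta>. (cmod (h \<zeta>))\<^sup>2 \<partial>circle_measure))"
    by (simp add: Liminf_const)
  also have "\<dots> = ennreal B * (\<integral>\<^sup>+\<zeta>. ennreal ((cmod (h \<zeta>))\<^sup>2) \<partial>circle_measure)"
  proof -
    have "integrable circle_measure (\<lambda>\<zeta>. (cmod (h \<zeta>))\<^sup>2)"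
      by (rule circle_integrable_bounded[where B = "H\<^sup>2"]) (auto intro!: power_mono H)
    then show ?thesis
      using B by (subst nn_integral_eq_integral) (auto simp: ennreal_mult)
  qed
  finally show ?thesis by (simp add: B_def)
qed

text \<open>The supremum of h times the circle average of the kernel with b = 0. So u^(c - 1) times
  the transform is bounded, which is the other end of the interpolation.\<close>

lemma circle_transform_Linfty:
  assumes c: "1 < c" and z: "cmod z < 1" and w: "cmod w < 1" and [measurable]: "h \<in> borel_measurable borel"
    and H: "\<And>\<zeta>. cmod \<zeta> = 1 \<Longrightarrow> cmod (h \<zeta>) \<le> H"
  shows "cmod (circle_transform c z h w) \<le> H * (kernel_const c * defect w powr (1 - c))"
proof -
  have H0: "0 \<le> H" using order_trans[OF norm_ge_zero H[of 1]] by simp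
  note kc = kernel_const_pos[OF c]
  let ?f = "\<lambda>\<zeta>. h \<zeta> / (1 - \<zeta> * (z * cnj w)) powr of_real c"
  have "ennreal (cmod (circle_transform c z h w)) \<le> (\<integral>\<^sup>+\<zeta>. ennreal (cmod (?f \<zeta>)) \<partial>circle_measure)"
  proof (cases "integrable circle_measure ?f")
    case True
    then show ?thesis unfolding circle_transform_def by (rule integral_norm_bound_ennreal)
  qed (simp add: circle_transform_def not_integrable_integral_eq)
  also have "\<dots> \<le> (\<integral>\<^sup>+\<zeta>. ennreal H * ennreal (disc_kernel 0 c (\<zeta> * z) w) \<partial>circle_measure)"
  proof (intro nn_integral_mono_AE eventually_mono[OF AE_circle_measure])
    fix \<zeta> :: complex assume \<zeta>: "cmod \<zeta> = 1"
    have "cmod (?f \<zeta>) = cmod (h \<zeta>) * disc_kernel 0 c (\<zeta> * z) w"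
      using defect_pos[OF w]
      by (simp add: disc_kernel_def norm_divide norm_powr_real_powr' powr_minus_divide mult.assoc)
    also have "\<dots> \<le> H * disc_kernel 0 c (\<zeta> * z) w"
      by (intro mult_right_mono H \<zeta> disc_kernel_nonneg)
    finally show "ennreal (cmod (?f \<zeta>)) \<le> ennreal H * ennreal (disc_kernel 0 c (\<zeta> * z) w)"
      using H0 by (simp add: ennreal_leI disc_kernel_nonneg flip: ennreal_mult)
  qed
  also have "\<dots> = ennreal H * (\<integral>\<^sup>+\<zeta>. ennreal (disc_kernel 0 c (\<zeta> * z) w) \<partial>circle_measure)"
    by (rule nn_integral_cmult) measurable
  also have "\<dots> \<le> ennreal H * ennreal (kernel_const c * radial_weight 0 c (defect z) (defect w))"
    by (intro mult_left_mono circle_disc_kernel_le c z w) simp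
  also have "\<dots> \<le> ennreal H * ennreal (kernel_const c * defect w powr (0 + 1 - c))"
    using kc by (intro mult_left_mono ennreal_leI radial_weight_le_powr(1) c defect_pos z w) auto
  also have "\<dots> = ennreal (H * (kernel_const c * defect w powr (1 - c)))"
    using H0 kc by (simp flip: ennreal_mult)
  finally show ?thesis using H0 kc by (simp add: ennreal_le_iff)
qed

text \<open>The bounds on both functions give the integrability without which the Bochner integral
  need not be additive.\<close>

lemma circle_transform_add:
  assumes c: "0 < c" and z: "cmod z < 1" and w: "cmod w < 1"
    and [measurable]: "h \<in> borel_measurable borel" "k \<in> borel_measurable borel"
    and H: "\<And>\<zeta>. cmod \<zeta> = 1 \<Longrightarrow> cmod (h \<zeta>) \<le> H" "\<And>\<zeta>. cmod \<zeta> = 1 \<Longrightarrow> cmod (k \<zeta>) \<le> K"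
  shows "circle_transform c z (\<lambda>\<zeta>. h \<zeta> + k \<zeta>) w = circle_transform c z h w + circle_transform c z k w"
proof -
  have zw: "cmod (z * cnj w) < 1" by (rule cmod_mult_cnj_less_1[OF z w])
  have int: "integrable circle_measure (\<lambda>\<zeta>. h \<zeta> / (1 - \<zeta> * (z * cnj w)) powr of_real c)"
    if [measurable]: "h \<in> borel_measurable borel" and H: "\<And>\<zeta>. cmod \<zeta> = 1 \<Longrightarrow> cmod (h \<zeta>) \<le> H" for h H
  proof (rule circle_integrable_bounded[where B = "H * (1 - cmod (z * cnj w)) powr (-c)"])
    fix \<zeta> :: complex assume \<zeta>: "cmod \<zeta> = 1"
    have "1 - cmod (z * cnj w) \<le> cmod (1 - \<zeta> * (z * cnj w))"
      using norm_triangle_ineq2[of 1 "\<zeta> * (z * cnj w)"] \<zeta> by (simp add: norm_mult)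
    then have "cmod (1 - \<zeta> * (z * cnj w)) powr (-c) \<le> (1 - cmod (z * cnj w)) powr (-c)"
      using zw c by (intro powr_mono2') auto
    then have "cmod (h \<zeta>) * cmod (1 - \<zeta> * (z * cnj w)) powr (-c) \<le> H * (1 - cmod (z * cnj w)) powr (-c)"
      using order_trans[OF norm_ge_zero H[OF \<zeta>]] by (intro mult_mono H \<zeta>) auto
    then show "norm (h \<zeta> / (1 - \<zeta> * (z * cnj w)) powr of_real c) \<le> H * (1 - cmod (z * cnj w)) powr (-c)"
      by (simp add: norm_divide norm_powr_real_powr' powr_minus_divide)
  qed measurable
  show ?thesis
    unfolding circle_transform_def add_divide_distrib
    by (intro Bochner_Integration.integral_add int) (auto intro: H)
qed

lemma nn_integral_powr_layer:
  fixes V s :: real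
  assumes "0 < s" "0 \<le> V"
  shows "(\<integral>\<^sup>+l. ennreal (s * l powr (s - 1)) * indicator {0<..<V} l \<partial>lborel) = ennreal (V powr s)"
proof -
  have "((\<lambda>l. s * l powr (s - 1)) has_integral s * (V powr (s - 1 + 1) / (s - 1 + 1))) {0..V}"
    using assms by (intro has_integral_mult_right has_integral_powr_from_0) auto
  then have "((\<lambda>l. s * l powr (s - 1)) has_integral V powr s) {0<..<V}"
    using assms by (simp add: has_integral_Icc_iff_Ioo)
  from nn_integral_has_integral_lebesgue[OF _ this] show ?thesis
    using assms by (simp add: ennreal_mult' ennreal_indicator mult.commute mult.left_commute)
qed

text \<open>Marcinkiewicz interpolation between the two preceding bounds, for the measure with density
  \<open>1 / defect\<close> and the function \<open>defect powr (c - 1) * circle_transform\<close>.\<close>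

lemma circle_transform_Ls:
  assumes c: "1 < c" and s: "2 \<le> s"
  shows "\<exists>C\<ge>0. \<forall>z h H. cmod z < 1 \<longrightarrow> h \<in> borel_measurable borel \<longrightarrow> (\<forall>\<zeta>. cmod \<zeta> = 1 \<longrightarrow> cmod (h \<zeta>) \<le> H) \<longrightarrow>
    (\<integral>\<^sup>+w. ennreal (defect w powr ((c - 1) * s - 1) * cmod (circle_transform c z h w) powr s) \<partial>disc_borel) \<le>
    ennreal C * (\<integral>\<^sup>+\<zeta>. ennreal (cmod (h \<zeta>) powr s) \<partial>circle_measure)"
proof -
  define B where "B = Gamma (2 * c - 2) / (Gamma c)\<^sup>2"
  have B: "0 < B" using c by (auto simp: B_def intro!: divide_pos_pos Gamma_real_pos zero_less_power)
  define kc where "kc = kernel_const c"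
  have kc: "0 < kc" using kernel_const_pos[OF c] by (simp add: kc_def)
  show ?thesis
  \<comment> \<open>The layer integral of l^(s - 3) converges at 0 only for s > 2; for s = 2 the
    claim is the L^2 bound itself.\<close>
  proof (cases "s = 2")
    case True
    have powr2: "cmod x powr 2 = (cmod x)\<^sup>2" for x by (cases "x = 0") (simp_all add: powr_numeral)
    have exp2: "(c - 1) * 2 - 1 = 2 * c - 3" by simp
    show ?thesis
      using True B circle_transform_L2[OF c]
      by (intro exI[of _ B]) (auto simp: B_def powr2 exp2 simp del: left_diff_distrib_numeral)
  next
    case False
    then have s2: "2 < s" using s by simp
    define C where "C = 4 * B * s * ((2 * kc) powr (s - 2) / (s - 2))"
    have C: "0 \<le> C" using B s2 by (simp add: C_def)
    show ?thesis
    proof (intro exI[of _ C] conjI C allI impI)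
      fix z h H assume z: "cmod z < 1" and [measurable]: "h \<in> borel_measurable borel"
        and H': "\<forall>\<zeta>. cmod \<zeta> = 1 \<longrightarrow> cmod (h \<zeta>) \<le> H"
      have H: "\<And>\<zeta>. cmod \<zeta> = 1 \<Longrightarrow> cmod (h \<zeta>) \<le> H" using H' by blast
      define V where "V w = defect w powr (c - 1) * cmod (circle_transform c z h w)" for w
      have V0: "0 \<le> V w" for w by (simp add: V_def)
      have [measurable]: "V \<in> borel_measurable borel" unfolding V_def by measurable
      have level: "(\<integral>\<^sup>+w. ennreal (1 / defect w) * indicator {w. l < V w} w \<partial>disc_borel) \<le>
          ennreal (4 * B / l\<^sup>2) * (\<integral>\<^sup>+\<zeta>. ennreal ((cmod (h \<zeta>))\<^sup>2) * indicator {..<2 * kc * cmod (h \<zeta>)} l \<partial>circle_measure)"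
        if l: "0 < l" for l
      proof -
        \<comment> \<open>The cut at |h| = l / (2 kc) moves with the level: by the sup bound the
          small part \<open>h2\<close> contributes at most l / 2 to \<open>V\<close>, so the large
          part must produce the other half, and the L^2 bound applies to it.\<close>
        define h1 where "h1 \<zeta> = (if l < 2 * kc * cmod (h \<zeta>) then h \<zeta> else 0)" for \<zeta>
        define h2 where "h2 \<zeta> = (if l < 2 * kc * cmod (h \<zeta>) then 0 else h \<zeta>)" for \<zeta>
        have [measurable]: "h1 \<in> borel_measurable borel" unfolding h1_def by measurable
        have [measurable]: "h2 \<in> borel_measurable borel" unfolding h2_def by measurable
        have H0: "0 \<le> H" using order_trans[OF norm_ge_zero H[of 1]] by simp
        have h1: "cmod (h1 \<zeta>) \<le> H" if "cmod \<zeta> = 1" for \<zeta> using H[OF that] H0 by (simp add: h1_def)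
        have h2: "cmod (h2 \<zeta>) \<le> l / (2 * kc)" for \<zeta>
          using l kc by (auto simp: h2_def field_simps not_less)
        have h12: "(\<lambda>\<zeta>. h1 \<zeta> + h2 \<zeta>) = h" by (auto simp: h1_def h2_def)
        have "(\<integral>\<^sup>+w. ennreal (1 / defect w) * indicator {w. l < V w} w \<partial>disc_borel) \<le>
            (\<integral>\<^sup>+w. ennreal (4 / l\<^sup>2) * ennreal (defect w powr (2 * c - 3) * (cmod (circle_transform c z h1 w))\<^sup>2) \<partial>disc_borel)"
        proof (intro nn_integral_mono_AE eventually_mono[OF AE_disc_borel_cmod])
          fix w assume w: "cmod w < 1"
          note u = defect_pos[OF w]
          show "ennreal (1 / defect w) * indicator {w. l < V w} w \<le>
            ennreal (4 / l\<^sup>2) * ennreal (defect w powr (2 * c - 3) * (cmod (circle_transform c z h1 w))\<^sup>2)"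
          proof (cases "l < V w")
            case True
            have "circle_transform c z h w = circle_transform c z h1 w + circle_transform c z h2 w"
              using circle_transform_add[OF _ z w, of c h1 h2 H "l / (2 * kc)"] c h1 h2 unfolding h12 by auto
            then have "V w \<le> defect w powr (c - 1) * (cmod (circle_transform c z h1 w) + cmod (circle_transform c z h2 w))"
              unfolding V_def by (intro mult_left_mono) (auto simp: norm_triangle_ineq)
            also have "\<dots> \<le> defect w powr (c - 1) * (cmod (circle_transform c z h1 w) + l / (2 * kc) * (kc * defect w powr (1 - c)))"
              unfolding kc_def
              by (intro mult_left_mono add_left_mono circle_transform_Linfty c z w) (auto intro: h2[unfolded kc_def])
            also have "\<dots> = defect w powr (c - 1) * cmod (circle_transform c z h1 w) + l / 2"
            proof -
              have "defect w powr (c - 1) * defect w powr (1 - c) = 1" using u by (simp flip: powr_add)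
              then show ?thesis using kc by (simp add: distrib_left mult_ac)
            qed
            finally have "l / 2 \<le> defect w powr (c - 1) * cmod (circle_transform c z h1 w)" using True by simp
            \<comment> \<open>Chebyshev's inequality for the measure with density 1/u: the square of
              u^(c - 1) is u times the weight u^(2 c - 3) of the L^2 bound.\<close>
            then have "(l / 2)\<^sup>2 \<le> (defect w powr (c - 1) * cmod (circle_transform c z h1 w))\<^sup>2"
              using l by (intro power_mono) auto
            also have "\<dots> = defect w * (defect w powr (2 * c - 3) * (cmod (circle_transform c z h1 w))\<^sup>2)"
            proof -
              have "(defect w powr (c - 1))\<^sup>2 = defect w powr 1 * defect w powr (2 * c - 3)"
                by (simp only: power2_eq_square powr_add[symmetric]) (simp add: algebra_simps)
              then show ?thesis using u by (simp add: power_mult_distrib)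
            qed
            finally have "1 / defect w \<le> 4 / l\<^sup>2 * (defect w powr (2 * c - 3) * (cmod (circle_transform c z h1 w))\<^sup>2)"
              using u l by (simp add: field_simps power2_eq_square)
            then show ?thesis using True l by (simp add: ennreal_leI flip: ennreal_mult)
          qed simp
        qed
        also have "\<dots> = ennreal (4 / l\<^sup>2) * (\<integral>\<^sup>+w. ennreal (defect w powr (2 * c - 3) * (cmod (circle_transform c z h1 w))\<^sup>2) \<partial>disc_borel)"
          by (rule nn_integral_cmult) measurable
        also have "\<dots> \<le> ennreal (4 / l\<^sup>2) * (ennreal B * (\<integral>\<^sup>+\<zeta>. ennreal ((cmod (h1 \<zeta>))\<^sup>2) \<partial>circle_measure))"
          unfolding B_def by (intro mult_left_mono circle_transform_L2[OF c z, where H = H] h1) auto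
        also have "\<dots> = ennreal (4 * B / l\<^sup>2) * (\<integral>\<^sup>+\<zeta>. ennreal ((cmod (h1 \<zeta>))\<^sup>2) \<partial>circle_measure)"
          using B by (simp add: mult.assoc[symmetric] flip: ennreal_mult)
        also have "(\<integral>\<^sup>+\<zeta>. ennreal ((cmod (h1 \<zeta>))\<^sup>2) \<partial>circle_measure) =
            (\<integral>\<^sup>+\<zeta>. ennreal ((cmod (h \<zeta>))\<^sup>2) * indicator {..<2 * kc * cmod (h \<zeta>)} l \<partial>circle_measure)"
          by (intro nn_integral_cong) (auto simp: h1_def indicator_def)
        finally show ?thesis .
      qed
      interpret P: pair_sigma_finite disc_borel lborel ..
      interpret Q: pair_sigma_finite circle_measure lborel ..
      have "(\<integral>\<^sup>+w. ennreal (defect w powr ((c - 1) * s - 1) * cmod (circle_transform c z h w) powr s) \<partial>disc_borel) =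
          (\<integral>\<^sup>+w. \<integral>\<^sup>+l. ennreal (1 / defect w) * (ennreal (s * l powr (s - 1)) * (if 0 < l \<and> l < V w then 1 else 0)) \<partial>lborel \<partial>disc_borel)"
      proof (intro nn_integral_cong_AE eventually_mono[OF AE_disc_borel])
        fix w assume w: "0 < defect w \<and> defect w < 1 \<and> cmod w < 1 \<and> w \<noteq> 0"
        have "(\<integral>\<^sup>+l. ennreal (1 / defect w) * (ennreal (s * l powr (s - 1)) * (if 0 < l \<and> l < V w then 1 else 0)) \<partial>lborel) =
            (\<integral>\<^sup>+l. ennreal (1 / defect w) * (ennreal (s * l powr (s - 1)) * indicator {0<..<V w} l) \<partial>lborel)"
          by (intro nn_integral_cong) (auto simp: indicator_def)
        also have "\<dots> = ennreal (1 / defect w) * ennreal (V w powr s)"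
          using s2 V0[of w] by (subst nn_integral_cmult) (auto simp: nn_integral_powr_layer)
        also have "\<dots> = ennreal (1 / defect w * V w powr s)"
          using w by (subst ennreal_mult) auto
        also have "1 / defect w * V w powr s = defect w powr ((c - 1) * s - 1) * cmod (circle_transform c z h w) powr s"
        proof -
          have "V w powr s = defect w powr ((c - 1) * s) * cmod (circle_transform c z h w) powr s"
            unfolding V_def by (subst powr_mult) (simp_all add: powr_powr)
          moreover have "defect w powr ((c - 1) * s - 1) = defect w powr ((c - 1) * s) / defect w"
            using w powr_diff[of "defect w" "(c - 1) * s" 1] by simp
          ultimately show ?thesis by (simp only: times_divide_eq_left times_divide_eq_right mult_1)
        qed
        finally show "ennreal (defect w powr ((c - 1) * s - 1) * cmod (circle_transform c z h w) powr s) =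
          (\<integral>\<^sup>+l. ennreal (1 / defect w) * (ennreal (s * l powr (s - 1)) * (if 0 < l \<and> l < V w then 1 else 0)) \<partial>lborel)" by simp
      qed
      also have "\<dots> = (\<integral>\<^sup>+l. \<integral>\<^sup>+w. ennreal (1 / defect w) * (ennreal (s * l powr (s - 1)) * (if 0 < l \<and> l < V w then 1 else 0)) \<partial>disc_borel \<partial>lborel)"
        by (rule P.Fubini'[symmetric]) measurable
      \<comment> \<open>Integrating the level bound against s l^(s - 1) leaves l^(s - 3) on 0 < l <
        2 kc |h|. Its integral is a multiple of |h|^(s - 2), and together with |h|^2 this is
        |h|^s.\<close>
      also have "\<dots> \<le> (\<integral>\<^sup>+l. \<integral>\<^sup>+\<zeta>. ennreal (4 * B * s) * (ennreal ((cmod (h \<zeta>))\<^sup>2) * (ennreal (l powr (s - 3)) * (if 0 < l \<and> l < 2 * kc * cmod (h \<zeta>) then 1 else 0))) \<partial>circle_measure \<partial>lborel)"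
      proof (rule nn_integral_mono)
        fix l :: real
        show "(\<integral>\<^sup>+w. ennreal (1 / defect w) * (ennreal (s * l powr (s - 1)) * (if 0 < l \<and> l < V w then 1 else 0)) \<partial>disc_borel) \<le>
          (\<integral>\<^sup>+\<zeta>. ennreal (4 * B * s) * (ennreal ((cmod (h \<zeta>))\<^sup>2) * (ennreal (l powr (s - 3)) * (if 0 < l \<and> l < 2 * kc * cmod (h \<zeta>) then 1 else 0))) \<partial>circle_measure)"
        proof (cases "0 < l")
          case True
          have "(\<integral>\<^sup>+w. ennreal (1 / defect w) * (ennreal (s * l powr (s - 1)) * (if 0 < l \<and> l < V w then 1 else 0)) \<partial>disc_borel) =
              (\<integral>\<^sup>+w. ennreal (s * l powr (s - 1)) * (ennreal (1 / defect w) * indicator {w. l < V w} w) \<partial>disc_borel)"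
            using True by (intro nn_integral_cong) (auto simp: indicator_def mult_ac)
          also have "\<dots> = ennreal (s * l powr (s - 1)) * (\<integral>\<^sup>+w. ennreal (1 / defect w) * indicator {w. l < V w} w \<partial>disc_borel)"
            by (rule nn_integral_cmult) measurable
          also have "\<dots> \<le> ennreal (s * l powr (s - 1)) * (ennreal (4 * B / l\<^sup>2) * (\<integral>\<^sup>+\<zeta>. ennreal ((cmod (h \<zeta>))\<^sup>2) * indicator {..<2 * kc * cmod (h \<zeta>)} l \<partial>circle_measure))"
            by (intro mult_left_mono level True) simp
          also have "\<dots> = ennreal (4 * B * s * l powr (s - 3)) * (\<integral>\<^sup>+\<zeta>. ennreal ((cmod (h \<zeta>))\<^sup>2) * indicator {..<2 * kc * cmod (h \<zeta>)} l \<partial>circle_measure)"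
          proof -
            have "l powr (s - 1) = l powr (s - 3) * l powr 2" by (subst powr_add[symmetric]) simp
            then have "s * l powr (s - 1) * (4 * B / l\<^sup>2) = 4 * B * s * l powr (s - 3)"
              using True by (simp add: powr_numeral)
            then show ?thesis using B s2 by (simp add: mult.assoc[symmetric] flip: ennreal_mult)
          qed
          also have "\<dots> = (\<integral>\<^sup>+\<zeta>. ennreal (4 * B * s * l powr (s - 3)) * (ennreal ((cmod (h \<zeta>))\<^sup>2) * indicator {..<2 * kc * cmod (h \<zeta>)} l) \<partial>circle_measure)"
          proof (rule nn_integral_cmult[symmetric])
            have "(\<lambda>\<zeta>. ennreal ((cmod (h \<zeta>))\<^sup>2) * (if l < 2 * kc * cmod (h \<zeta>) then 1 else 0)) \<in> borel_measurable circle_measure"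
              by measurable
            then show "(\<lambda>\<zeta>. ennreal ((cmod (h \<zeta>))\<^sup>2) * indicator {..<2 * kc * cmod (h \<zeta>)} l) \<in> borel_measurable circle_measure"
              by (simp add: indicator_def of_bool_def)
          qed
          also have "\<dots> = (\<integral>\<^sup>+\<zeta>. ennreal (4 * B * s) * (ennreal ((cmod (h \<zeta>))\<^sup>2) * (ennreal (l powr (s - 3)) * (if 0 < l \<and> l < 2 * kc * cmod (h \<zeta>) then 1 else 0))) \<partial>circle_measure)"
            using True B s2 by (intro nn_integral_cong) (auto simp: indicator_def mult_ac simp flip: ennreal_mult)
          finally show ?thesis .
        qed simp
      qed
      also have "\<dots> = (\<integral>\<^sup>+\<zeta>. \<integral>\<^sup>+l. ennreal (4 * B * s) * (ennreal ((cmod (h \<zeta>))\<^sup>2) * (ennreal (l powr (s - 3)) * (if 0 < l \<and> l < 2 * kc * cmod (h \<zeta>) then 1 else 0))) \<partial>lborel \<partial>circle_measure)"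
        by (rule Q.Fubini') measurable
      also have "\<dots> \<le> (\<integral>\<^sup>+\<zeta>. ennreal C * ennreal (cmod (h \<zeta>) powr s) \<partial>circle_measure)"
      proof (rule nn_integral_mono)
        fix \<zeta>
        have "(\<integral>\<^sup>+l. ennreal (4 * B * s) * (ennreal ((cmod (h \<zeta>))\<^sup>2) * (ennreal (l powr (s - 3)) * (if 0 < l \<and> l < 2 * kc * cmod (h \<zeta>) then 1 else 0))) \<partial>lborel) =
            (\<integral>\<^sup>+l. ennreal (4 * B * s * (cmod (h \<zeta>))\<^sup>2) * (ennreal (l powr (s - 3)) * indicator {0<..<2 * kc * cmod (h \<zeta>)} l) \<partial>lborel)"
          using B s2 by (intro nn_integral_cong) (auto simp: indicator_def mult.assoc[symmetric] simp flip: ennreal_mult)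
        also have "\<dots> = ennreal (4 * B * s * (cmod (h \<zeta>))\<^sup>2) * (\<integral>\<^sup>+l\<in>{0<..<2 * kc * cmod (h \<zeta>)}. ennreal (l powr (s - 3)) \<partial>lborel)"
          by (rule nn_integral_cmult) measurable
        also have "\<dots> \<le> ennreal (4 * B * s * (cmod (h \<zeta>))\<^sup>2) * ennreal ((2 * kc * cmod (h \<zeta>)) powr (s - 3 + 1) / (s - 3 + 1))"
          using s2 kc by (intro mult_left_mono nn_integral_powr_from_0) auto
        also have "\<dots> = ennreal (4 * B * s * (cmod (h \<zeta>))\<^sup>2 * ((2 * kc * cmod (h \<zeta>)) powr (s - 2) / (s - 2)))"
          using B s2 by (simp flip: ennreal_mult)
        also have "4 * B * s * (cmod (h \<zeta>))\<^sup>2 * ((2 * kc * cmod (h \<zeta>)) powr (s - 2) / (s - 2)) = C * cmod (h \<zeta>) powr s"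
        proof (cases "h \<zeta> = 0")
          case False
          have "cmod (h \<zeta>) powr s = cmod (h \<zeta>) powr 2 * cmod (h \<zeta>) powr (s - 2)"
            by (subst powr_add[symmetric]) simp
          then show ?thesis
            using False kc by (simp add: C_def powr_mult powr_numeral)
        qed (use s2 in simp)
        finally show "(\<integral>\<^sup>+l. ennreal (4 * B * s) * (ennreal ((cmod (h \<zeta>))\<^sup>2) * (ennreal (l powr (s - 3)) * (if 0 < l \<and> l < 2 * kc * cmod (h \<zeta>) then 1 else 0))) \<partial>lborel) \<le>
          ennreal C * ennreal (cmod (h \<zeta>) powr s)"
          using C by (simp add: ennreal_mult)
      qed
      also have "\<dots> = ennreal C * (\<integral>\<^sup>+\<zeta>. ennreal (cmod (h \<zeta>) powr s) \<partial>circle_measure)"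
        by (rule nn_integral_cmult) measurable
      finally show "(\<integral>\<^sup>+w. ennreal (defect w powr ((c - 1) * s - 1) * cmod (circle_transform c z h w) powr s) \<partial>disc_borel) \<le>
        ennreal C * (\<integral>\<^sup>+\<zeta>. ennreal (cmod (h \<zeta>) powr s) \<partial>circle_measure)" .
    qed
  qed
qed

text \<open>Young's inequality without the weights 1/p and 1 - 1/p: comparing y with x^(p - 1)
  bounds the product by one of the two terms alone.\<close>

lemma young_product:
  fixes x y p :: real
  assumes "0 \<le> x" "0 \<le> y" "1 < p"
  shows "x * y \<le> x powr p + y powr (p / (p - 1))"
proof (cases "y \<le> x powr (p - 1)")
  case True
  then have "x * y \<le> x * x powr (p - 1)" using assms by (intro mult_left_mono) auto
  also have "\<dots> = x powr p" using assms powr_add[of x 1 "p - 1"] by simp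
  finally show ?thesis by (simp add: add_increasing2)
next
  case False
  then have "(x powr (p - 1)) powr (1 / (p - 1)) \<le> y powr (1 / (p - 1))"
    using assms by (intro powr_mono2) auto
  then have "x \<le> y powr (1 / (p - 1))" using assms by (simp add: powr_powr)
  then have "x * y \<le> y powr (1 / (p - 1)) * y" using assms by (intro mult_right_mono) auto
  also have "\<dots> = y powr (p / (p - 1))"
  proof -
    have "p / (p - 1) = 1 / (p - 1) + 1" using assms by (simp add: field_simps)
    then show ?thesis using assms by (simp add: powr_add)
  qed
  finally show ?thesis by (simp add: add_increasing)
qed

lemma pos_op_0: "pos_op b c F 0 = (\<integral>\<^sup>+w. ennreal (defect w powr b) * F w \<partial>disc_borel)"
  by (simp add: pos_op_def disc_kernel_def)

text \<open>Circle means of the holomorphic function \<open>\<integral>w. T_kernel b c z w * f w\<close>, by duality with the bound for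
  \<open>circle_transform\<close>; the exponent relation says that the mean of order \<open>p\<close> stays bounded up to the circle.\<close>

lemma T_circle_mean_le:
  assumes c: "1 < c" and p: "1 < p" "p \<le> 2" and exp: "(b + 1 - c) * (p / (p - 1)) = -1"
  shows "\<exists>K\<ge>0. \<forall>z f X. cmod z < 1 \<longrightarrow> f \<in> borel_measurable borel \<longrightarrow> 0 \<le> X \<longrightarrow>
    pos_op b c (\<lambda>w. ennreal (cmod (f w))) 0 < \<infinity> \<longrightarrow> (\<integral>\<^sup>+w. ennreal (cmod (f w) powr p) \<partial>disc_borel) \<le> ennreal X \<longrightarrow>
    (\<integral>\<^sup>+\<zeta>. ennreal (cmod (\<integral>w. T_kernel b c (\<zeta> * z) w * f w \<partial>disc_borel) powr p) \<partial>circle_measure) \<le> ennreal (K * X)"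
proof -
  define s where "s = p / (p - 1)"
  have s: "2 \<le> s" using p by (simp add: s_def field_simps)
  have ps: "(p - 1) * s = p" using p by (simp add: s_def)
  \<comment> \<open>The exponent relation turns the weight u^(b s) of the duality pairing into the
    weight of \<open>circle_transform_Ls\<close>.\<close>
  have bs: "b * s = (c - 1) * s - 1" using exp by (simp add: s_def[symmetric] algebra_simps)
  obtain C where C: "0 \<le> C" and Ls: "\<And>z h H. cmod z < 1 \<Longrightarrow> h \<in> borel_measurable borel \<Longrightarrow> (\<And>\<zeta>. cmod \<zeta> = 1 \<Longrightarrow> cmod (h \<zeta>) \<le> H) \<Longrightarrow>
    (\<integral>\<^sup>+w. ennreal (defect w powr ((c - 1) * s - 1) * cmod (circle_transform c z h w) powr s) \<partial>disc_borel) \<le>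
    ennreal C * (\<integral>\<^sup>+\<zeta>. ennreal (cmod (h \<zeta>) powr s) \<partial>circle_measure)"
    using circle_transform_Ls[OF c s] by blast
  \<comment> \<open>Small enough for the term that contains the unknown mean \<open>Y\<close> to be
    absorbed with factor 1/2.\<close>
  define \<epsilon> where "\<epsilon> = (1 / (2 * C + 2)) powr (1 / s)"
  have \<epsilon>: "0 < \<epsilon>" "\<epsilon> powr s * C \<le> 1 / 2"
    using C s by (auto simp: \<epsilon>_def powr_powr field_simps)
  define K where "K = 2 * \<epsilon> powr (-p)"
  show ?thesis
  proof (intro exI[of _ K] conjI allI impI)
    show "0 \<le> K" by (simp add: K_def)
    fix z f X assume z: "cmod z < 1" and [measurable]: "f \<in> borel_measurable borel" and X: "0 \<le> X"
      and fin: "pos_op b c (\<lambda>w. ennreal (cmod (f w))) 0 < \<infinity>"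
      and fX: "(\<integral>\<^sup>+w. ennreal (cmod (f w) powr p) \<partial>disc_borel) \<le> ennreal X"
    \<comment> \<open>This leads to a bound for \<open>G\<close> that degenerates as |z| tends to 1.
      It only guarantees that the mean \<open>Y\<close> is finite and the dual function bounded, and
      does not enter the constant \<open>K\<close>.\<close>
    define M0 where "M0 = enn2real (pos_op b c (\<lambda>w. ennreal (cmod (f w))) 0)"
    have M0: "pos_op b c (\<lambda>w. ennreal (cmod (f w))) 0 = ennreal M0" "0 \<le> M0"
      using fin by (auto simp: M0_def ennreal_enn2real less_top)
    define M where "M = (1 - cmod z) powr (-c) * M0"
    have M: "0 \<le> M" using M0 by (simp add: M_def)
    define G where "G \<zeta> = (\<integral>w. T_kernel b c (\<zeta> * z) w * f w \<partial>disc_borel)" for \<zeta>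
    have [measurable]: "G \<in> borel_measurable borel"
    proof -
      have "(\<lambda>\<zeta>. \<integral>w. T_kernel b c (\<zeta> * z) w * f w \<partial>disc_borel) \<in> borel_measurable borel"
        by (rule disc_borel.borel_measurable_lebesgue_integral) measurable
      then show ?thesis by (simp add: G_def[abs_def])
    qed
    have kernel_bd: "(\<integral>\<^sup>+w. ennreal (cmod (T_kernel b c (\<zeta> * z) w * f w)) \<partial>disc_borel) \<le> ennreal M" if \<zeta>: "cmod \<zeta> = 1" for \<zeta>
    proof -
      have \<zeta>z: "cmod (\<zeta> * z) < 1" "cmod (\<zeta> * z) = cmod z" using \<zeta> z by (simp_all add: norm_mult)
      have "(\<integral>\<^sup>+w. ennreal (cmod (T_kernel b c (\<zeta> * z) w * f w)) \<partial>disc_borel) \<le>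
          (\<integral>\<^sup>+w. ennreal ((1 - cmod z) powr (-c)) * (ennreal (disc_kernel b c 0 w) * ennreal (cmod (f w))) \<partial>disc_borel)"
      proof (intro nn_integral_mono_AE eventually_mono[OF AE_disc_borel_cmod])
        fix w assume "cmod w < 1"
        from disc_kernel_le_kernel_0(1)[OF _ \<zeta>z(1) this, of c b] c
        have "disc_kernel b c (\<zeta> * z) w * cmod (f w) \<le> (1 - cmod z) powr (-c) * disc_kernel b c 0 w * cmod (f w)"
          unfolding \<zeta>z(2) by (intro mult_right_mono) auto
        then show "ennreal (cmod (T_kernel b c (\<zeta> * z) w * f w)) \<le> ennreal ((1 - cmod z) powr (-c)) * (ennreal (disc_kernel b c 0 w) * ennreal (cmod (f w)))"
          by (simp add: norm_mult cmod_T_kernel disc_kernel_nonneg mult.assoc ennreal_leI flip: ennreal_mult)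
      qed
      also have "\<dots> = ennreal ((1 - cmod z) powr (-c)) * pos_op b c (\<lambda>w. ennreal (cmod (f w))) 0"
        unfolding pos_op_def by (rule nn_integral_cmult) measurable
      also have "\<dots> = ennreal M" using M0 by (simp add: M_def ennreal_mult)
      finally show ?thesis .
    qed
    have G_bd: "cmod (G \<zeta>) \<le> M" if \<zeta>: "cmod \<zeta> = 1" for \<zeta>
    proof (cases "integrable disc_borel (\<lambda>w. T_kernel b c (\<zeta> * z) w * f w)")
      case True
      have "ennreal (cmod (G \<zeta>)) \<le> ennreal M"
        unfolding G_def using integral_norm_bound_ennreal[OF True] kernel_bd[OF \<zeta>] by (rule order_trans)
      then show ?thesis using M by (simp add: ennreal_le_iff)
    qed (simp add: G_def not_integrable_integral_eq M)
    \<comment> \<open>The extremal function for the duality of L^p and L^s on the circle: G h =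
      |G|^p, and also |h|^s = |G|^p.\<close>
    define h where "h \<zeta> = cnj (sgn (G \<zeta>)) * of_real (cmod (G \<zeta>) powr (p - 1))" for \<zeta>
    have [measurable]: "h \<in> borel_measurable borel" unfolding h_def by measurable
    have h_norm: "cmod (h \<zeta>) = cmod (G \<zeta>) powr (p - 1)" for \<zeta>
      by (simp add: h_def norm_mult norm_sgn)
    have h_bd: "cmod (h \<zeta>) \<le> M powr (p - 1)" if "cmod \<zeta> = 1" for \<zeta>
      unfolding h_norm using G_bd[OF that] p by (intro powr_mono2) auto
    have Gh: "G \<zeta> * h \<zeta> = of_real (cmod (G \<zeta>) powr p)" for \<zeta>
    proof (cases "G \<zeta> = 0")
      case False
      have "G \<zeta> * cnj (sgn (G \<zeta>)) = of_real (cmod (G \<zeta>))"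
        using False complex_norm_square[of "G \<zeta>"] by (simp add: sgn_eq power2_eq_square field_simps)
      moreover have "cmod (G \<zeta>) * cmod (G \<zeta>) powr (p - 1) = cmod (G \<zeta>) powr p"
        using powr_add[of "cmod (G \<zeta>)" 1 "p - 1"] by simp
      ultimately show ?thesis
        unfolding h_def mult.assoc[symmetric] by (simp only: of_real_mult[symmetric])
    qed simp
    define Y where "Y = (\<integral>\<zeta>. cmod (G \<zeta>) powr p \<partial>circle_measure)"
    have Y0: "0 \<le> Y" unfolding Y_def by (rule Bochner_Integration.integral_nonneg) simp
    have Y: "(\<integral>\<^sup>+\<zeta>. ennreal (cmod (G \<zeta>) powr p) \<partial>circle_measure) = ennreal Y"
      unfolding Y_def
    proof (rule nn_integral_eq_integral)
      show "integrable circle_measure (\<lambda>\<zeta>. cmod (G \<zeta>) powr p)"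
        by (rule circle_integrable_bounded[where B = "M powr p"]) (use p in \<open>auto intro!: powr_mono2 G_bd\<close>)
    qed simp
    interpret P: pair_sigma_finite circle_measure disc_borel ..
    have int: "integrable (circle_measure \<Otimes>\<^sub>M disc_borel) (\<lambda>(\<zeta>, w). T_kernel b c (\<zeta> * z) w * f w * h \<zeta>)"
    proof (rule integrableI_bounded)
      have "(\<integral>\<^sup>+x. ennreal (norm (case x of (\<zeta>, w) \<Rightarrow> T_kernel b c (\<zeta> * z) w * f w * h \<zeta>)) \<partial>(circle_measure \<Otimes>\<^sub>M disc_borel)) =
          (\<integral>\<^sup>+\<zeta>. \<integral>\<^sup>+w. ennreal (norm (T_kernel b c (\<zeta> * z) w * f w * h \<zeta>)) \<partial>disc_borel \<partial>circle_measure)"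
        by (subst disc_borel.nn_integral_fst[symmetric]) (auto simp: split_beta')
      also have "\<dots> \<le> (\<integral>\<^sup>+\<zeta>. ennreal (M * M powr (p - 1)) \<partial>circle_measure)"
      proof (intro nn_integral_mono_AE eventually_mono[OF AE_circle_measure])
        fix \<zeta> :: complex assume \<zeta>: "cmod \<zeta> = 1"
        have "(\<integral>\<^sup>+w. ennreal (norm (T_kernel b c (\<zeta> * z) w * f w * h \<zeta>)) \<partial>disc_borel) =
            (\<integral>\<^sup>+w. ennreal (cmod (T_kernel b c (\<zeta> * z) w * f w)) * ennreal (cmod (h \<zeta>)) \<partial>disc_borel)"
          by (simp add: norm_mult[of _ "h \<zeta>"] ennreal_mult)
        also have "\<dots> = (\<integral>\<^sup>+w. ennreal (cmod (T_kernel b c (\<zeta> * z) w * f w)) \<partial>disc_borel) * ennreal (cmod (h \<zeta>))"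
          by (rule nn_integral_multc) measurable
        also have "\<dots> \<le> ennreal M * ennreal (M powr (p - 1))"
          by (intro mult_mono kernel_bd \<zeta> ennreal_leI h_bd) auto
        also have "\<dots> = ennreal (M * M powr (p - 1))" using M by (simp add: ennreal_mult)
        finally show "(\<integral>\<^sup>+w. ennreal (norm (T_kernel b c (\<zeta> * z) w * f w * h \<zeta>)) \<partial>disc_borel) \<le> ennreal (M * M powr (p - 1))" .
      qed
      also have "\<dots> < \<infinity>" by (simp add: circle_measure.emeasure_space_1[simplified])
      finally show "(\<integral>\<^sup>+x. ennreal (norm (case x of (\<zeta>, w) \<Rightarrow> T_kernel b c (\<zeta> * z) w * f w * h \<zeta>)) \<partial>(circle_measure \<Otimes>\<^sub>M disc_borel)) < \<infinity>" .
    qed measurable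
    define W where "W w = circle_transform c z h w" for w
    have [measurable]: "W \<in> borel_measurable borel" unfolding W_def by measurable
    have "complex_of_real Y = (\<integral>\<zeta>. G \<zeta> * h \<zeta> \<partial>circle_measure)"
      unfolding Gh Y_def by (rule integral_complex_of_real[symmetric])
    also have "\<dots> = (\<integral>\<zeta>. \<integral>w. T_kernel b c (\<zeta> * z) w * f w * h \<zeta> \<partial>disc_borel \<partial>circle_measure)"
      by (simp add: G_def)
    also have "\<dots> = (\<integral>w. \<integral>\<zeta>. T_kernel b c (\<zeta> * z) w * f w * h \<zeta> \<partial>circle_measure \<partial>disc_borel)"
      by (rule P.Fubini_integral[OF int, symmetric])
    also have "\<dots> = (\<integral>w. of_real (defect w powr b) * f w * W w \<partial>disc_borel)"
    proof (rule Bochner_Integration.integral_cong[OF refl])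
      fix w
      have "(\<integral>\<zeta>. T_kernel b c (\<zeta> * z) w * f w * h \<zeta> \<partial>circle_measure) =
          (\<integral>\<zeta>. (of_real (defect w powr b) * f w) * (h \<zeta> / (1 - \<zeta> * (z * cnj w)) powr of_real c) \<partial>circle_measure)"
        by (intro Bochner_Integration.integral_cong refl) (simp add: T_kernel_def defect_def mult_ac)
      then show "(\<integral>\<zeta>. T_kernel b c (\<zeta> * z) w * f w * h \<zeta> \<partial>circle_measure) = of_real (defect w powr b) * f w * W w"
        by (simp only: integral_mult_right_zero W_def circle_transform_def)
    qed
    finally have YI: "complex_of_real Y = (\<integral>w. of_real (defect w powr b) * f w * W w \<partial>disc_borel)" .
    have "ennreal Y = ennreal (cmod (complex_of_real Y))" using Y0 by simp
    also have "\<dots> \<le> (\<integral>\<^sup>+w. ennreal (cmod (of_real (defect w powr b) * f w * W w)) \<partial>disc_borel)"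
    proof (cases "integrable disc_borel (\<lambda>w. of_real (defect w powr b) * f w * W w)")
      case True
      then show ?thesis unfolding YI by (rule integral_norm_bound_ennreal)
    qed (simp add: YI not_integrable_integral_eq)
    also have "\<dots> \<le> (\<integral>\<^sup>+w. ennreal (\<epsilon> powr (-p)) * ennreal (cmod (f w) powr p) +
        ennreal (\<epsilon> powr s) * ennreal (defect w powr ((c - 1) * s - 1) * cmod (W w) powr s) \<partial>disc_borel)"
    proof (rule nn_integral_mono)
      fix w
      have "cmod (of_real (defect w powr b) * f w * W w) = (cmod (f w) / \<epsilon>) * (\<epsilon> * (defect w powr b * cmod (W w)))"
        using \<epsilon> by (simp add: norm_mult)
      also have "\<dots> \<le> (cmod (f w) / \<epsilon>) powr p + (\<epsilon> * (defect w powr b * cmod (W w))) powr s"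
        unfolding s_def using \<epsilon> p by (intro young_product) auto
      also have "(cmod (f w) / \<epsilon>) powr p = \<epsilon> powr (-p) * cmod (f w) powr p"
        using \<epsilon> by (simp add: powr_divide powr_minus field_simps)
      also have "(\<epsilon> * (defect w powr b * cmod (W w))) powr s = \<epsilon> powr s * (defect w powr (b * s) * cmod (W w) powr s)"
        using \<epsilon> by (simp add: powr_mult powr_powr)
      finally show "ennreal (cmod (of_real (defect w powr b) * f w * W w)) \<le> ennreal (\<epsilon> powr (-p)) * ennreal (cmod (f w) powr p) +
        ennreal (\<epsilon> powr s) * ennreal (defect w powr ((c - 1) * s - 1) * cmod (W w) powr s)"
        unfolding bs by (simp add: ennreal_leI flip: ennreal_mult ennreal_plus)
    qed
    also have "\<dots> = ennreal (\<epsilon> powr (-p)) * (\<integral>\<^sup>+w. ennreal (cmod (f w) powr p) \<partial>disc_borel) +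
        ennreal (\<epsilon> powr s) * (\<integral>\<^sup>+w. ennreal (defect w powr ((c - 1) * s - 1) * cmod (W w) powr s) \<partial>disc_borel)"
      by (simp add: nn_integral_add nn_integral_cmult)
    also have "\<dots> \<le> ennreal (\<epsilon> powr (-p)) * ennreal X + ennreal (\<epsilon> powr s) * (ennreal C * ennreal Y)"
    proof (intro add_mono mult_left_mono fX)
      have "(\<integral>\<^sup>+w. ennreal (defect w powr ((c - 1) * s - 1) * cmod (W w) powr s) \<partial>disc_borel) \<le>
          ennreal C * (\<integral>\<^sup>+\<zeta>. ennreal (cmod (h \<zeta>) powr s) \<partial>circle_measure)"
        unfolding W_def by (rule Ls[OF z, where H = "M powr (p - 1)"]) (auto intro: h_bd)
      also have "(\<integral>\<^sup>+\<zeta>. ennreal (cmod (h \<zeta>) powr s) \<partial>circle_measure) = ennreal Y"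
        unfolding h_norm powr_powr ps Y ..
      finally show "(\<integral>\<^sup>+w. ennreal (defect w powr ((c - 1) * s - 1) * cmod (W w) powr s) \<partial>disc_borel) \<le> ennreal C * ennreal Y" .
    qed simp_all
    also have "\<dots> = ennreal (\<epsilon> powr (-p) * X + \<epsilon> powr s * C * Y)"
      using X Y0 C by (simp add: mult.assoc flip: ennreal_mult ennreal_plus)
    finally have "Y \<le> \<epsilon> powr (-p) * X + \<epsilon> powr s * C * Y"
      using X Y0 C by (subst (asm) ennreal_le_iff) auto
    also have "\<dots> \<le> \<epsilon> powr (-p) * X + 1 / 2 * Y"
      using \<epsilon> Y0 by (intro add_left_mono mult_right_mono) auto
    finally have "Y \<le> K * X" by (simp add: K_def)
    then show "(\<integral>\<^sup>+\<zeta>. ennreal (cmod (\<integral>w. T_kernel b c (\<zeta> * z) w * f w \<partial>disc_borel) powr p) \<partial>circle_measure) \<le> ennreal (K * X)"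
      using Y by (simp add: G_def ennreal_leI)
  qed
qed

text \<open>For q = -1/a the exponent a + 1/q vanishes, so a bound of the circle means of order p
  that is uniform in z yields, by Markov's inequality, exactly what
  \<open>weak_type_from_circle\<close> requires. The restriction p <= 2 enters through the conjugate
  exponent, which the interpolation needs to be at least 2.\<close>

lemma T_bounded_Lp_corner:
  assumes c: "1 < c" and a: "a < 0" and p: "1 < p" "p \<le> 2" and \<sigma>: "1 / p = b + 2 - c" "b + 2 - c < - a"
  shows "T_bounded a b c (Lp_norm (ereal p)) (weak_Lp_norm (ereal (- 1 / a)))"
proof -
  define q where "q = - 1 / a"
  have q: "0 < q" "a + 1 / q = 0" "1 / q = - a" using a by (auto simp: q_def field_simps)
  have qp: "q < p"
  proof -
    have "1 / p < 1 / q" using \<sigma> q by simp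
    then have "(p * q) * (1 / p) < (p * q) * (1 / q)"
      using p q(1) by (intro mult_strict_left_mono) auto
    then show ?thesis using p q(1) by simp
  qed
  have b: "b = 1 / p - 2 + c" using \<sigma>(1) by simp
  have exp: "(b + 1 - c) * (p / (p - 1)) = -1"
    unfolding b using p by (simp add: field_simps)
  obtain K where K: "0 \<le> K" and mean: "\<And>z f X. cmod z < 1 \<Longrightarrow> f \<in> borel_measurable borel \<Longrightarrow> 0 \<le> X \<Longrightarrow>
    pos_op b c (\<lambda>w. ennreal (cmod (f w))) 0 < \<infinity> \<Longrightarrow> (\<integral>\<^sup>+w. ennreal (cmod (f w) powr p) \<partial>disc_borel) \<le> ennreal X \<Longrightarrow>
    (\<integral>\<^sup>+\<zeta>. ennreal (cmod (\<integral>w. T_kernel b c (\<zeta> * z) w * f w \<partial>disc_borel) powr p) \<partial>circle_measure) \<le> ennreal (K * X)"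
    using T_circle_mean_le[OF c p exp] by blast
  \<comment> \<open>Convergence cannot be read off from a weak-type bound for the positive operator,
    which fails at this exponent. It holds because u^b lies in the conjugate Lebesgue space: b p /
    (p - 1) exceeds -1 by (c - 1) p / (p - 1).\<close>
  have fin: "pos_op b c (\<lambda>w. ennreal (cmod (f w))) 0 < \<infinity>"
    if [measurable]: "f \<in> borel_measurable borel" and N: "Lp_norm (ereal p) f < \<infinity>" for f
  proof -
    obtain X where X: "0 \<le> X" "Lp_norm (ereal p) f \<le> ennreal X"
      using N by (cases "Lp_norm (ereal p) f") auto
    then have fX: "(\<integral>\<^sup>+w. ennreal (cmod (f w) powr p) \<partial>disc_borel) \<le> ennreal (X powr p)"
      using p by (simp add: Lp_norm_le_iff)
    have bs: "-1 < b * (p / (p - 1))"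
    proof -
      have "b * (p / (p - 1)) = (b + 1 - c) * (p / (p - 1)) + (c - 1) * (p / (p - 1))"
        unfolding distrib_right[symmetric] by simp
      moreover have "0 < (c - 1) * (p / (p - 1))" using c p by simp
      ultimately show ?thesis using exp by simp
    qed
    have "pos_op b c (\<lambda>w. ennreal (cmod (f w))) 0 \<le>
        (\<integral>\<^sup>+w. ennreal (cmod (f w) powr p) + ennreal (defect w powr (b * (p / (p - 1)))) \<partial>disc_borel)"
      unfolding pos_op_0
    proof (rule nn_integral_mono)
      fix w
      have "cmod (f w) * defect w powr b \<le> cmod (f w) powr p + (defect w powr b) powr (p / (p - 1))"
        using p by (intro young_product) auto
      then show "ennreal (defect w powr b) * ennreal (cmod (f w)) \<le> ennreal (cmod (f w) powr p) + ennreal (defect w powr (b * (p / (p - 1))))"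
        by (simp add: powr_powr ennreal_leI mult.commute flip: ennreal_mult ennreal_plus)
    qed
    also have "\<dots> = (\<integral>\<^sup>+w. ennreal (cmod (f w) powr p) \<partial>disc_borel) + (\<integral>\<^sup>+w. ennreal (defect w powr (b * (p / (p - 1)))) \<partial>disc_borel)"
      by (rule nn_integral_add) measurable
    also have "\<dots> \<le> ennreal (X powr p) + ennreal (1 / (b * (p / (p - 1)) + 1))"
      by (intro add_mono fX nn_integral_disc_powr bs)
    also have "\<dots> < \<infinity>" by simp
    finally show ?thesis .
  qed
  have "disc_op_bounded a (T_kernel b c) (Lp_norm (ereal p)) (weak_Lp_norm (ereal q))"
  proof (rule disc_op_boundedI[OF q(1) _ _ _ _ cmod_T_kernel fin])
    show "0 \<le> 1 + K / (p / q - 1)" using K q qp by simp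
    show "0 < c" using c by simp
    show "(\<lambda>x. T_kernel b c (fst x) (snd x)) \<in> borel_measurable (borel \<Otimes>\<^sub>M borel)" by measurable
    show "Lp_norm (ereal p) f = Lp_norm (ereal p) g"
      if "f \<in> borel_measurable disc_measure" "g \<in> borel_measurable disc_measure" "AE w in disc_measure. f w = g w" for f g
      using that by (intro Lp_norm_cong) auto
    fix f :: "complex \<Rightarrow> complex" and X l :: real
    assume [measurable]: "f \<in> borel_measurable borel" and X: "0 \<le> X" "Lp_norm (ereal p) f \<le> ennreal X" and l: "0 < l"
    define g where "g z = (\<integral>w. T_kernel b c z w * f w \<partial>disc_borel)" for z
    have [measurable]: "g \<in> borel_measurable borel"
    proof -
      have "(\<lambda>z. \<integral>w. T_kernel b c z w * f w \<partial>disc_borel) \<in> borel_measurable borel"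
        by (rule disc_borel.borel_measurable_lebesgue_integral) measurable
      then show ?thesis by (simp add: g_def[abs_def])
    qed
    have finf: "pos_op b c (\<lambda>w. ennreal (cmod (f w))) 0 < \<infinity>"
      by (rule fin) (use X in \<open>auto intro: order.strict_trans1\<close>)
    show "emeasure disc_borel {z. l < defect z powr a * cmod (\<integral>w. T_kernel b c z w * f w \<partial>disc_borel)} \<le>
        ennreal ((1 + K / (p / q - 1)) * (X / l) powr q)"
    proof (rule weak_type_limit[OF q(1) X(1) l])
      fix Y assume Y: "X < Y"
      then have Y0: "0 < Y" using X by simp
      have "Lp_norm (ereal p) f \<le> ennreal Y" using X Y by (auto intro: order_trans ennreal_leI)
      then have fY: "(\<integral>\<^sup>+w. ennreal (cmod (f w) powr p) \<partial>disc_borel) \<le> ennreal (Y powr p)"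
        using p Y0 by (simp add: Lp_norm_le_iff)
      have "emeasure disc_borel {z. ennreal l < ennreal (defect z powr a) * ennreal (cmod (g z))} \<le>
          ennreal ((1 + K / (p / q - 1)) * (Y / l) powr q)"
      proof (rule weak_type_from_circle[OF _ q(1) qp Y0 K _ l])
        fix z :: complex and l :: real assume z: "cmod z < 1" and l: "0 < l"
        have "emeasure circle_measure {\<zeta>. ennreal l < ennreal (cmod (g (\<zeta> * z)))} \<le>
            emeasure circle_measure {\<zeta> \<in> UNIV. 1 \<le> ennreal (1 / l powr p) * ennreal (cmod (g (\<zeta> * z)) powr p)}"
        proof (rule emeasure_mono)
          show "{\<zeta>. ennreal l < ennreal (cmod (g (\<zeta> * z)))} \<subseteq> {\<zeta> \<in> UNIV. 1 \<le> ennreal (1 / l powr p) * ennreal (cmod (g (\<zeta> * z)) powr p)}"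
          proof (intro subsetI, elim CollectE)
            fix \<zeta> assume "ennreal l < ennreal (cmod (g (\<zeta> * z)))"
            then have "l < cmod (g (\<zeta> * z))" using l by (subst (asm) ennreal_less_iff) auto
            then have "l powr p \<le> cmod (g (\<zeta> * z)) powr p" using l p by (intro powr_mono2) auto
            then have "1 \<le> 1 / l powr p * cmod (g (\<zeta> * z)) powr p" using l by (simp add: field_simps)
            then have "ennreal 1 \<le> ennreal (1 / l powr p * cmod (g (\<zeta> * z)) powr p)" by (rule ennreal_leI)
            then show "\<zeta> \<in> {\<zeta> \<in> UNIV. 1 \<le> ennreal (1 / l powr p) * ennreal (cmod (g (\<zeta> * z)) powr p)}"
              by (subst (asm) ennreal_mult, simp, simp, simp only: ennreal_1 mem_Collect_eq UNIV_I simp_thms)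
          qed
        qed measurable
        also have "\<dots> \<le> ennreal (1 / l powr p) * (\<integral>\<^sup>+\<zeta>. ennreal (cmod (g (\<zeta> * z)) powr p) * indicator UNIV \<zeta> \<partial>circle_measure)"
          by (rule nn_integral_Markov_inequality) measurable
        also have "\<dots> \<le> ennreal (1 / l powr p) * ennreal (K * Y powr p)"
          using mean[OF z _ _ finf fY] by (intro mult_left_mono) (auto simp: g_def)
        also have "\<dots> = ennreal (K * (Y * defect z powr (- (a + 1 / q)) / l) powr p)"
          using K Y0 l defect_pos[OF z] unfolding q(2) by (simp add: powr_divide flip: ennreal_mult)
        finally show "emeasure circle_measure {\<zeta>. ennreal l < ennreal (cmod (g (\<zeta> * z)))} \<le>
          ennreal (K * (Y * defect z powr (- (a + 1 / q)) / l) powr p)" .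
      qed measurable
      moreover have "(ennreal l < ennreal (defect z powr a) * ennreal (cmod (g z))) = (l < defect z powr a * cmod (g z))" for z
        using l by (subst ennreal_mult[symmetric]) (auto simp: ennreal_less_iff)
      ultimately show "emeasure disc_borel {z. l < defect z powr a * cmod (\<integral>w. T_kernel b c z w * f w \<partial>disc_borel)} \<le>
        ennreal ((1 + K / (p / q - 1)) * (Y / l) powr q)"
        by (simp add: g_def)
    qed
  qed
  then show ?thesis by (simp add: q_def)
qed

section \<open>Unboundedness at the endpoints\<close>

text \<open>Each unboundedness proof produces inputs of norm at most n^e2 whose images have size at
  least of order n^e1.\<close>

lemma powr_growth_contradiction:
  fixes k C e1 e2 :: real
  assumes "0 < k" "e2 < e1" and le: "\<And>n::nat. 1 \<le> n \<Longrightarrow> k * real n powr e1 \<le> C * real n powr e2"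
  shows False
proof -
  obtain n :: nat where n: "real n > max 1 ((\<bar>C\<bar> / k) powr (1 / (e1 - e2)))"
    using reals_Archimedean2 by blast
  then have n1: "1 < real n" by simp
  have "\<bar>C\<bar> / k = ((\<bar>C\<bar> / k) powr (1 / (e1 - e2))) powr (e1 - e2)"
    using assms by (simp add: powr_powr)
  also have "\<dots> < real n powr (e1 - e2)"
    using n assms by (intro powr_less_mono2) auto
  finally have "\<bar>C\<bar> < k * real n powr (e1 - e2)"
    using assms by (simp add: field_simps)
  then have "\<bar>C\<bar> * real n powr e2 < k * real n powr (e1 - e2) * real n powr e2"
    using n1 by (intro mult_strict_right_mono) auto
  also have "\<dots> = k * real n powr e1"
    by (simp add: mult.assoc flip: powr_add)
  also have "\<dots> \<le> C * real n powr e2"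
    using n1 by (intro le) simp
  also have "\<dots> \<le> \<bar>C\<bar> * real n powr e2"
    by (intro mult_right_mono) auto
  finally show False by simp
qed

lemma disc_op_eq:
  assumes [measurable]: "f \<in> borel_measurable borel"
    and K: "(\<lambda>x. K (fst x) (snd x)) \<in> borel_measurable (borel \<Otimes>\<^sub>M borel)"
  shows "disc_op a K f z = of_real (defect z powr a) * (\<integral>w. K z w * f w \<partial>disc_borel)"
    and "disc_op a K f \<in> borel_measurable borel"
proof -
  have [measurable]: "(\<lambda>w. K z w) \<in> borel_measurable borel" for z
    using measurable_compose[OF measurable_Pair1'[of z] K] by simp
  have [measurable]: "(\<lambda>x. K (fst x) (snd x)) \<in> borel_measurable (borel \<Otimes>\<^sub>M disc_borel)"
    using K by (simp cong: measurable_cong_sets)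
  have eq: "disc_op a K f z = of_real (defect z powr a) * (\<integral>w. K z w * f w \<partial>disc_borel)" for z
    unfolding disc_op_def disc_borel_def defect_def
    by (subst integral_distr) (auto intro: measurable_id_disc_measure)
  then show "disc_op a K f z = of_real (defect z powr a) * (\<integral>w. K z w * f w \<partial>disc_borel)" .
  have "(\<lambda>z. \<integral>w. K z w * f w \<partial>disc_borel) \<in> borel_measurable borel"
    by (rule disc_borel.borel_measurable_lebesgue_integral) (simp add: split_beta')
  then show "disc_op a K f \<in> borel_measurable borel"
    unfolding eq[abs_def] by measurable
qed

text \<open>The form used for testing: a lower bound m for the measure of one level set stands for
  the image, and an upper bound X stands for the norm of the input.\<close>

lemma disc_op_bounded_imp_weak_type:
  assumes bdd: "disc_op_bounded a K (Lp_norm (ereal p)) (weak_Lp_norm (ereal q))"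
    and K: "(\<lambda>x. K (fst x) (snd x)) \<in> borel_measurable (borel \<Otimes>\<^sub>M borel)"
  shows "\<exists>C. \<forall>f X t m. f \<in> borel_measurable borel \<longrightarrow> 0 \<le> X \<longrightarrow> Lp_norm (ereal p) f \<le> ennreal X \<longrightarrow> 0 < t \<longrightarrow> 0 < q \<longrightarrow> 0 \<le> m \<longrightarrow>
    m \<le> measure disc_borel {z. t < defect z powr a * cmod (\<integral>w. K z w * f w \<partial>disc_borel)} \<longrightarrow> t * m powr (1 / q) \<le> C * X"
proof -
  obtain C where C: "\<And>f. f \<in> borel_measurable disc_measure \<Longrightarrow> Lp_norm (ereal p) f < \<infinity> \<Longrightarrow>
      weak_Lp_norm (ereal q) (disc_op a K f) \<le> ennreal C * Lp_norm (ereal p) f"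
    using bdd unfolding disc_op_bounded_def by blast
  have "t * m powr (1 / q) \<le> \<bar>C\<bar> * X"
    if f: "f \<in> borel_measurable borel" and X: "0 \<le> X" "Lp_norm (ereal p) f \<le> ennreal X" and t: "0 < t" and q: "0 < q"
      and m: "0 \<le> m" "m \<le> measure disc_borel {z. t < defect z powr a * cmod (\<integral>w. K z w * f w \<partial>disc_borel)}" for f X t m
  proof -
    note op = disc_op_eq[OF f K, of a]
    have "distribution (disc_op a K f) t = measure disc_borel {z. t < defect z powr a * cmod (\<integral>w. K z w * f w \<partial>disc_borel)}"
      by (simp add: distribution_eq[OF op(2)] op(1) norm_mult)
    then have "m powr (1 / q) \<le> distribution (disc_op a K f) t powr (1 / q)"
      using m q by (intro powr_mono2) auto
    then have "ennreal (t * m powr (1 / q)) \<le> ennreal (t * distribution (disc_op a K f) t powr (1 / q))"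
      using t by (intro ennreal_leI mult_left_mono) auto
    also have "\<dots> \<le> weak_Lp_norm (ereal q) (disc_op a K f)"
      using t by (auto simp: weak_Lp_norm_def intro: SUP_upper)
    also have "\<dots> \<le> ennreal C * Lp_norm (ereal p) f"
      using X by (intro C borel_measurable_disc_measure f) (auto intro: order.strict_trans1)
    also have "\<dots> \<le> ennreal \<bar>C\<bar> * ennreal X"
      using X by (intro mult_mono ennreal_leI) auto
    also have "\<dots> = ennreal (\<bar>C\<bar> * X)" using X by (simp add: ennreal_mult)
    finally show ?thesis using X by (simp add: ennreal_le_iff)
  qed
  then show ?thesis by (intro exI[of _ "\<bar>C\<bar>"] allI impI)
qed

section \<open>Radial test functions with a logarithmic norm\<close>

lemma nn_integral_disc_inverse:
  assumes "0 < \<delta>" "\<delta> < \<eta>" "\<eta> \<le> 1"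
  shows "(\<integral>\<^sup>+w. ennreal (1 / defect w) * indicator {\<delta><..<\<eta>} (defect w) \<partial>disc_borel) = ennreal (ln (\<eta> / \<delta>))"
proof -
  have "((\<lambda>x. 1 / x) has_integral (ln \<eta> - ln \<delta>)) {\<delta>..\<eta>}"
    using assms
    by (intro fundamental_theorem_of_calculus)
       (auto intro!: derivative_eq_intros simp flip: has_real_derivative_iff_has_vector_derivative)
  then have "((\<lambda>x. 1 / x) has_integral (ln \<eta> - ln \<delta>)) {\<delta><..<\<eta>}"
    by (simp add: has_integral_Icc_iff_Ioo)
  then have "(\<integral>\<^sup>+x. ennreal (indicator {\<delta><..<\<eta>} x * (1 / x)) \<partial>lborel) = ennreal (ln \<eta> - ln \<delta>)"
    using assms by (intro nn_integral_has_integral_lebesgue) auto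
  moreover have "(\<integral>\<^sup>+x. ennreal (1 / x) * indicator {\<delta><..<\<eta>} x \<partial>lborel) =
      (\<integral>\<^sup>+x. ennreal (indicator {\<delta><..<\<eta>} x * (1 / x)) \<partial>lborel)"
    by (intro nn_integral_cong) (auto simp: indicator_def)
  ultimately have *: "(\<integral>\<^sup>+x. ennreal (1 / x) * indicator {\<delta><..<\<eta>} x \<partial>lborel) = ennreal (ln \<eta> - ln \<delta>)"
    by simp
  have "(\<integral>\<^sup>+w. ennreal (1 / defect w) * indicator {\<delta><..<\<eta>} (defect w) \<partial>disc_borel) =
      (\<integral>\<^sup>+x\<in>{0<..<1}. ennreal (1 / x) * indicator {\<delta><..<\<eta>} x \<partial>lborel)"
    by (rule nn_integral_radial[where f = "\<lambda>x. ennreal (1 / x) * indicator {\<delta><..<\<eta>} x"]) measurable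
  also have "\<dots> = (\<integral>\<^sup>+x. ennreal (1 / x) * indicator {\<delta><..<\<eta>} x \<partial>lborel)"
    using assms by (intro nn_integral_cong) (auto simp: indicator_def)
  finally show ?thesis using assms * by (simp add: ln_div)
qed

lemma emeasure_defect_interval:
  assumes "0 \<le> \<delta>" "\<delta> \<le> \<eta>" "\<eta> \<le> 1"
  shows "emeasure disc_borel {w. \<delta> < defect w \<and> defect w < \<eta>} = ennreal (\<eta> - \<delta>)"
proof -
  have "emeasure disc_borel {w. \<delta> < defect w \<and> defect w < \<eta>} = (\<integral>\<^sup>+w. indicator {w. \<delta> < defect w \<and> defect w < \<eta>} w \<partial>disc_borel)"
    by (subst nn_integral_indicator) auto
  also have "\<dots> = (\<integral>\<^sup>+w. (if \<delta> < defect w \<and> defect w < \<eta> then 1 else 0) \<partial>disc_borel)"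
    by (intro nn_integral_cong) (auto simp: indicator_def)
  also have "\<dots> = (\<integral>\<^sup>+x\<in>{0<..<1}. (if \<delta> < x \<and> x < \<eta> then 1 else 0) \<partial>lborel)"
    by (rule nn_integral_radial) measurable
  also have "\<dots> = (\<integral>\<^sup>+x. indicator {\<delta><..<\<eta>} x \<partial>lborel)"
    using assms by (intro nn_integral_cong) (auto simp: indicator_def)
  also have "\<dots> = ennreal (\<eta> - \<delta>)" using assms by simp
  finally show ?thesis .
qed

lemma measure_defect_interval:
  "0 \<le> \<delta> \<Longrightarrow> \<delta> \<le> \<eta> \<Longrightarrow> \<eta> \<le> 1 \<Longrightarrow> measure disc_borel {w. \<delta> < defect w \<and> defect w < \<eta>} = \<eta> - \<delta>"
  using emeasure_defect_interval[of \<delta> \<eta>] by (simp add: disc_borel.emeasure_eq_measure)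

text \<open>The test functions vanish near the unit circle, and away from it u^b is bounded whatever
  the sign of b.\<close>

lemma integrable_kernel_annulus:
  assumes c: "0 < c" and z: "cmod z < 1" and \<delta>: "0 < \<delta>" and [measurable]: "f \<in> borel_measurable borel"
    and K: "(\<lambda>x. K (fst x) (snd x)) \<in> borel_measurable (borel \<Otimes>\<^sub>M borel)" and K_norm: "\<And>z w. cmod (K z w) = disc_kernel b c z w"
    and bd: "\<And>w. cmod (f w) \<le> M" and supp: "\<And>w. defect w \<le> \<delta> \<Longrightarrow> f w = 0"
  shows "integrable disc_borel (\<lambda>w. K z w * f w)"
proof (rule integrable_kernel[OF c _ K K_norm _ z])
  have M0: "0 \<le> M" using order_trans[OF norm_ge_zero bd] .
  have "pos_op b c (\<lambda>w. ennreal (cmod (f w))) 0 \<le> (\<integral>\<^sup>+w. ennreal (max 1 (\<delta> powr b) * M) \<partial>disc_borel)"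
    unfolding pos_op_0
  proof (intro nn_integral_mono_AE eventually_mono[OF AE_disc_borel])
    fix w assume w: "0 < defect w \<and> defect w < 1 \<and> cmod w < 1 \<and> w \<noteq> 0"
    have "defect w powr b * cmod (f w) \<le> max 1 (\<delta> powr b) * M"
    proof (cases "defect w \<le> \<delta>")
      case False
      have "defect w powr b \<le> max 1 (\<delta> powr b)"
      proof (cases "0 \<le> b")
        case True
        then show ?thesis using w powr_le1[of b "defect w"] by (simp add: le_max_iff_disj)
      next
        case b: False
        have "defect w powr b \<le> \<delta> powr b" using False \<delta> b by (intro powr_mono2') auto
        then show ?thesis by simp
      qed
      then show ?thesis using bd by (intro mult_mono) auto
    qed (use supp M0 in auto)
    then show "ennreal (defect w powr b) * ennreal (cmod (f w)) \<le> ennreal (max 1 (\<delta> powr b) * M)"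
      by (simp add: ennreal_leI flip: ennreal_mult)
  qed
  also have "\<dots> < \<infinity>" by (simp add: disc_borel.emeasure_space_1[simplified])
  finally show "pos_op b c (\<lambda>w. ennreal (cmod (f w))) 0 < \<infinity>" .
qed measurable

lemma measurable_T_kernel_pair: "(\<lambda>x. T_kernel b c (fst x) (snd x)) \<in> borel_measurable (borel \<Otimes>\<^sub>M borel)"
  and measurable_S_kernel_pair: "(\<lambda>x. S_kernel b c (fst x) (snd x)) \<in> borel_measurable (borel \<Otimes>\<^sub>M borel)"
  by measurable

lemma S_kernel_eq: "S_kernel b c z w = of_real (disc_kernel b c z w)"
  by (simp add: S_kernel_def disc_kernel_def defect_def powr_minus_divide)

lemma cmod_S_integral:
  assumes [measurable]: "\<phi> \<in> borel_measurable borel" and "\<And>w. 0 \<le> \<phi> w"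
    and int: "integrable disc_borel (\<lambda>w. S_kernel b c z w * of_real (\<phi> w))"
  shows "ennreal (cmod (\<integral>w. S_kernel b c z w * of_real (\<phi> w) \<partial>disc_borel)) = pos_op b c (\<lambda>w. ennreal (\<phi> w)) z"
proof -
  have eq: "S_kernel b c z w * of_real (\<phi> w) = of_real (disc_kernel b c z w * \<phi> w)" for w
    by (simp add: S_kernel_eq)
  have int': "integrable disc_borel (\<lambda>w. disc_kernel b c z w * \<phi> w)"
    using integrable_Re[OF int] unfolding eq by simp
  have "cmod (\<integral>w. S_kernel b c z w * of_real (\<phi> w) \<partial>disc_borel) = (\<integral>w. disc_kernel b c z w * \<phi> w \<partial>disc_borel)"
    unfolding eq integral_complex_of_real norm_of_real
    by (intro abs_of_nonneg Bochner_Integration.integral_nonneg mult_nonneg_nonneg disc_kernel_nonneg assms)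
  also have "ennreal \<dots> = (\<integral>\<^sup>+w. ennreal (disc_kernel b c z w * \<phi> w) \<partial>disc_borel)"
    using int' assms disc_kernel_nonneg by (intro nn_integral_eq_integral[symmetric]) auto
  also have "\<dots> = pos_op b c (\<lambda>w. ennreal (\<phi> w)) z"
    using assms by (simp add: pos_op_def ennreal_mult disc_kernel_nonneg)
  finally show ?thesis .
qed

text \<open>With e = -1/p and applied to the defect, this is the power that just fails to lie in
  L^p: its p-th power is 1/u, and the cut to an annulus makes the norm a power of ln (\<eta> /
  \<delta>).\<close>

definition annulus_power :: "real \<Rightarrow> real \<Rightarrow> real \<Rightarrow> real \<Rightarrow> real" where
  "annulus_power e \<delta> \<eta> x = (if \<delta> < x \<and> x < \<eta> then x powr e else 0)"

lemma measurable_annulus_power [measurable]: "annulus_power e \<delta> \<eta> \<in> borel_measurable borel"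
  unfolding annulus_power_def by measurable

lemma annulus_power_nonneg: "0 \<le> annulus_power e \<delta> \<eta> x"
  by (simp add: annulus_power_def)

lemma annulus_power_bounded:
  assumes "0 < \<delta>" "\<eta> \<le> 1"
  shows "annulus_power e \<delta> \<eta> x \<le> max 1 (\<delta> powr e)"
proof (cases "0 \<le> e")
  case True
  then show ?thesis using assms powr_le1[of e x] by (auto simp: annulus_power_def le_max_iff_disj)
next
  case False
  then show ?thesis using assms powr_mono2'[of e \<delta> x] by (auto simp: annulus_power_def le_max_iff_disj)
qed

lemma Lp_norm_annulus_power:
  assumes "0 < \<delta>" "\<delta> < \<eta>" "\<eta> \<le> 1" and p: "0 < p"
  shows "Lp_norm (ereal p) (\<lambda>w. complex_of_real (annulus_power (- 1 / p) \<delta> \<eta> (defect w))) \<le> ennreal (ln (\<eta> / \<delta>) powr (1 / p))"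
proof (subst Lp_norm_le_iff[OF p])
  have "(\<integral>\<^sup>+w. ennreal (cmod (complex_of_real (annulus_power (- 1 / p) \<delta> \<eta> (defect w))) powr p) \<partial>disc_borel) =
      (\<integral>\<^sup>+w. ennreal (1 / defect w) * indicator {\<delta><..<\<eta>} (defect w) \<partial>disc_borel)"
  proof (rule nn_integral_cong)
    fix w
    have e: "(x powr (- (1 / p))) powr p = 1 / x" if "0 < x" for x :: real
    proof -
      have "(x powr (- (1 / p))) powr p = x powr (- 1)" using p by (simp add: powr_powr)
      then show ?thesis using that by (simp add: powr_minus_divide)
    qed
    show "ennreal (cmod (complex_of_real (annulus_power (- 1 / p) \<delta> \<eta> (defect w))) powr p) =
      ennreal (1 / defect w) * indicator {\<delta><..<\<eta>} (defect w)"
      using assms e[of "defect w"] by (auto simp: annulus_power_def indicator_def)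
  qed
  also have "\<dots> = ennreal (ln (\<eta> / \<delta>))" by (rule nn_integral_disc_inverse) (use assms in auto)
  also have "\<dots> = ennreal ((ln (\<eta> / \<delta>) powr (1 / p)) powr p)" using assms by (simp add: powr_powr)
  finally show "(\<integral>\<^sup>+w. ennreal (cmod (complex_of_real (annulus_power (- 1 / p) \<delta> \<eta> (defect w))) powr p) \<partial>disc_borel) \<le>
    ennreal ((ln (\<eta> / \<delta>) powr (1 / p)) powr p)" by simp
qed auto

text \<open>With 1/p = b + 1 the product u^b u^(-1/p) is 1/u, so cutting at defect exp (-n) gives an
  integral of size at least n at every z, against a norm n^(1/p). The outer weight is at least 1
  because a < 0, so the level set at n / 2 fills the disc up to a null set.\<close>

lemma T_S_unbounded_weak_L1:
  assumes c: "0 < c" and a: "a < 0" and p: "1 < p" and b: "b = -1 + 1 / p"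
  shows "\<not> T_bounded a b c (Lp_norm (ereal p)) (weak_Lp_norm 1)"
    and "\<not> S_bounded a b c (Lp_norm (ereal p)) (weak_Lp_norm 1)"
proof -
  define f where "f n w = complex_of_real (annulus_power (- 1 / p) (exp (- real n)) 1 (defect w))" for n w
  have [measurable]: "f n \<in> borel_measurable borel" for n unfolding f_def by measurable
  have int: "integrable disc_borel (\<lambda>w. K z w * f n w)"
    if "cmod z < 1" "(\<lambda>x. K (fst x) (snd x)) \<in> borel_measurable (borel \<Otimes>\<^sub>M borel)" "\<And>z w. cmod (K z w) = disc_kernel b c z w" for K z n
    by (rule integrable_kernel_annulus[OF c that(1) _ _ that(2,3), where \<delta> = "exp (- real n)" and M = "max 1 (exp (- real n) powr (- 1 / p))"])
       (use annulus_power_bounded[of "exp (- real n)" 1 "- 1 / p"] annulus_power_nonneg in \<open>auto simp: f_def annulus_power_def\<close>)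
  \<comment> \<open>A radial input meets only the constant Taylor term of the kernel, so the inner
    integral does not depend on z; the monomial formula is used with exponent 0.\<close>
  have T: "cmod (\<integral>w. T_kernel b c z w * f n w \<partial>disc_borel) = real n" if z: "cmod z < 1" and n: "1 \<le> n" for z n
  proof -
    define \<phi> where "\<phi> x = x powr b * annulus_power (- 1 / p) (exp (- real n)) 1 x" for x
    have [measurable]: "\<phi> \<in> borel_measurable borel" unfolding \<phi>_def by measurable
    have eq: "T_kernel b c z w * f n w = complex_of_real (\<phi> (defect w)) * w ^ 0 / (1 - z * cnj w) powr of_real c" for w
      by (simp add: T_kernel_def f_def \<phi>_def defect_def)
    have "ennreal (\<integral>w. \<phi> (defect w) \<partial>disc_borel) = (\<integral>\<^sup>+w. ennreal (\<phi> (defect w)) \<partial>disc_borel)"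
    proof (rule nn_integral_eq_integral[symmetric])
      have "integrable disc_borel (\<lambda>w. T_kernel b c 0 w * f n w)"
        by (rule int) (auto intro: measurable_T_kernel_pair cmod_T_kernel)
      then have "integrable disc_borel (\<lambda>w. Re (T_kernel b c 0 w * f n w))" by (rule integrable_Re)
      then show "integrable disc_borel (\<lambda>w. \<phi> (defect w))"
        by (simp add: T_kernel_def f_def \<phi>_def defect_def)
      show "AE w in disc_borel. 0 \<le> \<phi> (defect w)" by (simp add: \<phi>_def annulus_power_nonneg)
    qed
    also have "\<dots> = (\<integral>\<^sup>+w. ennreal (1 / defect w) * indicator {exp (- real n)<..<1} (defect w) \<partial>disc_borel)"
    proof (intro nn_integral_cong_AE eventually_mono[OF AE_disc_borel])
      fix w assume w: "0 < defect w \<and> defect w < 1 \<and> cmod w < 1 \<and> w \<noteq> 0"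
      have e: "b + - 1 / p = -1" using b by simp
      have "defect w powr b * defect w powr (- 1 / p) = defect w powr (-1)"
        unfolding powr_add[symmetric] e ..
      also have "\<dots> = 1 / defect w" using w by (simp add: powr_minus_divide)
      finally have "defect w powr b * defect w powr (- 1 / p) = 1 / defect w" .
      then show "ennreal (\<phi> (defect w)) = ennreal (1 / defect w) * indicator {exp (- real n)<..<1} (defect w)"
        by (auto simp: \<phi>_def annulus_power_def indicator_def)
    qed
    also have "\<dots> = ennreal (real n)"
      using n by (subst nn_integral_disc_inverse) (auto simp: ln_div)
    finally have I: "(\<integral>w. \<phi> (defect w) \<partial>disc_borel) = real n"
      by (subst (asm) ennreal_inj) (auto intro!: Bochner_Integration.integral_nonneg simp: \<phi>_def annulus_power_nonneg)
    have "integrable disc_borel (\<lambda>w. T_kernel b c z w * f n w)"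
      by (rule int[OF z]) (auto intro: measurable_T_kernel_pair cmod_T_kernel)
    then have "(\<integral>w. T_kernel b c z w * f n w \<partial>disc_borel) = of_real (real n)"
      unfolding eq by (subst integral_radial_monomial[OF c z]) (auto simp: I kernel_coeff_def)
    then show ?thesis by simp
  qed
  \<comment> \<open>The input is nonnegative, so the integral for S is the integral of the moduli,
    which dominates the one for T.\<close>
  have S: "real n \<le> cmod (\<integral>w. S_kernel b c z w * f n w \<partial>disc_borel)" if z: "cmod z < 1" and n: "1 \<le> n" for z n
  proof -
    have intS: "integrable disc_borel (\<lambda>w. S_kernel b c z w * f n w)"
      by (rule int[OF z]) (auto intro: measurable_S_kernel_pair cmod_S_kernel)
    have intT: "integrable disc_borel (\<lambda>w. T_kernel b c z w * f n w)"
      by (rule int[OF z]) (auto intro: measurable_T_kernel_pair cmod_T_kernel)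
    have "ennreal (real n) = ennreal (cmod (\<integral>w. T_kernel b c z w * f n w \<partial>disc_borel))" by (simp add: T[OF z n])
    also have "\<dots> \<le> (\<integral>\<^sup>+w. ennreal (cmod (T_kernel b c z w * f n w)) \<partial>disc_borel)"
      by (rule integral_norm_bound_ennreal[OF intT])
    also have "\<dots> = pos_op b c (\<lambda>w. ennreal (annulus_power (- 1 / p) (exp (- real n)) 1 (defect w))) z"
      by (simp add: pos_op_def f_def norm_mult cmod_T_kernel ennreal_mult disc_kernel_nonneg annulus_power_nonneg)
    also have "\<dots> = ennreal (cmod (\<integral>w. S_kernel b c z w * f n w \<partial>disc_borel))"
      unfolding f_def by (rule cmod_S_integral[symmetric]) (use intS in \<open>auto simp: f_def annulus_power_nonneg\<close>)
    finally show ?thesis by (simp add: ennreal_le_iff)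
  qed
  have unbounded: "\<not> disc_op_bounded a K (Lp_norm (ereal p)) (weak_Lp_norm 1)"
    if K: "(\<lambda>x. K (fst x) (snd x)) \<in> borel_measurable (borel \<Otimes>\<^sub>M borel)"
      and ge: "\<And>z n. cmod z < 1 \<Longrightarrow> 1 \<le> n \<Longrightarrow> real n \<le> cmod (\<integral>w. K z w * f n w \<partial>disc_borel)" for K
  proof
    assume "disc_op_bounded a K (Lp_norm (ereal p)) (weak_Lp_norm 1)"
    then have "disc_op_bounded a K (Lp_norm (ereal p)) (weak_Lp_norm (ereal 1))" by (simp add: one_ereal_def)
    note bdd = this
    obtain C where C: "\<forall>f X t m. f \<in> borel_measurable borel \<longrightarrow> 0 \<le> X \<longrightarrow> Lp_norm (ereal p) f \<le> ennreal X \<longrightarrow> 0 < t \<longrightarrow> 0 < (1::real) \<longrightarrow> 0 \<le> m \<longrightarrow>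
      m \<le> measure disc_borel {z. t < defect z powr a * cmod (\<integral>w. K z w * f w \<partial>disc_borel)} \<longrightarrow> t * m powr (1 / 1) \<le> C * X"
      using disc_op_bounded_imp_weak_type[OF bdd K] by (elim exE) (rule that)
    have "1 / 2 * real n powr 1 \<le> C * real n powr (1 / p)" if n: "1 \<le> n" for n
    proof -
      have "real n / 2 * 1 powr (1 / 1) \<le> C * real n powr (1 / p)"
      proof (rule C[rule_format])
        show "Lp_norm (ereal p) (f n) \<le> ennreal (real n powr (1 / p))"
          using Lp_norm_annulus_power[of "exp (- real n)" 1 p] n p by (simp add: f_def[abs_def] ln_div)
        have "measure disc_borel {z. real n / 2 < defect z powr a * cmod (\<integral>w. K z w * f n w \<partial>disc_borel)} = measure disc_borel UNIV"
        proof (rule measure_eq_AE)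
          show "AE z in disc_borel. (z \<in> {z. real n / 2 < defect z powr a * cmod (\<integral>w. K z w * f n w \<partial>disc_borel)}) = (z \<in> UNIV)"
          proof (rule eventually_mono[OF AE_disc_borel])
            fix z assume z: "0 < defect z \<and> defect z < 1 \<and> cmod z < 1 \<and> z \<noteq> 0"
            have "1 \<le> defect z powr a" using z a powr_mono2'[of a "defect z" 1] by simp
            then have "1 * real n \<le> defect z powr a * cmod (\<integral>w. K z w * f n w \<partial>disc_borel)"
              using z n by (intro mult_mono ge) auto
            then show "(z \<in> {z. real n / 2 < defect z powr a * cmod (\<integral>w. K z w * f n w \<partial>disc_borel)}) = (z \<in> UNIV)"
              using n by auto
          qed
          have "disc_op a K (f n) \<in> borel_measurable borel" by (rule disc_op_eq(2)[OF _ K]) measurable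
          then have "{z. real n / 2 < cmod (disc_op a K (f n) z)} \<in> sets borel" by measurable
          then show "{z. real n / 2 < defect z powr a * cmod (\<integral>w. K z w * f n w \<partial>disc_borel)} \<in> sets disc_borel"
            by (simp add: disc_op_eq(1)[OF _ K] norm_mult)
        qed simp
        then show "1 \<le> measure disc_borel {z. real n / 2 < defect z powr a * cmod (\<integral>w. K z w * f n w \<partial>disc_borel)}"
          using disc_borel.prob_space by simp
      qed (use n in auto)
      then show ?thesis using n by simp
    qed
    from powr_growth_contradiction[OF _ _ this] show False using p by simp
  qed
  show "\<not> T_bounded a b c (Lp_norm (ereal p)) (weak_Lp_norm 1)"
    by (rule unbounded[OF measurable_T_kernel_pair]) (simp add: T)
  show "\<not> S_bounded a b c (Lp_norm (ereal p)) (weak_Lp_norm 1)"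
    by (rule unbounded[OF measurable_S_kernel_pair S])
qed

text \<open>A converse to the averaged kernel bound in the region u > v. The circle estimate is used
  at the scale 2 u, since 1 - |z w| <= (1 - |z|) + (1 - |w|) <= 2 u; the condition u < 1/2 keeps
  this scale below 1, and the constant comes from (2 u / 64) (4 u)^(-c).\<close>

lemma pos_op_radial_ge:
  assumes c: "0 < c" and [measurable]: "\<phi> \<in> borel_measurable borel" and \<phi>: "\<And>x. 0 \<le> \<phi> x"
    and supp: "\<And>x. \<phi> x \<noteq> 0 \<Longrightarrow> defect z < x \<and> x < 1 / 2" and z: "cmod z < 1"
  shows "ennreal (4 powr (-c) / 32) * (\<integral>\<^sup>+w. ennreal (defect w powr (b + 1 - c) * \<phi> (defect w)) \<partial>disc_borel) \<le>
    pos_op b c (\<lambda>w. ennreal (\<phi> (defect w))) z"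
proof -
  interpret P: pair_sigma_finite circle_measure disc_borel ..
  have "pos_op b c (\<lambda>w. ennreal (\<phi> (defect w))) z = (\<integral>\<^sup>+\<zeta>. pos_op b c (\<lambda>w. ennreal (\<phi> (defect w))) (\<zeta> * z) \<partial>circle_measure)"
    by (rule pos_op_radial_average[where \<phi> = "\<lambda>x. ennreal (\<phi> x)"]) measurable
  also have "\<dots> = (\<integral>\<^sup>+w. \<integral>\<^sup>+\<zeta>. ennreal (disc_kernel b c (\<zeta> * z) w) * ennreal (\<phi> (defect w)) \<partial>circle_measure \<partial>disc_borel)"
    unfolding pos_op_def by (subst P.Fubini') auto
  also have "\<dots> = (\<integral>\<^sup>+w. (\<integral>\<^sup>+\<zeta>. ennreal (disc_kernel b c (\<zeta> * z) w) \<partial>circle_measure) * ennreal (\<phi> (defect w)) \<partial>disc_borel)"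
    by (subst nn_integral_multc) auto
  finally have eq: "pos_op b c (\<lambda>w. ennreal (\<phi> (defect w))) z = \<dots>" .
  have "ennreal (4 powr (-c) / 32) * (\<integral>\<^sup>+w. ennreal (defect w powr (b + 1 - c) * \<phi> (defect w)) \<partial>disc_borel) =
      (\<integral>\<^sup>+w. ennreal (4 powr (-c) / 32) * ennreal (defect w powr (b + 1 - c) * \<phi> (defect w)) \<partial>disc_borel)"
    by (rule nn_integral_cmult[symmetric]) measurable
  also have "\<dots> \<le> (\<integral>\<^sup>+w. (\<integral>\<^sup>+\<zeta>. ennreal (disc_kernel b c (\<zeta> * z) w) \<partial>circle_measure) * ennreal (\<phi> (defect w)) \<partial>disc_borel)"
  proof (intro nn_integral_mono_AE eventually_mono[OF AE_disc_borel])
    fix w assume w: "0 < defect w \<and> defect w < 1 \<and> cmod w < 1 \<and> w \<noteq> 0"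
    show "ennreal (4 powr (-c) / 32) * ennreal (defect w powr (b + 1 - c) * \<phi> (defect w)) \<le>
      (\<integral>\<^sup>+\<zeta>. ennreal (disc_kernel b c (\<zeta> * z) w) \<partial>circle_measure) * ennreal (\<phi> (defect w))"
    proof (cases "\<phi> (defect w) = 0")
      case False
      define u where "u = defect w"
      have u: "defect z < u" "u < 1 / 2" "0 < u" using supp[OF False] w by (auto simp: u_def)
      have "1 - cmod x \<le> defect x" if "cmod x < 1" for x
        using that mult_left_mono[of "cmod x" 1 "cmod x"] by (simp add: defect_def power2_eq_square)
      from this[OF z] this[of w] w have le: "1 - cmod z \<le> defect z" "1 - cmod w \<le> u" by (auto simp: u_def)
      have zw: "1 - 2 * u \<le> cmod (z * cnj w)"
      proof -
        have "0 \<le> (1 - cmod z) * (1 - cmod w)" using z w by (intro mult_nonneg_nonneg) auto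
        then have "cmod z + cmod w - 1 \<le> cmod z * cmod w" by (simp add: algebra_simps)
        then show ?thesis using le u by (simp add: norm_mult)
      qed
      have "ennreal (u powr b) * ennreal (2 * u / 64 * (2 * (2 * u)) powr (-c)) \<le>
          ennreal (u powr b) * (\<integral>\<^sup>+\<zeta>. ennreal (cmod (1 - \<zeta> * (z * cnj w)) powr (-c)) \<partial>circle_measure)"
        using w u by (intro mult_left_mono circle_kernel_ge c zw cmod_mult_cnj_less_1 z) auto
      also have "\<dots> = (\<integral>\<^sup>+\<zeta>. ennreal (u powr b) * ennreal (cmod (1 - \<zeta> * (z * cnj w)) powr (-c)) \<partial>circle_measure)"
        by (rule nn_integral_cmult[symmetric]) measurable
      also have "\<dots> = (\<integral>\<^sup>+\<zeta>. ennreal (disc_kernel b c (\<zeta> * z) w) \<partial>circle_measure)"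
        by (simp add: disc_kernel_def u_def ennreal_mult mult.assoc)
      also have "ennreal (u powr b) * ennreal (2 * u / 64 * (2 * (2 * u)) powr (-c)) = ennreal (4 powr (-c) / 32 * u powr (b + 1 - c))"
      proof -
        have "(2 * (2 * u)) powr (-c) = 4 powr (-c) * u powr (-c)" using u by (subst powr_mult[symmetric]) auto
        moreover have "u powr (b + 1 - c) = u powr b * u * u powr (-c)"
          using u by (simp add: powr_add powr_diff powr_minus_divide)
        ultimately show ?thesis using u by (simp add: ennreal_mult[symmetric] mult_ac)
      qed
      finally have "ennreal (4 powr (-c) / 32 * u powr (b + 1 - c)) * ennreal (\<phi> u) \<le>
          (\<integral>\<^sup>+\<zeta>. ennreal (disc_kernel b c (\<zeta> * z) w) \<partial>circle_measure) * ennreal (\<phi> u)"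
        by (rule mult_right_mono) simp
      then show ?thesis
        using \<phi>[of u] by (simp add: u_def[symmetric] ennreal_mult[symmetric] mult.assoc)
    qed simp
  qed
  finally show ?thesis unfolding eq .
qed

text \<open>At 1/p = \<sigma> the averaged kernel for u > v times u^(-1/p) is of order 1/u. So for v
  < \<delta> the integral is at least a multiple of n = ln (1 / (2 \<delta>)), against a norm
  n^(1/p).\<close>

lemma S_unbounded_corner:
  assumes c: "1 < c" and a: "a < 0" and p: "1 < p" and \<sigma>: "1 / p = b + 2 - c"
  shows "\<not> S_bounded a b c (Lp_norm (ereal p)) (weak_Lp_norm (ereal (- 1 / a)))"
proof
  assume "S_bounded a b c (Lp_norm (ereal p)) (weak_Lp_norm (ereal (- 1 / a)))"
  note bdd = this
  obtain C where C: "\<forall>f X t m. f \<in> borel_measurable borel \<longrightarrow> 0 \<le> X \<longrightarrow> Lp_norm (ereal p) f \<le> ennreal X \<longrightarrow> 0 < t \<longrightarrow> 0 < - 1 / a \<longrightarrow> 0 \<le> m \<longrightarrow>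
      m \<le> measure disc_borel {z. t < defect z powr a * cmod (\<integral>w. S_kernel b c z w * f w \<partial>disc_borel)} \<longrightarrow> t * m powr (1 / (- 1 / a)) \<le> C * X"
    using disc_op_bounded_imp_weak_type[OF bdd measurable_S_kernel_pair] by (elim exE) (rule that)
  define k where "k = 4 powr (-c) / 32"
  have k: "0 < k" by (simp add: k_def)
  have "k * real n powr 1 \<le> C * real n powr (1 / p)" if n: "1 \<le> n" for n :: nat
  proof -
    define \<delta> where "\<delta> = exp (- real n) / 2"
    have \<delta>: "0 < \<delta>" "\<delta> < 1 / 2" "ln (1 / 2 / \<delta>) = real n" using n by (auto simp: \<delta>_def ln_div)
    define \<phi> where "\<phi> = annulus_power (- 1 / p) \<delta> (1 / 2)"
    have [measurable]: "\<phi> \<in> borel_measurable borel" unfolding \<phi>_def by measurable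
    define f where "f w = complex_of_real (\<phi> (defect w))" for w
    have [measurable]: "f \<in> borel_measurable borel" unfolding f_def by measurable
    have ge: "k * real n \<le> cmod (\<integral>w. S_kernel b c z w * f w \<partial>disc_borel)" if z: "cmod z < 1" "defect z < \<delta>" for z
    proof -
      have "ennreal (k * real n) = ennreal k * ennreal (real n)" using k by (simp add: ennreal_mult)
      also have "ennreal (real n) = (\<integral>\<^sup>+w. ennreal (1 / defect w) * indicator {\<delta><..<1/2} (defect w) \<partial>disc_borel)"
        using \<delta> by (subst nn_integral_disc_inverse) auto
      also have "\<dots> = (\<integral>\<^sup>+w. ennreal (defect w powr (b + 1 - c) * \<phi> (defect w)) \<partial>disc_borel)"
      proof (intro nn_integral_cong_AE eventually_mono[OF AE_disc_borel])
        fix w assume w: "0 < defect w \<and> defect w < 1 \<and> cmod w < 1 \<and> w \<noteq> 0"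
        have e: "b + 1 - c + - 1 / p = -1" using \<sigma> by simp
        have "defect w powr (b + 1 - c) * defect w powr (- 1 / p) = defect w powr (-1)"
          unfolding powr_add[symmetric] e ..
        also have "\<dots> = 1 / defect w" using w by (simp add: powr_minus_divide)
        finally show "ennreal (1 / defect w) * indicator {\<delta><..<1/2} (defect w) = ennreal (defect w powr (b + 1 - c) * \<phi> (defect w))"
          by (auto simp: \<phi>_def annulus_power_def indicator_def)
      qed
      also have "ennreal k * \<dots> \<le> pos_op b c (\<lambda>w. ennreal (\<phi> (defect w))) z"
        unfolding k_def using c z
        by (intro pos_op_radial_ge) (auto simp: \<phi>_def annulus_power_def split: if_splits)
      also have "\<dots> = ennreal (cmod (\<integral>w. S_kernel b c z w * f w \<partial>disc_borel))"
        unfolding f_def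
      proof (rule cmod_S_integral[symmetric])
        show "integrable disc_borel (\<lambda>w. S_kernel b c z w * complex_of_real (\<phi> (defect w)))"
          by (rule integrable_kernel_annulus[OF _ z(1) \<delta>(1) _ measurable_S_kernel_pair cmod_S_kernel, where M = "max 1 (\<delta> powr (- 1 / p))"])
             (use c \<delta> annulus_power_bounded[of \<delta> "1/2" "- 1 / p"] annulus_power_nonneg in \<open>auto simp: \<phi>_def annulus_power_def\<close>)
      qed (auto simp: \<phi>_def annulus_power_nonneg)
      finally show ?thesis by (simp add: ennreal_le_iff)
    qed
    have main: "(\<delta> powr a * (k * real n)) * \<delta> powr (1 / (- 1 / a)) \<le> C * real n powr (1 / p)"
    proof (rule C[rule_format])
      show "Lp_norm (ereal p) f \<le> ennreal (real n powr (1 / p))"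
        using Lp_norm_annulus_power[of \<delta> "1/2" p] \<delta> p by (simp add: f_def[abs_def] \<phi>_def)
      have "measure disc_borel {w. 0 < defect w \<and> defect w < \<delta>} \<le>
          measure disc_borel {z. \<delta> powr a * (k * real n) < defect z powr a * cmod (\<integral>w. S_kernel b c z w * f w \<partial>disc_borel)}"
      proof (rule disc_borel.finite_measure_mono)
        show "{w. 0 < defect w \<and> defect w < \<delta>} \<subseteq> {z. \<delta> powr a * (k * real n) < defect z powr a * cmod (\<integral>w. S_kernel b c z w * f w \<partial>disc_borel)}"
        proof safe
          fix z assume z: "0 < defect z" "defect z < \<delta>"
          then have z1: "cmod z < 1" by (simp add: defect_def abs_square_less_1)
          have "\<delta> powr a * (k * real n) < defect z powr a * (k * real n)"
            using z a k n by (intro mult_strict_right_mono powr_less_mono2_neg) auto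
          also have "\<dots> \<le> defect z powr a * cmod (\<integral>w. S_kernel b c z w * f w \<partial>disc_borel)"
            by (intro mult_left_mono ge z1 z) auto
          finally show "\<delta> powr a * (k * real n) < defect z powr a * cmod (\<integral>w. S_kernel b c z w * f w \<partial>disc_borel)" .
        qed
        have "disc_op a (S_kernel b c) f \<in> borel_measurable borel" by (rule disc_op_eq(2)[OF _ measurable_S_kernel_pair]) measurable
        then have "{z. \<delta> powr a * (k * real n) < cmod (disc_op a (S_kernel b c) f z)} \<in> sets borel" by measurable
        then show "{z. \<delta> powr a * (k * real n) < defect z powr a * cmod (\<integral>w. S_kernel b c z w * f w \<partial>disc_borel)} \<in> disc_borel.events"
          by (simp add: disc_op_eq(1)[OF _ measurable_S_kernel_pair] norm_mult)
      qed
      then show "\<delta> \<le> measure disc_borel {z. \<delta> powr a * (k * real n) < defect z powr a * cmod (\<integral>w. S_kernel b c z w * f w \<partial>disc_borel)}"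
        using measure_defect_interval[of 0 \<delta>] \<delta> by simp
    qed (use n \<delta> k a in \<open>auto simp: divide_neg_neg\<close>)
    \<comment> \<open>Because q = -1/a, the size of the outer weight at defect \<delta> and the
      measure \<delta> of the region cancel, and only the logarithm is left.\<close>
    have "\<delta> powr a * \<delta> powr (1 / (- 1 / a)) = 1"
      using \<delta> by (simp flip: powr_add)
    then have eq: "(\<delta> powr a * (k * real n)) * \<delta> powr (1 / (- 1 / a)) = k * real n"
      by (metis (no_types, lifting) mult.assoc mult.commute mult_1)
    show ?thesis using main n unfolding eq by simp
  qed
  from powr_growth_contradiction[OF k _ this] show False using p by simp
qed

section \<open>Moments of sums with random signs\<close>

definition signed_sum :: "nat set \<Rightarrow> (nat \<Rightarrow> complex) \<Rightarrow> nat set \<Rightarrow> complex" where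
  "signed_sum I x B = (\<Sum>k\<in>I. (if k \<in> B then 1 else -1) * x k)"

lemma signed_sum_insert:
  assumes "finite I" "k \<notin> I" "B \<subseteq> I"
  shows "signed_sum (insert k I) x B = signed_sum I x B - x k"
    and "signed_sum (insert k I) x (insert k B) = signed_sum I x B + x k"
proof -
  have "(\<Sum>j\<in>I. (if j = k \<or> j \<in> B then 1 else -1) * x j) = (\<Sum>j\<in>I. (if j \<in> B then 1 else -1) * x j)"
    using assms by (intro sum.cong) auto
  then show "signed_sum (insert k I) x B = signed_sum I x B - x k"
    "signed_sum (insert k I) x (insert k B) = signed_sum I x B + x k"
    using assms by (auto simp: signed_sum_def)
qed

lemma sum_Pow_insert:
  fixes f :: "'a set \<Rightarrow> real"
  assumes "finite I" "k \<notin> I"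
  shows "(\<Sum>B\<in>Pow (insert k I). f B) = (\<Sum>B\<in>Pow I. f B + f (insert k B))"
proof -
  have "inj_on (insert k) (Pow I)"
    using assms by (auto simp: inj_on_def)
  then have "(\<Sum>B\<in>insert k ` Pow I. f B) = (\<Sum>B\<in>Pow I. f (insert k B))"
    by (subst sum.reindex) auto
  moreover have "Pow I \<inter> insert k ` Pow I = {}" using assms by auto
  ultimately show ?thesis
    using assms by (simp add: Pow_insert sum.union_disjoint sum.distrib)
qed

text \<open>\<open>B\<close> is the set of indices with sign +, so averaging over signs means
  summing over \<open>Pow I\<close>. The induction pairs B with \<open>insert k B\<close>, and the
  parallelogram law adds the two values.\<close>

lemma signed_sum_moment2:
  "finite I \<Longrightarrow> (\<Sum>B\<in>Pow I. (cmod (signed_sum I x B))\<^sup>2) = 2 ^ card I * (\<Sum>k\<in>I. (cmod (x k))\<^sup>2)"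
proof (induction I rule: finite_induct)
  case (insert k I)
  have par: "(cmod (u - y))\<^sup>2 + (cmod (u + y))\<^sup>2 = 2 * (cmod u)\<^sup>2 + 2 * (cmod y)\<^sup>2" for u y
    unfolding cmod_power2 by (simp add: power2_eq_square algebra_simps)
  have "(\<Sum>B\<in>Pow (insert k I). (cmod (signed_sum (insert k I) x B))\<^sup>2) =
      (\<Sum>B\<in>Pow I. 2 * (cmod (signed_sum I x B))\<^sup>2 + 2 * (cmod (x k))\<^sup>2)"
    unfolding sum_Pow_insert[OF insert.hyps]
    by (intro sum.cong refl) (simp add: signed_sum_insert insert.hyps par)
  also have "\<dots> = 2 * (2 ^ card I * (\<Sum>k\<in>I. (cmod (x k))\<^sup>2)) + 2 ^ card I * (2 * (cmod (x k))\<^sup>2)"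
    using insert by (simp add: sum.distrib sum_distrib_left[symmetric] card_Pow)
  finally show ?case using insert.hyps by (simp add: algebra_simps)
qed (simp add: signed_sum_def)

text \<open>Khintchine's inequality for the fourth moment, by the same pairing. The induction closes
  because 3 A^2 + 6 A Y + Y^2 <= 3 (A + Y)^2.\<close>

lemma signed_sum_moment4:
  "finite I \<Longrightarrow> (\<Sum>B\<in>Pow I. (cmod (signed_sum I x B)) ^ 4) \<le> 2 ^ card I * (3 * (\<Sum>k\<in>I. (cmod (x k))\<^sup>2)\<^sup>2)"
proof (induction I rule: finite_induct)
  case (insert k I)
  define A where "A = (\<Sum>k\<in>I. (cmod (x k))\<^sup>2)"
  define Y where "Y = (cmod (x k))\<^sup>2"
  have par: "(cmod (u - y)) ^ 4 + (cmod (u + y)) ^ 4 \<le> 2 * (cmod u) ^ 4 + 12 * (cmod u)\<^sup>2 * (cmod y)\<^sup>2 + 2 * (cmod y) ^ 4" for u y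
  proof -
    define r where "r = Re u * Re y + Im u * Im y"
    have r2: "r\<^sup>2 \<le> (cmod u)\<^sup>2 * (cmod y)\<^sup>2"
    proof -
      have "(cmod u)\<^sup>2 * (cmod y)\<^sup>2 = r\<^sup>2 + (Re u * Im y - Im u * Re y)\<^sup>2"
        unfolding cmod_power2 r_def by (simp add: power2_eq_square algebra_simps)
      then show ?thesis by simp
    qed
    have "(cmod (u - y))\<^sup>2 = (cmod u)\<^sup>2 + (cmod y)\<^sup>2 - 2 * r" "(cmod (u + y))\<^sup>2 = (cmod u)\<^sup>2 + (cmod y)\<^sup>2 + 2 * r"
      unfolding cmod_power2 r_def by (simp_all add: power2_eq_square algebra_simps)
    moreover have "t ^ 4 = (t\<^sup>2)\<^sup>2" for t :: real by (simp flip: power_mult)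
    ultimately have "(cmod (u - y)) ^ 4 + (cmod (u + y)) ^ 4 = 2 * ((cmod u)\<^sup>2 + (cmod y)\<^sup>2)\<^sup>2 + 8 * r\<^sup>2"
      by (simp only:) (simp add: power2_eq_square algebra_simps)
    also have "\<dots> \<le> 2 * ((cmod u)\<^sup>2 + (cmod y)\<^sup>2)\<^sup>2 + 8 * ((cmod u)\<^sup>2 * (cmod y)\<^sup>2)"
      using r2 by simp
    also have "\<dots> = 2 * (cmod u) ^ 4 + 12 * (cmod u)\<^sup>2 * (cmod y)\<^sup>2 + 2 * (cmod y) ^ 4"
      by (simp add: power2_eq_square power4_eq_xxxx algebra_simps)
    finally show ?thesis .
  qed
  have "(\<Sum>B\<in>Pow (insert k I). (cmod (signed_sum (insert k I) x B)) ^ 4) \<le>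
      (\<Sum>B\<in>Pow I. 2 * (cmod (signed_sum I x B)) ^ 4 + 12 * (cmod (signed_sum I x B))\<^sup>2 * Y + 2 * Y\<^sup>2)"
    unfolding sum_Pow_insert[OF insert.hyps]
  proof (rule sum_mono)
    fix B assume B: "B \<in> Pow I"
    show "(cmod (signed_sum (insert k I) x B)) ^ 4 + (cmod (signed_sum (insert k I) x (insert k B))) ^ 4 \<le>
      2 * (cmod (signed_sum I x B)) ^ 4 + 12 * (cmod (signed_sum I x B))\<^sup>2 * Y + 2 * Y\<^sup>2"
      using par[of "signed_sum I x B" "x k"] B insert.hyps
      by (simp add: signed_sum_insert Y_def flip: power_mult)
  qed
  also have "\<dots> = 2 * (\<Sum>B\<in>Pow I. (cmod (signed_sum I x B)) ^ 4) + 12 * (2 ^ card I * A) * Y + 2 ^ card I * (2 * Y\<^sup>2)"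
    using insert.hyps
    by (simp add: sum.distrib sum_distrib_left[symmetric] sum_distrib_right[symmetric] card_Pow signed_sum_moment2 A_def mult.assoc)
  also have "\<dots> \<le> 2 * (2 ^ card I * (3 * A\<^sup>2)) + 12 * (2 ^ card I * A) * Y + 2 ^ card I * (2 * Y\<^sup>2)"
    using insert.IH by (simp add: A_def)
  also have "\<dots> = 2 ^ card (insert k I) * (3 * A\<^sup>2 + 6 * A * Y + Y\<^sup>2)"
    using insert.hyps by (simp add: algebra_simps)
  also have "\<dots> \<le> 2 ^ card (insert k I) * (3 * (Y + A)\<^sup>2)"
    by (intro mult_left_mono) (auto simp: power2_eq_square algebra_simps)
  finally show ?case using insert.hyps by (simp add: A_def Y_def)
qed (simp add: signed_sum_def)

text \<open>A Paley--Zygmund argument with the moments above.\<close>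

lemma signed_sum_large:
  assumes I: "finite I" and A: "0 < (\<Sum>k\<in>I. (cmod (x k))\<^sup>2)"
  shows "2 ^ card I / 12 \<le> real (card {B \<in> Pow I. (\<Sum>k\<in>I. (cmod (x k))\<^sup>2) / 2 < (cmod (signed_sum I x B))\<^sup>2})"
proof -
  define A where "A = (\<Sum>k\<in>I. (cmod (x k))\<^sup>2)"
  have A0: "0 < A" using A by (simp add: A_def)
  define S where "S B = (cmod (signed_sum I x B))\<^sup>2" for B
  \<comment> \<open>For large S this is (S - 6 A)^2 >= 0. On average the second term is at most A /
    4 by the fourth moment, so the indicator term with its factor 3 A has to supply the missing A /
    4: hence the proportion 1 / 12.\<close>
  have pw: "S B \<le> A / 2 + (S B)\<^sup>2 / (12 * A) + 3 * A * (if A / 2 < S B then 1 else 0)" for B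
  proof (cases "A / 2 < S B")
    case True
    have "0 \<le> (S B - 6 * A)\<^sup>2" by simp
    then have "S B * (12 * A) \<le> (S B)\<^sup>2 + 3 * A * (12 * A)" by (simp add: power2_eq_square algebra_simps)
    then have "S B \<le> (S B)\<^sup>2 / (12 * A) + 3 * A" using A0 by (simp add: field_simps)
    then show ?thesis using True A0 by simp
  qed (use A0 in \<open>simp add: add_increasing2\<close>)
  have "2 ^ card I * A = (\<Sum>B\<in>Pow I. S B)"
    using signed_sum_moment2[OF I, of x] by (simp add: S_def A_def)
  also have "\<dots> \<le> (\<Sum>B\<in>Pow I. A / 2 + (S B)\<^sup>2 / (12 * A) + 3 * A * (if A / 2 < S B then 1 else 0))"
    by (intro sum_mono pw)
  also have "\<dots> = 2 ^ card I * (A / 2) + (\<Sum>B\<in>Pow I. (S B)\<^sup>2) / (12 * A) + 3 * A * (\<Sum>B\<in>Pow I. if A / 2 < S B then 1 else 0)"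
    using I by (simp add: sum.distrib sum_distrib_left[symmetric] sum_divide_distrib[symmetric] card_Pow)
  also have "(\<Sum>B\<in>Pow I. if A / 2 < S B then 1 else 0) = real (card {B \<in> Pow I. A / 2 < S B})"
    using I by (simp add: sum.If_cases Int_def)
  also have "(\<Sum>B\<in>Pow I. (S B)\<^sup>2) / (12 * A) \<le> (2 ^ card I * (3 * A\<^sup>2)) / (12 * A)"
    using signed_sum_moment4[OF I, of x] A0 by (intro divide_right_mono) (auto simp: S_def A_def simp flip: power_mult)
  also have "(2 ^ card I * (3 * A\<^sup>2)) / (12 * A) = 2 ^ card I * A / 4"
    using A0 by (simp add: power2_eq_square field_simps)
  finally have "2 ^ card I * A \<le> 2 ^ card I * (A / 2) + 2 ^ card I * A / 4 + 3 * A * real (card {B \<in> Pow I. A / 2 < S B})"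
    by simp
  moreover have "2 ^ card I * (A / 2) = 2 ^ card I * A / 2" by simp
  ultimately have "2 ^ card I * A / 12 \<le> A * real (card {B \<in> Pow I. A / 2 < S B})" by linarith
  then have "A * (2 ^ card I / 12) \<le> A * real (card {B \<in> Pow I. A / 2 < S B})" by (simp add: mult.commute)
  then show ?thesis using A0 by (simp add: S_def A_def)
qed

section \<open>A lacunary counterexample for T at the corner\<close>

lemma kernel_coeff_lower_bound:
  assumes c: "0 < c"
  shows "\<exists>\<kappa>>0. \<exists>n0. \<forall>n\<ge>n0. \<kappa> * real n powr (c - 1) \<le> kernel_coeff c n"
proof -
  \<comment> \<open>Up to sign the Taylor coefficient is the binomial coefficient with upper entry
    -c; half of its limiting constant 1 / Gamma c serves as \<kappa>.\<close>
  have lim: "(\<lambda>n. ((- c) gchoose n) / ((-1)^n / exp ((- c + 1) * of_real (ln (real n))))) \<longlonglongrightarrow> inverse (Gamma (- (- c)))"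
    by (rule gbinomial_asymptotic)
  have G: "0 < inverse (Gamma c)" using c by (simp add: Gamma_real_pos)
  have "\<forall>\<^sub>F n in sequentially. inverse (Gamma c) / 2 < ((- c) gchoose n) / ((-1)^n / exp ((- c + 1) * of_real (ln (real n))))"
    using order_tendstoD(1)[OF lim, of "inverse (Gamma c) / 2"] G by simp
  then have "\<forall>\<^sub>F n in sequentially. inverse (Gamma c) / 2 * real n powr (c - 1) \<le> kernel_coeff c n"
    using eventually_gt_at_top[of 0]
  proof eventually_elim
    case (elim n)
    have e: "exp ((- c + 1) * of_real (ln (real n))) = inverse (real n powr (c - 1))"
      using elim by (simp add: powr_def exp_minus[symmetric] algebra_simps)
    have s: "(-1::real) ^ n * (-1) ^ n = 1" by (simp flip: power_mult_distrib)
    have "((- c) gchoose n) / ((-1)^n / exp ((- c + 1) * of_real (ln (real n)))) = (((-1) ^ n * (-1) ^ n) * kernel_coeff c n) / real n powr (c - 1)"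
      unfolding e gbinomial_pochhammer kernel_coeff_def
      by (simp add: field_simps minus_one_power_iff)
    then have "inverse (Gamma c) / 2 < kernel_coeff c n / real n powr (c - 1)"
      using elim unfolding s by simp
    then show ?case using elim by (simp add: field_simps)
  qed
  then obtain n0 where "\<forall>n\<ge>n0. inverse (Gamma c) / 2 * real n powr (c - 1) \<le> kernel_coeff c n"
    by (auto simp: eventually_at_top_linorder)
  then show ?thesis using G by (intro exI[of _ "inverse (Gamma c) / 2"]) auto
qed

text \<open>The sequence increases with k because (1 - y/2)^2 >= 1 - y, and it starts with (1/2)^2
  at k = 1. It bounds monomials of degree comparable to 2^k from below where the defect is less than
  2^(-k).\<close>

lemma power_one_minus_dyadic_ge:
  assumes "1 \<le> k"
  shows "1 / 4 \<le> (1 - (1/2::real) ^ k) ^ (2 ^ k)"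
  using assms
proof (induction k rule: dec_induct)
  case (step k)
  define y where "y = (1/2::real) ^ k"
  have y: "0 \<le> y" by (simp add: y_def)
  have "1 - y \<le> (1 - y / 2)\<^sup>2"
    by (simp add: power2_eq_square algebra_simps)
  then have "(1 - y) ^ (2 ^ k) \<le> ((1 - y / 2)\<^sup>2) ^ (2 ^ k)"
    by (intro power_mono) (auto simp: y_def power_le_one)
  also have "\<dots> = (1 - (1/2) ^ Suc k) ^ (2 ^ Suc k)"
    by (simp add: y_def flip: power_mult)
  finally show ?case using step.IH by (simp add: y_def)
qed (simp add: power2_eq_square)

text \<open>Blocks of L^p norm at most 1 on disjoint annuli add up to norm at most N^(1/p), while
  their images are monomials that all stay away from 0 near the unit circle. For suitable signs the
  sum of N images has size N^(1/2) on a fixed proportion of v < \<delta>, and p > 2 makes this too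
  large.\<close>

lemma T_unbounded_corner:
  assumes c: "1 < c" and a: "a < 0" and p: "2 < p" and \<sigma>: "1 / p = b + 2 - c"
  shows "\<not> T_bounded a b c (Lp_norm (ereal p)) (weak_Lp_norm (ereal (- 1 / a)))"
proof
  assume bdd: "T_bounded a b c (Lp_norm (ereal p)) (weak_Lp_norm (ereal (- 1 / a)))"
  obtain C where C: "\<forall>f X t m. f \<in> borel_measurable borel \<longrightarrow> 0 \<le> X \<longrightarrow> Lp_norm (ereal p) f \<le> ennreal X \<longrightarrow> 0 < t \<longrightarrow> 0 < - 1 / a \<longrightarrow> 0 \<le> m \<longrightarrow>
      m \<le> measure disc_borel {z. t < defect z powr a * cmod (\<integral>w. T_kernel b c z w * f w \<partial>disc_borel)} \<longrightarrow> t * m powr (1 / (- 1 / a)) \<le> C * X"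
    using disc_op_bounded_imp_weak_type[OF bdd measurable_T_kernel_pair] by (elim exE) (rule that)
  obtain \<kappa> n0 where \<kappa>: "0 < \<kappa>" and coeff: "\<And>n. n0 \<le> n \<Longrightarrow> \<kappa> * real n powr (c - 1) \<le> kernel_coeff c n"
    using kernel_coeff_lower_bound[of c] c by auto
  \<comment> \<open>From this index on 2^k >= n0, so that the lower bound for the Taylor
    coefficients applies, and also k >= 1.\<close>
  define k0 where "k0 = Suc n0"
  define \<sigma> where "\<sigma> = 1 / p"
  define lo hi where "lo k = (1/2::real) ^ Suc k" and "hi k = (1/2::real) ^ k" for k
  have lohi: "0 < lo k" "lo k < hi k" "hi k \<le> 1" "hi k = 2 * lo k" for k
    by (simp_all add: lo_def hi_def power_le_one)
  \<comment> \<open>The height 2^(k/p) compensates the measure 2^(-k-1) of the annulus. The degree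
    2^k in \<open>f\<close> is adapted to it as well: for k >= 1 the monomial stays bounded below
    there.\<close>
  define \<phi> where "\<phi> k x = (if lo k < x \<and> x < hi k then (2 powr \<sigma>) ^ k else 0)" for k x
  have [measurable]: "\<phi> k \<in> borel_measurable borel" for k unfolding \<phi>_def by measurable
  have \<phi>0: "0 \<le> \<phi> k x" for k x by (simp add: \<phi>_def)
  define f where "f k w = complex_of_real (\<phi> k (defect w)) * w ^ (2 ^ k)" for k w
  have [measurable]: "f k \<in> borel_measurable borel" for k unfolding f_def by measurable
  have f_le: "cmod (f k w) \<le> (2 powr \<sigma>) ^ k" "defect w \<le> lo k \<Longrightarrow> f k w = 0" for k w
  proof -
    have "cmod w ^ (2 ^ k) \<le> 1" if "lo k < defect w"
    proof -
      have "0 < defect w" using that lohi[of k] by simp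
      then have "cmod w < 1" by (simp add: defect_def abs_square_less_1)
      then show ?thesis by (simp add: power_le_one)
    qed
    then show "cmod (f k w) \<le> (2 powr \<sigma>) ^ k"
      using mult_left_mono[of "cmod w ^ (2 ^ k)" 1 "(2 powr \<sigma>) ^ k"] by (auto simp: f_def \<phi>_def norm_mult norm_power)
    show "f k w = 0" if "defect w \<le> lo k" using that by (simp add: f_def \<phi>_def)
  qed
  define \<gamma> where "\<gamma> k = kernel_coeff c (2 ^ k) * (\<integral>w. defect w powr b * \<phi> k (defect w) * (cmod w ^ 2) ^ (2 ^ k) \<partial>disc_borel)" for k
  have int: "integrable disc_borel (\<lambda>w. T_kernel b c z w * f k w)" if "cmod z < 1" for z k
    by (rule integrable_kernel_annulus[OF _ that lohi(1)[of k] _ measurable_T_kernel_pair cmod_T_kernel f_le]) (use c in auto)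
  have Tf: "(\<integral>w. T_kernel b c z w * f k w \<partial>disc_borel) = of_real (\<gamma> k) * z ^ (2 ^ k)" if z: "cmod z < 1" for z k
  proof -
    have eq: "T_kernel b c z w * f k w = complex_of_real (defect w powr b * \<phi> k (defect w)) * w ^ (2 ^ k) / (1 - z * cnj w) powr of_real c" for w
      by (simp add: T_kernel_def f_def defect_def)
    show ?thesis
      unfolding eq \<gamma>_def
      by (rule integral_radial_monomial[where \<phi> = "\<lambda>x. x powr b * \<phi> k x"]) (use c z int[OF z, of k] in \<open>auto simp: eq\<close>)
  qed
  \<comment> \<open>\<kappa> comes from the Taylor coefficient, 2 to the power -|b| from comparing
    u^b with its value at \<open>hi k\<close>, and 1/8 is 1/4 from the monomial times 1/2 from
    \<open>lo k\<close> being half of \<open>hi k\<close>.\<close>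
  define m where "m = \<kappa> * 2 powr (- \<bar>b\<bar>) / 8"
  have m: "0 < m" using \<kappa> by (simp add: m_def)
  have \<gamma>_ge: "m \<le> \<gamma> k" if k: "k0 \<le> k" for k
  proof -
    have "k < 2 ^ k" by (rule less_exp)
    then have k1: "1 \<le> k" and kn: "n0 \<le> 2 ^ k"
      using k unfolding k0_def by linarith+
    define M where "M = hi k powr b * 2 powr (- \<bar>b\<bar>) * (2 powr \<sigma>) ^ k * (1 / 4)"
    have ge: "M * indicator {w. lo k < defect w \<and> defect w < hi k} w \<le> defect w powr b * \<phi> k (defect w) * (cmod w ^ 2) ^ (2 ^ k)" for w
    proof (cases "lo k < defect w \<and> defect w < hi k")
      case True
      have u: "0 < defect w" using True lohi[of k] by simp
      have "hi k powr b * 2 powr (- \<bar>b\<bar>) \<le> defect w powr b"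
      proof (cases "0 \<le> b")
        case b: True
        have "hi k powr b * 2 powr (- \<bar>b\<bar>) = lo k powr b"
          using b lohi[of k] by (simp add: powr_mult powr_minus field_simps)
        also have "\<dots> \<le> defect w powr b" using b True lohi[of k] by (intro powr_mono2) auto
        finally show ?thesis .
      next
        case b: False
        have "hi k powr b * 2 powr (- \<bar>b\<bar>) \<le> hi k powr b * 1"
          using powr_mono[of "- \<bar>b\<bar>" 0 "2::real"] by (intro mult_left_mono) auto
        also have "\<dots> \<le> defect w powr b" using b True u by (simp add: powr_mono2')
        finally show ?thesis .
      qed
      moreover have "1 / 4 \<le> (cmod w ^ 2) ^ (2 ^ k)"
      proof -
        have "1 - hi k \<le> cmod w ^ 2" using True by (simp add: defect_def)
        then have "(1 - hi k) ^ (2 ^ k) \<le> (cmod w ^ 2) ^ (2 ^ k)"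
          using lohi[of k] by (intro power_mono) auto
        then show ?thesis using power_one_minus_dyadic_ge[OF k1] by (simp add: hi_def)
      qed
      ultimately have "(hi k powr b * 2 powr (- \<bar>b\<bar>)) * (2 powr \<sigma>) ^ k * (1 / 4) \<le> defect w powr b * (2 powr \<sigma>) ^ k * (cmod w ^ 2) ^ (2 ^ k)"
        by (intro mult_mono) auto
      then show ?thesis using True by (simp add: M_def \<phi>_def)
    qed (auto simp: \<phi>_def)
    have int': "integrable disc_borel (\<lambda>w. defect w powr b * \<phi> k (defect w) * (cmod w ^ 2) ^ (2 ^ k))"
    proof (rule Bochner_Integration.integrable_bound)
      show "integrable disc_borel (\<lambda>w. T_kernel b c 0 w * f k w)" by (rule int) simp
      show "AE w in disc_borel. norm (defect w powr b * \<phi> k (defect w) * (cmod w ^ 2) ^ (2 ^ k)) \<le> norm (T_kernel b c 0 w * f k w)"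
      proof (rule eventually_mono[OF AE_disc_borel_cmod])
        fix w assume w: "cmod w < 1"
        have "(cmod w ^ 2) ^ (2 ^ k) \<le> cmod w ^ (2 ^ k)"
          using w by (intro power_mono) (auto simp: power2_eq_square mult_left_le_one_le)
        then have "defect w powr b * \<phi> k (defect w) * (cmod w ^ 2) ^ (2 ^ k) \<le> defect w powr b * \<phi> k (defect w) * cmod w ^ (2 ^ k)"
          using \<phi>0 by (intro mult_left_mono) auto
        then show "norm (defect w powr b * \<phi> k (defect w) * (cmod w ^ 2) ^ (2 ^ k)) \<le> norm (T_kernel b c 0 w * f k w)"
          using \<phi>0[of k "defect w"] by (simp add: norm_mult cmod_T_kernel disc_kernel_def f_def norm_power abs_mult mult.assoc)
      qed
    qed measurable
    have "M * lo k = (\<integral>w. M * indicator {w. lo k < defect w \<and> defect w < hi k} w \<partial>disc_borel)"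
      using measure_defect_interval[of "lo k" "hi k"] lohi[of k] by simp
    also have "\<dots> \<le> (\<integral>w. defect w powr b * \<phi> k (defect w) * (cmod w ^ 2) ^ (2 ^ k) \<partial>disc_borel)"
      by (intro integral_mono int' ge integrable_mult_right integrable_real_indicator) (auto simp: disc_borel.emeasure_finite less_top[symmetric])
    finally have I: "M * lo k \<le> (\<integral>w. defect w powr b * \<phi> k (defect w) * (cmod w ^ 2) ^ (2 ^ k) \<partial>disc_borel)" .
    have "m = (\<kappa> * real (2 ^ k) powr (c - 1)) * (M * lo k)"
    proof -
      define y where "y = real k"
      have 1: "real (2 ^ k) powr (c - 1) = 2 powr (y * (c - 1))"
        by (simp add: y_def powr_powr flip: powr_realpow)
      have 2: "hi k = 2 powr (- y)" by (simp add: hi_def y_def powr_minus_divide powr_realpow power_one_over)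
      have 3: "lo k = 2 powr (- y) / 2" using lohi(4)[of k] 2 by simp
      have 4: "(2 powr \<sigma>) ^ k = 2 powr (y * \<sigma>)"
        by (simp add: y_def powr_powr mult.commute flip: powr_realpow)
      \<comment> \<open>The powers of 2^k come from the Taylor coefficient, from u^b, from the
        height and from the measure. Their exponents add up to c - 2 - b + 1/p, which is 0 at the
        corner; this keeps \<open>\<gamma>\<close> bounded below.\<close>
      have "2 powr (y * (c - 1)) * (2 powr (- y * b) * 2 powr (y * \<sigma>) * 2 powr (- y)) = 2 powr (y * (c - 1) + (- y * b + y * \<sigma> + - y))"
        by (simp only: powr_add)
      also have "y * (c - 1) + (- y * b + y * \<sigma> + - y) = y * (c - 2 - b + \<sigma>)" by (simp add: algebra_simps)
      also have "c - 2 - b + \<sigma> = 0" using assms(4) by (simp add: \<sigma>_def)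
      finally have "2 powr (y * (c - 1)) * (2 powr (- y * b) * 2 powr (y * \<sigma>) * 2 powr (- y)) = 1" by simp
      then have "m = \<kappa> * 2 powr (- \<bar>b\<bar>) / 8 * (2 powr (y * (c - 1)) * (2 powr (- y * b) * 2 powr (y * \<sigma>) * 2 powr (- y)))"
        by (simp add: m_def)
      also have "\<dots> = (\<kappa> * 2 powr (y * (c - 1))) * (2 powr (- y * b) * 2 powr (- \<bar>b\<bar>) * 2 powr (y * \<sigma>) * (1 / 4) * (2 powr (- y) / 2))"
        by (simp only: times_divide_eq_left times_divide_eq_right) (simp add: mult_ac)
      also have "2 powr (- y * b) = hi k powr b" unfolding 2 by (simp add: powr_powr)
      finally show ?thesis unfolding M_def 1 3 4 .
    qed
    also have "\<dots> \<le> kernel_coeff c (2 ^ k) * (M * lo k)"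
    proof (rule mult_right_mono[OF coeff[OF kn]])
      show "0 \<le> M * lo k" using lohi[of k] by (simp add: M_def)
    qed
    also have "\<dots> \<le> \<gamma> k"
      unfolding \<gamma>_def using kernel_coeff_pos[of c] c by (intro mult_left_mono I) (auto intro: less_imp_le)
    finally show ?thesis .
  qed
  define K where "K = 12 powr a * (m / 4) * sqrt (1 / 2)"
  have K: "0 < K" using m by (simp add: K_def)
  have "K * real N powr (1 / 2) \<le> C * real N powr \<sigma>" if N: "1 \<le> N" for N :: nat
  proof -
    define I where "I = {k0..<k0 + N}"
    have I: "finite I" "card I = N" by (simp_all add: I_def)
    define F where "F B w = signed_sum I (\<lambda>k. f k w) B" for B w
    have [measurable]: "F B \<in> borel_measurable borel" for B
    proof -
      have "(\<lambda>w. \<Sum>k\<in>I. (if k \<in> B then 1 else -1) * f k w) \<in> borel_measurable borel" by measurable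
      then show ?thesis by (simp add: F_def[abs_def] signed_sum_def)
    qed
    have disj: "k = j" if "lo k < x" "x < hi k" "lo j < x" "x < hi j" for k j x
    proof (rule ccontr)
      assume "k \<noteq> j"
      then consider "Suc k \<le> j" | "Suc j \<le> k" by linarith
      then show False
      proof cases
        case 1
        then have "hi j \<le> lo k" unfolding hi_def lo_def by (intro power_decreasing) auto
        then show False using that by simp
      next
        case 2
        then have "hi k \<le> lo j" unfolding hi_def lo_def by (intro power_decreasing) auto
        then show False using that by simp
      qed
    qed
    \<comment> \<open>On each annulus only one block is nonzero, so p-th powers add; a block
      contributes at most 2^k times the measure \<open>lo k\<close>, which is 1/2.\<close>
    have F_norm: "Lp_norm (ereal p) (F B) \<le> ennreal (real N powr \<sigma>)" for B
    proof (subst Lp_norm_le_iff)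
      have "(\<integral>\<^sup>+w. ennreal (cmod (F B w) powr p) \<partial>disc_borel) \<le>
          (\<integral>\<^sup>+w. (\<Sum>k\<in>I. ennreal (2 ^ k) * indicator {w. lo k < defect w \<and> defect w < hi k} w) \<partial>disc_borel)"
      proof (rule nn_integral_mono)
        fix w
        show "ennreal (cmod (F B w) powr p) \<le> (\<Sum>k\<in>I. ennreal (2 ^ k) * indicator {w. lo k < defect w \<and> defect w < hi k} w)"
        proof (cases "\<exists>k\<in>I. lo k < defect w \<and> defect w < hi k")
          case True
          then obtain k where k: "k \<in> I" "lo k < defect w" "defect w < hi k" by blast
          have "f j w = 0" if "j \<noteq> k" for j
            using disj[OF k(2,3), of j] that by (auto simp: f_def \<phi>_def)
          then have "F B w = (\<Sum>j\<in>{k}. (if j \<in> B then 1 else -1) * f j w)"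
            unfolding F_def signed_sum_def using k(1) I by (intro sum.mono_neutral_right) auto
          then have "cmod (F B w) \<le> (2 powr \<sigma>) ^ k" using f_le(1)[of k w] by (simp add: norm_mult)
          then have "cmod (F B w) powr p \<le> ((2 powr \<sigma>) ^ k) powr p" using p by (intro powr_mono2) auto
          also have "\<dots> = 2 ^ k"
          proof -
            have "((2 powr \<sigma>) ^ k) powr p = ((2 powr \<sigma>) powr real k) powr p" by (simp add: powr_realpow)
            also have "\<dots> = 2 powr (\<sigma> * real k * p)" by (simp add: powr_powr)
            also have "\<sigma> * real k * p = real k" using p by (simp add: \<sigma>_def)
            finally show ?thesis by (simp add: powr_realpow)
          qed
          finally have "ennreal (cmod (F B w) powr p) \<le> ennreal (2 ^ k) * indicator {w. lo k < defect w \<and> defect w < hi k} w"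
            using k by (simp add: ennreal_leI)
          also have "\<dots> \<le> (\<Sum>k\<in>I. ennreal (2 ^ k) * indicator {w. lo k < defect w \<and> defect w < hi k} w)"
            using I k(1) by (intro member_le_sum) auto
          finally show ?thesis .
        next
          case False
          then have "F B w = 0" unfolding F_def signed_sum_def by (intro sum.neutral) (auto simp: f_def \<phi>_def)
          then show ?thesis using p by simp
        qed
      qed
      also have "\<dots> = (\<Sum>k\<in>I. ennreal (2 ^ k) * emeasure disc_borel {w. lo k < defect w \<and> defect w < hi k})"
        by (subst nn_integral_sum) (auto simp: nn_integral_cmult_indicator)
      also have "\<dots> \<le> (\<Sum>k\<in>I. 1)"
      proof (rule sum_mono)
        fix k
        have "ennreal (2 ^ k) * emeasure disc_borel {w. lo k < defect w \<and> defect w < hi k} = ennreal (2 ^ k * lo k)"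
          using lohi[of k] by (subst emeasure_defect_interval) (auto simp flip: ennreal_mult)
        also have "2 ^ k * lo k = 1 / 2" by (simp add: lo_def power_divide)
        finally show "ennreal (2 ^ k) * emeasure disc_borel {w. lo k < defect w \<and> defect w < hi k} \<le> 1"
          using ennreal_leI[of "1 / 2" 1] by (simp only: ennreal_1)
      qed
      also have "\<dots> = ennreal ((real N powr \<sigma>) powr p)"
        using I p by (simp add: \<sigma>_def powr_powr ennreal_of_nat_eq_real_of_nat)
      finally show "(\<integral>\<^sup>+w. ennreal (cmod (F B w) powr p) \<partial>disc_borel) \<le> ennreal ((real N powr \<sigma>) powr p)" .
    qed (use p in auto)
    \<comment> \<open>At most \<open>hi k\<close> for every k in I, so that for v < \<delta> each of
      the N monomials still has modulus at least 1/4.\<close>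
    define \<delta> where "\<delta> = hi (k0 + N)"
    have \<delta>: "0 < \<delta>" "\<delta> \<le> 1" by (simp_all add: \<delta>_def hi_def power_le_one)
    define x where "x z k = of_real (\<gamma> k) * z ^ (2 ^ k)" for z :: complex and k
    have TF: "(\<integral>w. T_kernel b c z w * F B w \<partial>disc_borel) = signed_sum I (x z) B" if z: "cmod z < 1" for z B
    proof -
      have "(\<integral>w. T_kernel b c z w * F B w \<partial>disc_borel) = (\<integral>w. (\<Sum>k\<in>I. (if k \<in> B then 1 else -1) * (T_kernel b c z w * f k w)) \<partial>disc_borel)"
        by (intro Bochner_Integration.integral_cong refl) (simp add: F_def signed_sum_def sum_distrib_left mult.left_commute)
      also have "\<dots> = (\<Sum>k\<in>I. (if k \<in> B then 1 else -1) * (\<integral>w. T_kernel b c z w * f k w \<partial>disc_borel))"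
        using int[OF z] by (subst Bochner_Integration.integral_sum) auto
      also have "\<dots> = signed_sum I (x z) B" by (simp add: signed_sum_def x_def Tf[OF z])
      finally show ?thesis .
    qed
    have x_ge: "m / 4 \<le> cmod (x z k)" if z: "cmod z < 1" "defect z < \<delta>" and k: "k \<in> I" for z k
    proof -
      have k1: "1 \<le> k" "k0 \<le> k" "k \<le> k0 + N" using k by (auto simp: I_def k0_def)
      have "\<delta> \<le> hi k" unfolding \<delta>_def hi_def using k1 by (intro power_decreasing) auto
      then have "1 - hi k \<le> (cmod z)\<^sup>2" using z by (simp add: defect_def)
      also have "\<dots> \<le> cmod z" using z by (simp add: power2_eq_square mult_left_le_one_le)
      finally have "(1 - hi k) ^ (2 ^ k) \<le> cmod z ^ (2 ^ k)" using lohi[of k] by (intro power_mono) auto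
      then have "1 / 4 \<le> cmod z ^ (2 ^ k)" using power_one_minus_dyadic_ge[OF k1(1)] by (simp add: hi_def)
      then have "m * (1 / 4) \<le> \<gamma> k * cmod z ^ (2 ^ k)"
        using \<gamma>_ge[OF k1(2)] m by (intro mult_mono) auto
      then show ?thesis using \<gamma>_ge[OF k1(2)] m by (simp add: x_def norm_mult norm_power)
    qed
    \<comment> \<open>Its square is half of N (m / 4)^2, the lower bound for the sum of squares, and
      thus fits the threshold in \<open>signed_sum_large\<close>.\<close>
    define t0 where "t0 = (m / 4) * sqrt (real N / 2)"
    have t0: "0 < t0" using m N by (simp add: t0_def)
    define E where "E B = {z. 0 < defect z \<and> defect z < \<delta> \<and> t0 < cmod (signed_sum I (x z) B)}" for B
    have [measurable]: "E B \<in> sets borel" for B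
    proof -
      have [measurable]: "(\<lambda>z. signed_sum I (x z) B) \<in> borel_measurable borel"
        unfolding signed_sum_def x_def by measurable
      show ?thesis unfolding E_def by measurable
    qed
    \<comment> \<open>For each z with v < \<delta> at least 2^N / 12 of the sign patterns are good.
      Integrating over z and exchanging sum and integral, one fixed pattern must be good on a set of
      measure at least \<delta> / 12.\<close>
    have "2 ^ N / 12 * \<delta> \<le> (\<Sum>B\<in>Pow I. measure disc_borel (E B))"
    proof -
      have "2 ^ N / 12 * \<delta> = (\<integral>z. 2 ^ N / 12 * indicator {z. 0 < defect z \<and> defect z < \<delta>} z \<partial>disc_borel)"
        using measure_defect_interval[of 0 \<delta>] \<delta> by simp
      also have "\<dots> \<le> (\<integral>z. (\<Sum>B\<in>Pow I. indicator (E B) z) \<partial>disc_borel)"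
      proof (rule integral_mono)
        show "integrable disc_borel (\<lambda>z. 2 ^ N / 12 * indicator {z. 0 < defect z \<and> defect z < \<delta>} z :: real)"
          by (intro integrable_mult_right integrable_real_indicator) (auto simp: disc_borel.emeasure_finite less_top[symmetric])
        show "integrable disc_borel (\<lambda>z. \<Sum>B\<in>Pow I. indicator (E B) z :: real)"
          by (intro Bochner_Integration.integrable_sum integrable_real_indicator) (auto simp: disc_borel.emeasure_finite less_top[symmetric])
        fix z
        show "2 ^ N / 12 * indicator {z. 0 < defect z \<and> defect z < \<delta>} z \<le> (\<Sum>B\<in>Pow I. indicator (E B) z :: real)"
        proof (cases "0 < defect z \<and> defect z < \<delta>")
          case True
          then have z: "cmod z < 1" by (simp add: defect_def abs_square_less_1)
          have "(\<Sum>k\<in>I. (m / 4)\<^sup>2) \<le> (\<Sum>k\<in>I. (cmod (x z k))\<^sup>2)"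
            using m True by (intro sum_mono power_mono x_ge z) auto
          then have A: "real N * (m / 4)\<^sup>2 \<le> (\<Sum>k\<in>I. (cmod (x z k))\<^sup>2)" using I by simp
          moreover have "0 < real N * (m / 4)\<^sup>2" using N m by simp
          ultimately have "2 ^ card I / 12 \<le> real (card {B \<in> Pow I. (\<Sum>k\<in>I. (cmod (x z k))\<^sup>2) / 2 < (cmod (signed_sum I (x z) B))\<^sup>2})"
            using I by (intro signed_sum_large) auto
          also have "\<dots> \<le> real (card {B \<in> Pow I. z \<in> E B})"
          proof -
            have "t0 < s" if "(\<Sum>k\<in>I. (cmod (x z k))\<^sup>2) / 2 < s\<^sup>2" "0 \<le> s" for s
            proof (rule power2_less_imp_less)
              have "(sqrt (real N / 2))\<^sup>2 = real N / 2" by (rule real_sqrt_pow2) simp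
              then have "t0\<^sup>2 = real N * (m / 4)\<^sup>2 / 2"
                unfolding t0_def power_mult_distrib by (simp only:) simp
              then show "t0\<^sup>2 < s\<^sup>2" using that A by simp
            qed (use that in auto)
            then show ?thesis
              using I True by (intro of_nat_mono card_mono) (auto simp: E_def)
          qed
          also have "\<dots> = (\<Sum>B\<in>Pow I. indicator (E B) z)"
            using I by (simp add: indicator_def of_bool_def sum.If_cases Int_def)
          finally show ?thesis using True I by simp
        qed (auto intro!: sum_nonneg)
      qed
      also have "\<dots> = (\<Sum>B\<in>Pow I. measure disc_borel (E B))"
        by (subst Bochner_Integration.integral_sum) (auto simp: disc_borel.emeasure_finite less_top[symmetric] intro!: integrable_real_indicator)
      finally show ?thesis .
    qed
    have "\<exists>B\<in>Pow I. \<delta> / 12 \<le> measure disc_borel (E B)"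
    proof (rule ccontr)
      assume "\<not> ?thesis"
      then have "(\<Sum>B\<in>Pow I. measure disc_borel (E B)) < (\<Sum>B\<in>Pow I. \<delta> / 12)"
        using I by (intro sum_strict_mono) (auto simp: not_le)
      then show False using \<open>2 ^ N / 12 * \<delta> \<le> _\<close> I by (simp add: card_Pow)
    qed
    then obtain B where B: "\<delta> / 12 \<le> measure disc_borel (E B)" by blast
    have main: "(\<delta> powr a * t0) * (\<delta> / 12) powr (1 / (- 1 / a)) \<le> C * real N powr \<sigma>"
    proof (rule C[rule_format, where f = "F B"])
      have "measure disc_borel (E B) \<le> measure disc_borel {z. \<delta> powr a * t0 < defect z powr a * cmod (\<integral>w. T_kernel b c z w * F B w \<partial>disc_borel)}"
      proof (rule disc_borel.finite_measure_mono)
        show "E B \<subseteq> {z. \<delta> powr a * t0 < defect z powr a * cmod (\<integral>w. T_kernel b c z w * F B w \<partial>disc_borel)}"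
        proof safe
          fix z assume z: "z \<in> E B"
          then have z1: "cmod z < 1" by (simp add: E_def defect_def abs_square_less_1)
          have "\<delta> powr a * t0 < defect z powr a * t0"
            using z a t0 by (intro mult_strict_right_mono powr_less_mono2_neg) (auto simp: E_def)
          also have "\<dots> \<le> defect z powr a * cmod (\<integral>w. T_kernel b c z w * F B w \<partial>disc_borel)"
            unfolding TF[OF z1] using z by (intro mult_left_mono) (auto simp: E_def)
          finally show "\<delta> powr a * t0 < defect z powr a * cmod (\<integral>w. T_kernel b c z w * F B w \<partial>disc_borel)" .
        qed
        have "disc_op a (T_kernel b c) (F B) \<in> borel_measurable borel" by (rule disc_op_eq(2)[OF _ measurable_T_kernel_pair]) measurable
        then have "{z. \<delta> powr a * t0 < cmod (disc_op a (T_kernel b c) (F B) z)} \<in> sets borel" by measurable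
        then show "{z. \<delta> powr a * t0 < defect z powr a * cmod (\<integral>w. T_kernel b c z w * F B w \<partial>disc_borel)} \<in> disc_borel.events"
          by (simp add: disc_op_eq(1)[OF _ measurable_T_kernel_pair] norm_mult)
      qed
      then show "\<delta> / 12 \<le> measure disc_borel {z. \<delta> powr a * t0 < defect z powr a * cmod (\<integral>w. T_kernel b c z w * F B w \<partial>disc_borel)}"
        using B by simp
    qed (use F_norm t0 \<delta> a in \<open>auto simp: divide_neg_neg\<close>)
    \<comment> \<open>Because a + 1/q = 0 all powers of \<delta>, which is exponentially small in N,
      cancel.\<close>
    have "(\<delta> powr a * t0) * (\<delta> / 12) powr (1 / (- 1 / a)) = K * real N powr (1 / 2)"
    proof -
      have "1 / (- 1 / a) = - a" by simp
      then have "(\<delta> / 12) powr (1 / (- 1 / a)) = \<delta> powr (-a) * 12 powr a"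
        using \<delta> by (simp add: powr_divide powr_minus field_simps)
      moreover have "\<delta> powr a * \<delta> powr (-a) = 1" using \<delta> by (simp flip: powr_add)
      ultimately have "(\<delta> powr a * t0) * (\<delta> / 12) powr (1 / (- 1 / a)) = t0 * 12 powr a"
        by (metis (no_types, opaque_lifting) mult.assoc mult.commute mult_1)
      also have "sqrt (real N / 2) = sqrt (1 / 2) * real N powr (1 / 2)"
        by (simp add: powr_half_sqrt real_sqrt_divide)
      then have "t0 * 12 powr a = K * real N powr (1 / 2)" by (simp add: t0_def K_def mult_ac)
      finally show ?thesis .
    qed
    then show ?thesis using main by (simp only:)
  qed
  from powr_growth_contradiction[OF K _ this] show False using p by (simp add: \<sigma>_def)
qed

text \<open>From 1/q <= 1 and a + 2 <= c the relation gives 1/p <= 3 + a + b - c <= b + 1. Equality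
  throughout would mean q = 1 and a + 2 = c, which \<open>crit\<close> excludes. On the other side
  1/q > -a becomes 1/p > \<sigma>.\<close>

lemma T_S_bounded_diagonal:
  fixes a b c :: real and p q :: ereal
  assumes c: "1 < c" and a: "-1 < a" "a < 0" and \<sigma>: "0 < b + 2 - c" and \<kappa>: "0 < c - a - b - 2" and le: "a + 2 \<le> c"
    and p: "1 \<le> p" and q: "1 \<le> q" and diag: "1 / q = 1 / p + ereal (c - a - b - 2)" and gt: "ereal (- a) < 1 / q"
    and crit: "b + 1 \<noteq> 3 + a + b - c \<or> 1 / q < 1"
  shows "T_bounded a b c (Lp_norm p) (weak_Lp_norm q) \<and> S_bounded a b c (Lp_norm p) (weak_Lp_norm q)"
proof -
  obtain q' where q': "q = ereal q'" "1 \<le> q'"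
    using q gt a by (cases q) (auto simp: one_ereal_def)
  have qq: "1 / q = ereal (1 / q')" using q' by (simp add: one_ereal_def)
  obtain p' where p': "p = ereal p'" "1 \<le> p'"
    using p diag gt \<sigma> by (cases p) (auto simp: one_ereal_def qq)
  have pp: "1 / p = ereal (1 / p')" using p' by (simp add: one_ereal_def)
  have d: "1 / q' = 1 / p' + (c - a - b - 2)" using diag unfolding pp qq by simp
  have g: "- a < 1 / q'" using gt unfolding qq by simp
  have q1: "1 / q' \<le> 1" using q' by simp
  have "p' \<noteq> 1" using d q1 \<kappa> by auto
  then have p1: "1 < p'" using p' by simp
  have "1 / p' < b + 1"
  proof (cases "b + 1 = 3 + a + b - c")
    case True
    then have "1 / q' < 1" using crit unfolding qq by (simp add: one_ereal_def)
    then show ?thesis using True d by simp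
  qed (use d q1 le in simp)
  moreover have "q' < p'"
  proof -
    have "(p' * q') * (1 / p') < (p' * q') * (1 / q')"
      using p1 q' d \<kappa> by (intro mult_strict_left_mono) auto
    then show ?thesis using p1 q' by simp
  qed
  ultimately show ?thesis
    unfolding p' q' using c p1 \<sigma> d g q'
    by (intro T_S_bounded_Lp_large) auto
qed

theorem theorem10p4:
  fixes a b c :: real
  assumes "a > -1" "b > -1"
    and "0 < c - a - b - 2" "c - a - b - 2 < 1"
    and "a + 2 \<le> c" "c < b + 2"
  shows
    "(b + 1 \<noteq> 3 + a + b - c \<and> 0 < 2 - c + b \<and> 2 - c + b < 1 / 2 \<longrightarrow>
       (\<forall>p q :: ereal. 1 \<le> p \<and> 1 \<le> q \<and>
        (1 / q = 1 / p + ereal (c - a - b - 2) \<and> ereal (- a) < 1 / q \<or>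
         0 \<le> 1 / p \<and> 1 / p < ereal (2 - c + b) \<and> q = ereal (- 1 / a)) \<longrightarrow>
        T_bounded a b c (Lp_norm p) (weak_Lp_norm q) \<and>
        S_bounded a b c (Lp_norm p) (weak_Lp_norm q)) \<and>
       (\<not> T_bounded a b c (Lp_norm (ereal (1 / (2 - c + b)))) (weak_Lp_norm (ereal (- 1 / a))) \<and>
        \<not> S_bounded a b c (Lp_norm (ereal (1 / (2 - c + b)))) (weak_Lp_norm (ereal (- 1 / a)))) \<and>
       (T_bounded a b c (Lorentz1_norm (1 / (2 - c + b))) (weak_Lp_norm (ereal (- 1 / a))) \<and>
        S_bounded a b c (Lorentz1_norm (1 / (2 - c + b))) (weak_Lp_norm (ereal (- 1 / a))))) \<and>
     (b + 1 = 3 + a + b - c \<and> 0 < 2 - c + b \<and> 2 - c + b < 1 / 2 \<longrightarrow>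
       (\<forall>p q :: ereal. 1 \<le> p \<and> 1 \<le> q \<and>
        (1 / q = 1 / p + ereal (c - a - b - 2) \<and> ereal (- a) < 1 / q \<and> 1 / q < 1 \<or>
         0 \<le> 1 / p \<and> 1 / p < ereal (2 - c + b) \<and> q = ereal (- 1 / a)) \<longrightarrow>
        T_bounded a b c (Lp_norm p) (weak_Lp_norm q) \<and>
        S_bounded a b c (Lp_norm p) (weak_Lp_norm q)) \<and>
       (\<not> T_bounded a b c (Lp_norm (ereal (1 / (2 - c + b)))) (weak_Lp_norm (ereal (- 1 / a))) \<and>
        \<not> S_bounded a b c (Lp_norm (ereal (1 / (2 - c + b)))) (weak_Lp_norm (ereal (- 1 / a)))) \<and>
       (\<not> T_bounded a b c (Lp_norm (ereal (1 / (3 + a + b - c)))) (weak_Lp_norm 1) \<and>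
        \<not> S_bounded a b c (Lp_norm (ereal (1 / (3 + a + b - c)))) (weak_Lp_norm 1)) \<and>
       (T_bounded a b c (Lorentz1_norm (1 / (2 - c + b))) (weak_Lp_norm (ereal (- 1 / a))) \<and>
        S_bounded a b c (Lorentz1_norm (1 / (2 - c + b))) (weak_Lp_norm (ereal (- 1 / a)))) \<and>
       (T_bounded a b c (Lorentz1_norm (1 / (3 + a + b - c))) (weak_Lp_norm 1) \<and>
        S_bounded a b c (Lorentz1_norm (1 / (3 + a + b - c))) (weak_Lp_norm 1))) \<and>
     (b + 1 \<noteq> 3 + a + b - c \<and> 1 / 2 \<le> 2 - c + b \<and> 2 - c + b < 1 \<longrightarrow>
       (\<forall>p q :: ereal. 1 \<le> p \<and> 1 \<le> q \<and>
        (1 / q = 1 / p + ereal (c - a - b - 2) \<and> ereal (- a) < 1 / q \<or>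
         0 \<le> 1 / p \<and> 1 / p < ereal (2 - c + b) \<and> q = ereal (- 1 / a)) \<longrightarrow>
        T_bounded a b c (Lp_norm p) (weak_Lp_norm q) \<and>
        S_bounded a b c (Lp_norm p) (weak_Lp_norm q)) \<and>
       (T_bounded a b c (Lp_norm (ereal (1 / (2 - c + b)))) (weak_Lp_norm (ereal (- 1 / a))) \<and>
        \<not> S_bounded a b c (Lp_norm (ereal (1 / (2 - c + b)))) (weak_Lp_norm (ereal (- 1 / a)))) \<and>
       (T_bounded a b c (Lorentz1_norm (1 / (2 - c + b))) (weak_Lp_norm (ereal (- 1 / a))) \<and>
        S_bounded a b c (Lorentz1_norm (1 / (2 - c + b))) (weak_Lp_norm (ereal (- 1 / a))))) \<and>
     (b + 1 = 3 + a + b - c \<and> 1 / 2 \<le> 2 - c + b \<and> 2 - c + b < 1 \<longrightarrow>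
       (\<forall>p q :: ereal. 1 \<le> p \<and> 1 \<le> q \<and>
        (1 / q = 1 / p + ereal (c - a - b - 2) \<and> ereal (- a) < 1 / q \<and> 1 / q < 1 \<or>
         0 \<le> 1 / p \<and> 1 / p < ereal (2 - c + b) \<and> q = ereal (- 1 / a)) \<longrightarrow>
        T_bounded a b c (Lp_norm p) (weak_Lp_norm q) \<and>
        S_bounded a b c (Lp_norm p) (weak_Lp_norm q)) \<and>
       (\<not> T_bounded a b c (Lp_norm (ereal (1 / (3 + a + b - c)))) (weak_Lp_norm 1) \<and>
        \<not> S_bounded a b c (Lp_norm (ereal (1 / (3 + a + b - c)))) (weak_Lp_norm 1)) \<and>
       (T_bounded a b c (Lp_norm (ereal (1 / (2 - c + b)))) (weak_Lp_norm (ereal (- 1 / a))) \<and>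
        \<not> S_bounded a b c (Lp_norm (ereal (1 / (2 - c + b)))) (weak_Lp_norm (ereal (- 1 / a)))) \<and>
       (T_bounded a b c (Lorentz1_norm (1 / (2 - c + b))) (weak_Lp_norm (ereal (- 1 / a))) \<and>
        S_bounded a b c (Lorentz1_norm (1 / (2 - c + b))) (weak_Lp_norm (ereal (- 1 / a)))) \<and>
       (T_bounded a b c (Lorentz1_norm (1 / (3 + a + b - c))) (weak_Lp_norm 1) \<and>
        S_bounded a b c (Lorentz1_norm (1 / (3 + a + b - c))) (weak_Lp_norm 1)))"
proof -
  have c: "1 < c" using assms by simp
  have sub1: "T_bounded a b c (Lp_norm p) (weak_Lp_norm q) \<and> S_bounded a b c (Lp_norm p) (weak_Lp_norm q)"
    if "0 < 2 - c + b" "1 \<le> p" "1 \<le> q" "0 \<le> 1 / p \<and> 1 / p < ereal (2 - c + b) \<and> q = ereal (- 1 / a)" for p q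
  proof -
    have "1 / p < ereal (b + 2 - c)" using that by (simp add: algebra_simps)
    then show ?thesis
      using T_S_bounded_Lp_small[OF c, of a b p] assms that by simp
  qed
  have sub2: "T_bounded a b c (Lp_norm p) (weak_Lp_norm q) \<and> S_bounded a b c (Lp_norm p) (weak_Lp_norm q)"
    if "0 < 2 - c + b" "1 \<le> p" "1 \<le> q" "1 / q = 1 / p + ereal (c - a - b - 2)" "ereal (- a) < 1 / q"
      "b + 1 \<noteq> 3 + a + b - c \<or> 1 / q < 1" for p q
    using T_S_bounded_diagonal[OF c, of a b p q] assms that by simp
  have lor1: "T_bounded a b c (Lorentz1_norm (1 / (2 - c + b))) (weak_Lp_norm (ereal (- 1 / a))) \<and>
      S_bounded a b c (Lorentz1_norm (1 / (2 - c + b))) (weak_Lp_norm (ereal (- 1 / a)))" if \<sigma>: "0 < 2 - c + b"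
  proof (rule T_S_bounded_Lorentz[OF c \<sigma>])
    \<comment> \<open>With \<sigma> = 2 - c + b the hypothesis 0 < c - a - b - 2 reads \<sigma> <
      -a, so \<sigma> > 0 forces a < 0.\<close>
    have a: "a < 0" using assms \<sigma> by simp
    then have q: "1 / (- 1 / a) = - a" "0 < - 1 / a" by (simp_all add: divide_neg_neg)
    show "2 - c + b < 1" "2 - c + b < 1 / (- 1 / a)" "0 < - 1 / a"
      unfolding q(1) using assms q(2) by auto
    fix v u :: real assume "0 < v" "v \<le> 1" "0 < u" "u < 1"
    \<comment> \<open>The kernel bound that is sharp for u >= v is used on the whole disc; the
      exponent of v vanishes because q = -1/a.\<close>
    then show "radial_weight b c v u \<le> v powr (- (a + 1 / (- 1 / a))) * u powr (2 - c + b - 1)"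
      unfolding q(1) using radial_weight_le_powr(1)[OF c, of u v b] by (simp add: algebra_simps)
  qed
  have lor2: "T_bounded a b c (Lorentz1_norm (1 / (3 + a + b - c))) (weak_Lp_norm 1) \<and>
      S_bounded a b c (Lorentz1_norm (1 / (3 + a + b - c))) (weak_Lp_norm 1)" if eq: "b + 1 = 3 + a + b - c"
    unfolding one_ereal_def
  proof (rule T_S_bounded_Lorentz[OF c])
    show "0 < 3 + a + b - c" "3 + a + b - c < 1" "0 < (1::real)" "3 + a + b - c < 1 / 1"
      using assms eq by auto
    have ca: "a = c - 2" using eq by simp
    fix v u :: real assume "0 < v" "v \<le> 1" "0 < u" "u < 1"
    \<comment> \<open>With a = c - 2 and q = 1 the exponent a + 1/q is c - 1, so the kernel bound
      that is sharp for u <= v is the required majorant.\<close>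
    then show "radial_weight b c v u \<le> v powr (- (a + 1 / 1)) * u powr (3 + a + b - c - 1)"
      unfolding ca using radial_weight_le_powr(2)[OF c, of u v b] by (simp add: mult.commute)
  qed
  have neg1: "\<not> T_bounded a b c (Lp_norm (ereal (1 / (3 + a + b - c)))) (weak_Lp_norm 1) \<and>
      \<not> S_bounded a b c (Lp_norm (ereal (1 / (3 + a + b - c)))) (weak_Lp_norm 1)"
    if eq: "b + 1 = 3 + a + b - c" and \<sigma>: "0 < 2 - c + b"
  proof -
    \<comment> \<open>The critical exponent is p = 1 / (b + 1). In this case a = c - 2, and then 0 <
      c - a - b - 2 says b < 0, so that p > 1.\<close>
    have "0 < b + 1" "b + 1 < 1" using assms eq by auto
    then have "1 < 1 / (b + 1)" "b = - 1 + 1 / (1 / (b + 1))" by (auto simp: field_simps)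
    then show ?thesis
      using T_S_unbounded_weak_L1[of c a "1 / (b + 1)" b] c assms \<sigma> unfolding eq[symmetric] by simp
  qed
  have neg2: "\<not> S_bounded a b c (Lp_norm (ereal (1 / (2 - c + b)))) (weak_Lp_norm (ereal (- 1 / a)))"
    if \<sigma>: "0 < 2 - c + b"
  proof -
    have "2 - c + b < 1" using assms by simp
    then have "1 < 1 / (2 - c + b)" using \<sigma> by simp
    then show ?thesis
      using assms \<sigma> by (intro S_unbounded_corner c) auto
  qed
  have neg3: "\<not> T_bounded a b c (Lp_norm (ereal (1 / (2 - c + b)))) (weak_Lp_norm (ereal (- 1 / a)))"
    if \<sigma>: "0 < 2 - c + b" "2 - c + b < 1 / 2"
  proof -
    have "2 < 1 / (2 - c + b)" using \<sigma> by (simp add: field_simps)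
    then show ?thesis
      using assms \<sigma> by (intro T_unbounded_corner c) auto
  qed
  have pos: "T_bounded a b c (Lp_norm (ereal (1 / (2 - c + b)))) (weak_Lp_norm (ereal (- 1 / a)))"
    if \<sigma>: "1 / 2 \<le> 2 - c + b" "2 - c + b < 1"
  proof -
    have "1 < 1 / (2 - c + b)" "1 / (2 - c + b) \<le> 2" using \<sigma> by (simp_all add: field_simps)
    then show ?thesis
      using assms \<sigma> by (intro T_bounded_Lp_corner c) auto
  qed
  have half: "0 < 2 - c + b" if "1 / 2 \<le> 2 - c + b" using that by simp
  show ?thesis
    by (intro conjI impI allI; elim conjE disjE; (use sub1 sub2 lor1 lor2 neg1 neg2 neg3 pos half in blast))
qed

end
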